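(* Let $f$ be a nonconstant meromorphic function on $\mathbb C$, and let $a_1,\dots,a_q$ be distinct points in $\overline{\mathbb C}$. Then for any $\delta>0$ $$(q-2)T_f(r)\le\sum_{j=1}^q\overline N_f(r,a_j)+O\Big(\log T_f(r)+\delta\log r\Big)$$ holds for all $r\in(0,\infty)$ outside a set $E_\delta$ of finite Lebesgue measure.
   Context: Let $D(r)=\{z\in\mathbb C:|z|<r\}$, $dd^c=\frac{\sqrt{-1}}{2\pi}\partial\bar\partial$, and let $\omega_{FS}=dd^c\log(|\zeta_0|^2+|\zeta_1|^2)$ be the Fubini–Study form on $\mathbb P^1(\mathbb C)=\overline{\mathbb C}$. For $r>1$, viewing $f$ as a holomorphic map to $\mathbb P^1(\mathbb C)$, $$T_f(r)=\int_1^r\frac{dt}{t}\int_{D(t)}f^*\omega_{FS},\qquad \overline N_f(r,a)=\int_1^r\frac{\overline n_f(t,a)}{t}dt,$$ where $\overline n_f(t,a)$ is the number of points of $D(t)$ where $f=a$ (poles if $a=\infty$), counted without multiplicity. Convention: the error term $O(A_1+\cdots+A_m)$ denotes a quantity bounded above by $C(1+A_1^++\cdots+A_m^+)$ with $A^+=\max(A,0)$ and $C$ a constant independent of $r$ and $\delta$; the interval $(0,1]$, where the functions are not defined, is understood to be contained in $E_\delta$. *)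

theory Defs
  imports "HOL-Complex_Analysis.Complex_Analysis"
begin

text \<open>
  The Riemann sphere is \<^typ>\<open>complex option\<close>, with \<^term>\<open>None\<close> for the point at infinity; in homogeneous
  coordinates \<^term>\<open>Some w\<close> is $[1:w]$ and \<^term>\<open>None\<close> is $[0:1]$.  Meromorphic functions are
  taken to be nicely meromorphic: continuous off the poles, with the dummy value 0 at a pole.
\<close>

definition sphere_map :: "(complex \<Rightarrow> complex) \<Rightarrow> complex \<Rightarrow> complex option" where
  "sphere_map f z = (if is_pole f z then None else Some (f z))"

definition wirtinger :: "(complex \<Rightarrow> complex) \<Rightarrow> complex \<Rightarrow> complex" where
  "wirtinger u z =
     (frechet_derivative u (at z) 1 - \<i> * frechet_derivative u (at z) \<i>) / 2"

definition wirtinger_bar :: "(complex \<Rightarrow> complex) \<Rightarrow> complex \<Rightarrow> complex" where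
  "wirtinger_bar u z =
     (frechet_derivative u (at z) 1 + \<i> * frechet_derivative u (at z) \<i>) / 2"

text \<open>
  A (1,1)-form on a coordinate domain is represented by its density with respect to
  $dx \wedge dy$.  The factor $-2i$ comes from $dz \wedge d\bar z = -2i\, dx \wedge dy$.
\<close>

definition ddc_density :: "(complex \<Rightarrow> real) \<Rightarrow> complex \<Rightarrow> real" where
  "ddc_density u z =
     Re (\<i> / (2 * of_real pi) * wirtinger (wirtinger_bar (\<lambda>w. of_real (u w))) z * (-2 * \<i>))"

definition fs_potential :: "complex \<Rightarrow> complex \<Rightarrow> real" where
  "fs_potential \<zeta>0 \<zeta>1 = ln ((cmod \<zeta>0)\<^sup>2 + (cmod \<zeta>1)\<^sup>2)"

text \<open>
  The density of the pullback of the Fubini--Study form is its density in a chart, evaluated at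
  the image point, times the Jacobian determinant $|g'|^2$ of the coordinate expression $g$ of the map.
  Off the poles the chart is $w \mapsto [1:w]$, with $g = f$; at a pole it is $w \mapsto [w:1]$,
  with $g = 1/f$ (which takes the value 0 at the pole, since 1/0 = 0 here).
\<close>

definition fs_pullback_density :: "(complex \<Rightarrow> complex) \<Rightarrow> complex \<Rightarrow> real" where
  "fs_pullback_density f z =
     (if is_pole f z
      then ddc_density (\<lambda>w. fs_potential w 1) (inverse (f z))
             * (cmod (deriv (\<lambda>w. inverse (f w)) z))\<^sup>2
      else ddc_density (\<lambda>w. fs_potential 1 w) (f z) * (cmod (deriv f z))\<^sup>2)"

definition nevanlinna_T :: "(complex \<Rightarrow> complex) \<Rightarrow> real \<Rightarrow> real" where
  "nevanlinna_T f r =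
     (LBINT t:{1..r}. (LINT z:ball 0 t|lborel. fs_pullback_density f z) / t)"

definition nbar :: "(complex \<Rightarrow> complex) \<Rightarrow> real \<Rightarrow> complex option \<Rightarrow> nat" where
  "nbar f t a = card {z \<in> ball 0 t. sphere_map f z = a}"

definition nevanlinna_Nbar :: "(complex \<Rightarrow> complex) \<Rightarrow> real \<Rightarrow> complex option \<Rightarrow> real" where
  "nevanlinna_Nbar f r a = (LBINT t:{1..r}. real (nbar f t a) / t)"

end

theory Submission
  imports Defs
begin

text \<open>
  The proof follows F. Nevanlinna and Ahlfors: it uses a singular conformal metric of negative curvature on the
  sphere minus the targets, in place of the lemma on the logarithmic derivative.
  
  Write f = F1 / F0 with entire F0, F1 without common zeros, let W be their Wronskian, |F|^2 =
  |F0|^2 + |F1|^2, and let g_j be the linear form in F0, F1 that vanishes where f takes the value a_j.  The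
  Laplacian of ln |F| is twice the squared spherical derivative |W|^2 / |F|^4, so by Green's formula
  T(r) is the mean of ln |F| over the circle of radius r minus its mean over the unit circle
  (\<open>nevanlinna_T_eq_circle_mean\<close>).
  
  Jensen's inequality is used for the product of the g_j divided by W.  A zero of g_j of order m is a zero of W of order
  at least m - 1, so every point with value a_j costs at most a simple zero: the mean of the sum of the ln |g_j|
  minus ln |W| is at most the sum of the truncated counting functions plus a constant
  (\<open>ramified_quotient\<close>, \<open>circle_mean_ln_forms_le\<close>).  Let s_j be the squared chordal distance
  of f to a_j.  Up to constants, the difference between (q - 2) T and that mean is half the mean of
  ln (|W|^2 |F|^(-4) / (s_1 ... s_q)).  It remains to bound this mean from above.
  
  The density |W|^2 |F|^(-4) / (s_j (3 - ln s_j)^2) is, up to a multiple of |W|^2 |F|^(-4), at most the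
  Laplacian of the function -ln (3 - ln s_j), which is bounded above
  (\<open>curvature_potential\<close>).  The mean over circles turns the Laplacian into
  a second derivative in r, and Borel's growth lemma bounds that by r^\<delta> times a power of 1 + T for
  all r outside a set of finite measure (\<open>circle_mean_laplacian_le\<close>).  At
  most one s_j is small at a time, so the product of the 1 / (s_j (3 - ln s_j)^2) is
  dominated by their sum.  Since the logarithm is concave, the mean of the logarithm of the product
  is O(ln T + \<delta> ln r), and the extra factors (3 - ln s_j)^2 cost only O(ln T), because the
  mean of -ln s_j is at most 2 T plus a constant.
  
  The singularities at the points with value a_j are avoided by working with s_j + e.  The
  exceptional sets have measures bounded independently of e, so their lower limit as e tends to 0
  still has finite measure (\<open>chordal_average_bound\<close>).
\<close>

section \<open>Functions with a continuous Laplacian\<close>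

text \<open>
  Here D is v_x - i v_y, twice the Wirtinger derivative of v, so that the first differential of v
  is the real part of D h.  The anti-linear part of the differential of D is then half the
  Laplacian, which is how L is tied to v without naming second partial derivatives.
\<close>

definition potential_on :: "complex set \<Rightarrow> (complex \<Rightarrow> real) \<Rightarrow> (complex \<Rightarrow> complex) \<Rightarrow> (complex \<Rightarrow> real) \<Rightarrow> bool" where
  "potential_on U v D L \<longleftrightarrow>
     (\<forall>z\<in>U. (v has_derivative (\<lambda>h. Re (D z * h))) (at z)) \<and> continuous_on U L \<and>
     (\<exists>A. continuous_on U A \<and>
        (\<forall>z\<in>U. (D has_derivative (\<lambda>h. A z * h + of_real (L z / 2) * cnj h)) (at z)))"

lemma potential_onD:
  assumes "potential_on U v D L"
  shows "continuous_on U v" "continuous_on U D" "continuous_on U L"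
proof -
  show "continuous_on U v"
    using assms unfolding potential_on_def
    by (meson continuous_at_imp_continuous_on has_derivative_continuous)
  show "continuous_on U D"
    using assms unfolding potential_on_def
    by (meson continuous_at_imp_continuous_on has_derivative_continuous)
qed (use assms in \<open>auto simp: potential_on_def\<close>)

lemma potential_on_const: "potential_on U (\<lambda>_. c) (\<lambda>_. 0) (\<lambda>_. 0)"
  unfolding potential_on_def by (auto intro!: exI[of _ "\<lambda>_. 0"] derivative_eq_intros)

lemma potential_on_add:
  assumes "potential_on U v D L" "potential_on U w E M"
  shows "potential_on U (\<lambda>z. v z + w z) (\<lambda>z. D z + E z) (\<lambda>z. L z + M z)"
proof -
  obtain A where A: "continuous_on U A"
    "\<And>z. z \<in> U \<Longrightarrow> (D has_derivative (\<lambda>h. A z * h + of_real (L z / 2) * cnj h)) (at z)"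
    using assms(1) unfolding potential_on_def by auto
  obtain B where B: "continuous_on U B"
    "\<And>z. z \<in> U \<Longrightarrow> (E has_derivative (\<lambda>h. B z * h + of_real (M z / 2) * cnj h)) (at z)"
    using assms(2) unfolding potential_on_def by auto
  have 1: "((\<lambda>z. v z + w z) has_derivative (\<lambda>h. Re ((D z + E z) * h))) (at z)" if "z \<in> U" for z
    using that assms unfolding potential_on_def
    by (auto intro!: derivative_eq_intros simp: algebra_simps)
  have 2: "((\<lambda>z. D z + E z) has_derivative (\<lambda>h. (A z + B z) * h + of_real ((L z + M z) / 2) * cnj h)) (at z)" 
    if "z \<in> U" for z
    by (rule has_derivative_eq_rhs[OF has_derivative_add[OF A(2)[OF that] B(2)[OF that]]])
       (simp add: fun_eq_iff algebra_simps add_divide_distrib)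
  show ?thesis
    unfolding potential_on_def using 1 2 A(1) B(1) assms
    by (auto intro!: exI[of _ "\<lambda>z. A z + B z"] continuous_intros simp: potential_on_def)
qed

lemma potential_on_cmult:
  assumes "potential_on U v D L"
  shows "potential_on U (\<lambda>z. c * v z) (\<lambda>z. of_real c * D z) (\<lambda>z. c * L z)"
proof -
  obtain A where A: "continuous_on U A"
    "\<And>z. z \<in> U \<Longrightarrow> (D has_derivative (\<lambda>h. A z * h + of_real (L z / 2) * cnj h)) (at z)"
    using assms(1) unfolding potential_on_def by auto
  have 1: "((\<lambda>z. c * v z) has_derivative (\<lambda>h. Re ((of_real c * D z) * h))) (at z)" if "z \<in> U" for z
    using that assms unfolding potential_on_def
    by (auto intro!: derivative_eq_intros simp: algebra_simps)
  have 2: "((\<lambda>z. of_real c * D z) has_derivative (\<lambda>h. (of_real c * A z) * h + of_real ((c * L z) / 2) * cnj h)) (at z)" 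
    if "z \<in> U" for z
    by (rule has_derivative_eq_rhs[OF has_derivative_mult_right[OF A(2)[OF that]]])
       (simp add: fun_eq_iff algebra_simps)
  show ?thesis
    unfolding potential_on_def using 1 2 A(1) assms
    by (auto intro!: exI[of _ "\<lambda>z. of_real c * A z"] continuous_intros simp: potential_on_def)
qed

lemma potential_on_sum:
  assumes "\<And>i. i \<in> I \<Longrightarrow> potential_on U (v i) (D i) (L i)"
  shows "potential_on U (\<lambda>z. \<Sum>i\<in>I. v i z) (\<lambda>z. \<Sum>i\<in>I. D i z) (\<lambda>z. \<Sum>i\<in>I. L i z)"
  using assms
  by (induction I rule: infinite_finite_induct) (auto intro: potential_on_const potential_on_add)

lemma Re_eq_half_sum_cnj: "of_real (Re w) = (w + cnj w) / 2"
  by (simp add: complex_add_cnj)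

text \<open>
  The chain rule: the Laplacian of k(v) is k''(v) |grad v|^2 + k'(v) times the Laplacian of v.
\<close>

lemma potential_on_compose:
  assumes v: "potential_on U v D L"
    and k: "\<And>z. z \<in> U \<Longrightarrow> (k has_real_derivative k' (v z)) (at (v z))"
    and k': "\<And>z. z \<in> U \<Longrightarrow> (k' has_real_derivative k'' (v z)) (at (v z))"
    and cont: "continuous_on U (\<lambda>z. k'' (v z))"
  shows "potential_on U (\<lambda>z. k (v z)) (\<lambda>z. of_real (k' (v z)) * D z)
           (\<lambda>z. k'' (v z) * (cmod (D z))\<^sup>2 + k' (v z) * L z)"
proof -
  obtain A where A: "continuous_on U A"
    "\<And>z. z \<in> U \<Longrightarrow> (D has_derivative (\<lambda>h. A z * h + of_real (L z / 2) * cnj h)) (at z)"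
    using assms(1) unfolding potential_on_def by auto
  have dv: "(v has_derivative (\<lambda>h. Re (D z * h))) (at z)" if "z \<in> U" for z
    using v that by (auto simp: potential_on_def)
  have ck': "continuous_on U (\<lambda>z. k' (v z))"
  proof (intro continuous_at_imp_continuous_on ballI)
    fix z assume z: "z \<in> U"
    have "isCont k' (v z)" using k'[OF z] by (rule DERIV_isCont)
    moreover have "isCont v z" using dv[OF z] by (rule has_derivative_continuous)
    ultimately show "isCont (\<lambda>z. k' (v z)) z" by (rule isCont_o2[rotated])
  qed
  have 1: "((\<lambda>z. k (v z)) has_derivative (\<lambda>h. Re ((of_real (k' (v z)) * D z) * h))) (at z)"
    if "z \<in> U" for z
    using has_derivative_compose[OF dv[OF that] k[OF that, unfolded has_field_derivative_def]]
    by (simp add: algebra_simps)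
  have dk: "((\<lambda>z. k' (v z)) has_derivative (\<lambda>h. k'' (v z) * Re (D z * h))) (at z)"
    if "z \<in> U" for z
    using has_derivative_compose[OF dv[OF that] k'[OF that, unfolded has_field_derivative_def]]
    by (simp add: algebra_simps)
  let ?A = "\<lambda>z. of_real (k'' (v z) / 2) * (D z)\<^sup>2 + of_real (k' (v z)) * A z"
  have 2: "((\<lambda>z. of_real (k' (v z)) * D z) has_derivative
       (\<lambda>h. ?A z * h + of_real ((k'' (v z) * (cmod (D z))\<^sup>2 + k' (v z) * L z) / 2) * cnj h)) (at z)"
    if "z \<in> U" for z
  proof (rule has_derivative_eq_rhs[OF has_derivative_mult[OF has_derivative_of_real[OF dk[OF that]] A(2)[OF that]]], rule ext)
    fix h
    have 1: "complex_of_real (Re (D z * h)) = (D z * h + cnj (D z) * cnj h) / 2"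
      by (simp only: Re_eq_half_sum_cnj complex_cnj_mult)
    show "of_real (k' (v z)) * (A z * h + of_real (L z / 2) * cnj h) + of_real (k'' (v z) * Re (D z * h)) * D z =
       ?A z * h + of_real ((k'' (v z) * (cmod (D z))\<^sup>2 + k' (v z) * L z) / 2) * cnj h"
      unfolding of_real_mult 1 of_real_divide of_real_add complex_norm_square
      by (simp add: field_simps power2_eq_square)
  qed
  show ?thesis
    unfolding potential_on_def using 1 2
    by (auto intro!: exI[of _ "?A"] continuous_intros cont ck' A(1) potential_onD[OF v])
qed

text \<open>
  Differentiating N / Q, where Q = |G|^2 + |H|^2 and N = G' cnj G + H' cnj H, leaves
  (|G'|^2 + |H'|^2) Q - |N|^2 in the numerator, and by Lagrange's identity this is the squared
  modulus of the Wronskian of G and H.  Thus the Laplacian is the pulled back Fubini--Study density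
  of the map [G : H], up to a constant factor.
\<close>

lemma potential_on_ln_norms:
  assumes U: "open U" and G: "G holomorphic_on U" and H: "H holomorphic_on U"
    and nz: "\<And>z. z \<in> U \<Longrightarrow> G z \<noteq> 0 \<or> H z \<noteq> 0"
  shows "potential_on U (\<lambda>z. ln ((cmod (G z))\<^sup>2 + (cmod (H z))\<^sup>2))
     (\<lambda>z. 2 * (deriv G z * cnj (G z) + deriv H z * cnj (H z)) / of_real ((cmod (G z))\<^sup>2 + (cmod (H z))\<^sup>2))
     (\<lambda>z. 4 * (cmod (G z * deriv H z - deriv G z * H z))\<^sup>2 / ((cmod (G z))\<^sup>2 + (cmod (H z))\<^sup>2)\<^sup>2)"
proof -
  define Q where "Q = (\<lambda>z. (cmod (G z))\<^sup>2 + (cmod (H z))\<^sup>2)"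
  define Qc where "Qc = (\<lambda>z. G z * cnj (G z) + H z * cnj (H z))"
  define N where "N = (\<lambda>z. deriv G z * cnj (G z) + deriv H z * cnj (H z))"
  have Qc: "Qc z = of_real (Q z)" for z
    by (simp add: Qc_def Q_def complex_norm_square flip: of_real_power)
  have Qpos: "Q z > 0" if "z \<in> U" for z
    using nz[OF that] by (auto simp: Q_def add_pos_nonneg add_nonneg_pos)
  have Qc0: "Qc z \<noteq> 0" if "z \<in> U" for z
    using Qpos[OF that] by (auto simp: Qc)
  have hol: "deriv G holomorphic_on U" "deriv H holomorphic_on U"
    "deriv (deriv G) holomorphic_on U" "deriv (deriv H) holomorphic_on U"
    using assms by (auto intro!: holomorphic_deriv)
  have d: "(F has_derivative (\<lambda>h. deriv F z * h)) (at z)" if "z \<in> U" "F holomorphic_on U" for F z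
    using holomorphic_derivI[OF that(2) U that(1)] by (simp add: has_field_derivative_def)
  have dc: "((\<lambda>z. cnj (F z)) has_derivative (\<lambda>h. cnj (deriv F z * h))) (at z)"
    if "z \<in> U" "F holomorphic_on U" for F z
    using bounded_linear.has_derivative[OF bounded_linear_cnj d[OF that]] .
  have dQc: "(Qc has_derivative (\<lambda>h. N z * h + cnj (N z) * cnj h)) (at z)" if "z \<in> U" for z
    unfolding Qc_def N_def
    by (rule has_derivative_eq_rhs[OF has_derivative_add[OF has_derivative_mult[OF d[OF that G] dc[OF that G]]
          has_derivative_mult[OF d[OF that H] dc[OF that H]]]])
       (simp add: fun_eq_iff algebra_simps)
  have dQ: "(Q has_derivative (\<lambda>h. 2 * Re (N z * h))) (at z)" if "z \<in> U" for z
    using bounded_linear.has_derivative[OF bounded_linear_Re dQc[OF that]]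
    by (simp add: Qc algebra_simps)
  have 1: "((\<lambda>z. ln (Q z)) has_derivative (\<lambda>h. Re ((2 * N z / of_real (Q z)) * h))) (at z)" if "z \<in> U" for z
  proof -
    have "((\<lambda>z. ln (Q z)) has_derivative (\<lambda>h. 2 * Re (N z * h) / Q z)) (at z)"
      by (rule derivative_eq_intros dQ that Qpos)+ (simp add: field_simps)
    also have "(\<lambda>h. 2 * Re (N z * h) / Q z) = (\<lambda>h. Re ((2 * N z / of_real (Q z)) * h))"
      by (simp add: Re_divide_of_real flip: of_real_mult) (simp add: fun_eq_iff diff_divide_distrib right_diff_distrib)
    finally show ?thesis .
  qed
  let ?M = "\<lambda>z. deriv (deriv G) z * cnj (G z) + deriv (deriv H) z * cnj (H z)"
  let ?P = "\<lambda>z. deriv G z * cnj (deriv G z) + deriv H z * cnj (deriv H z)"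
  let ?W = "\<lambda>z. G z * deriv H z - deriv G z * H z"
  have dN: "(N has_derivative (\<lambda>h. ?M z * h + ?P z * cnj h)) (at z)" if "z \<in> U" for z
    unfolding N_def
    by (rule has_derivative_eq_rhs[OF has_derivative_add[OF has_derivative_mult[OF d[OF that hol(1)] dc[OF that G]]
          has_derivative_mult[OF d[OF that hol(2)] dc[OF that H]]]])
       (simp add: fun_eq_iff algebra_simps)
  have W: "?P z * Qc z - N z * cnj (N z) = ?W z * cnj (?W z)" for z
    by (simp add: N_def Qc_def algebra_simps)
  let ?A = "\<lambda>z. 2 * (?M z * Qc z - N z * N z) / (Qc z * Qc z)"
  have 2: "((\<lambda>z. 2 * N z / of_real (Q z)) has_derivative
       (\<lambda>h. ?A z * h + of_real (4 * (cmod (?W z))\<^sup>2 / (Q z)\<^sup>2 / 2) * cnj h)) (at z)"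
    if "z \<in> U" for z
  proof -
    have *: "of_real (4 * (cmod (?W z))\<^sup>2 / (Q z)\<^sup>2 / 2) = 2 * (?P z * Qc z - N z * cnj (N z)) / (Qc z * Qc z)"
      unfolding W unfolding Qc unfolding complex_norm_square[symmetric] by (simp add: power2_eq_square)
    have "((\<lambda>z. 2 * N z / Qc z) has_derivative
       (\<lambda>h. ?A z * h + of_real (4 * (cmod (?W z))\<^sup>2 / (Q z)\<^sup>2 / 2) * cnj h)) (at z)"
      unfolding *
      by (rule has_derivative_eq_rhs[OF has_derivative_divide'[OF has_derivative_mult_right[OF dN[OF that]] dQc[OF that] Qc0[OF that]]])
         (use Qc0[OF that] in \<open>simp add: fun_eq_iff field_simps\<close>)
    thus ?thesis by (simp add: Qc)
  qed
  have cont: "continuous_on U G" "continuous_on U H" "continuous_on U (deriv G)" "continuous_on U (deriv H)"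
     "continuous_on U (deriv (deriv G))" "continuous_on U (deriv (deriv H))"
    using G H hol by (auto intro: holomorphic_on_imp_continuous_on)
  have 3: "continuous_on U ?A"
    using cont Qc0 unfolding N_def Qc_def by (intro continuous_intros) auto
  have 4: "continuous_on U (\<lambda>z. 4 * (cmod (?W z))\<^sup>2 / (Q z)\<^sup>2)"
    using cont Qpos unfolding Q_def by (intro continuous_intros) (use nz in \<open>auto simp: power2_eq_square add_nonneg_eq_0_iff\<close>)
  show ?thesis
    using 1 2 3 4 unfolding potential_on_def N_def Q_def by blast
qed

section \<open>Means over circles\<close>

definition circle_mean :: "(complex \<Rightarrow> real) \<Rightarrow> real \<Rightarrow> real" where
  "circle_mean v r = integral {0..2*pi} (\<lambda>\<theta>. v (rcis r \<theta>)) / (2 * pi)"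

lemma continuous_on_rcis [continuous_intros]:
  assumes "continuous_on S f" "continuous_on S g"
  shows "continuous_on S (\<lambda>x. rcis (f x) (g x))"
  unfolding rcis_def using assms by (intro continuous_intros)

lemma circle_mean_integrable:
  fixes v :: "complex \<Rightarrow> real"
  assumes "continuous_on (sphere 0 r) v" "r \<ge> 0"
  shows "(\<lambda>\<theta>. v (rcis r \<theta>)) integrable_on {0..2*pi}"
  by (intro integrable_continuous_real continuous_on_compose2[OF assms(1)] continuous_intros) (use assms in auto)

lemma circle_mean_add:
  assumes "continuous_on (sphere 0 r) v" "continuous_on (sphere 0 r) w" "r \<ge> 0"
  shows "circle_mean (\<lambda>z. v z + w z) r = circle_mean v r + circle_mean w r"
  unfolding circle_mean_def
  by (subst integral_add) (use assms circle_mean_integrable in \<open>auto simp: add_divide_distrib\<close>)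

lemma circle_mean_diff:
  assumes "continuous_on (sphere 0 r) v" "continuous_on (sphere 0 r) w" "r \<ge> 0"
  shows "circle_mean (\<lambda>z. v z - w z) r = circle_mean v r - circle_mean w r"
  unfolding circle_mean_def
  by (subst integral_diff) (use assms circle_mean_integrable in \<open>auto simp: diff_divide_distrib\<close>)

lemma circle_mean_cmult: "circle_mean (\<lambda>z. c * v z) r = c * circle_mean v r"
  by (simp add: circle_mean_def)

lemma circle_mean_const [simp]: "circle_mean (\<lambda>z. c) r = c"
  by (simp add: circle_mean_def)

lemma circle_mean_sum:
  assumes "\<And>i. i \<in> I \<Longrightarrow> continuous_on (sphere 0 r) (v i)" "r \<ge> 0"
  shows "circle_mean (\<lambda>z. \<Sum>i\<in>I. v i z) r = (\<Sum>i\<in>I. circle_mean (v i) r)"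
  using assms
proof (induction I rule: infinite_finite_induct)
  case (insert i I)
  thus ?case by (simp add: circle_mean_add continuous_on_sum)
qed simp_all

lemma circle_mean_cong:
  assumes "\<And>z. norm z = r \<Longrightarrow> v z = w z" "r \<ge> 0"
  shows "circle_mean v r = circle_mean w r"
  unfolding circle_mean_def using assms by (auto intro!: integral_cong)

lemma circle_mean_mono:
  assumes "continuous_on (sphere 0 r) v" "continuous_on (sphere 0 r) w" "r \<ge> 0"
    "\<And>z. norm z = r \<Longrightarrow> v z \<le> w z"
  shows "circle_mean v r \<le> circle_mean w r"
  unfolding circle_mean_def
  by (intro divide_right_mono integral_le circle_mean_integrable assms) (use assms in auto)

text \<open>
  Concavity of the logarithm, in the form ln x \<le> ln m + x / m - 1 with m the mean.
\<close>

lemma circle_mean_ln_le: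
  assumes cont: "continuous_on (sphere 0 r) v" and r: "r \<ge> 0" and pos: "\<And>z. norm z = r \<Longrightarrow> v z > 0"
  shows "circle_mean v r > 0" "circle_mean (\<lambda>z. ln (v z)) r \<le> ln (circle_mean v r)"
proof -
  have "sphere (0::complex) r \<noteq> {}"
    using r by simp
  then obtain z0 where z0: "z0 \<in> sphere 0 r" "\<And>z. z \<in> sphere 0 r \<Longrightarrow> v z0 \<le> v z"
    using continuous_attains_inf[OF compact_sphere _ cont] by auto
  have "circle_mean (\<lambda>_. v z0) r \<le> circle_mean v r"
    using z0 by (intro circle_mean_mono cont r continuous_intros) auto
  moreover have "v z0 > 0" using z0 pos by auto
  ultimately show p: "circle_mean v r > 0" by simp
  define m where "m = circle_mean v r"
  have m: "m > 0" using p by (simp add: m_def)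
  have c: "continuous_on (sphere 0 r) (\<lambda>z. ln (v z))" 
    "continuous_on (sphere 0 r) (\<lambda>z. (ln m - 1) + (1/m) * v z)"
    using m pos by (auto intro!: continuous_intros cont simp: order.strict_implies_not_eq[symmetric])
  have "circle_mean (\<lambda>z. ln (v z)) r \<le> circle_mean (\<lambda>z. (ln m - 1) + (1/m) * v z) r"
  proof (rule circle_mean_mono[OF c r])
    fix z :: complex assume z: "norm z = r"
    have "ln (v z / m) \<le> v z / m - 1"
      using pos[OF z] p by (intro ln_le_minus_one) (auto simp: m_def)
    thus "ln (v z) \<le> (ln m - 1) + (1/m) * v z"
      using pos[OF z] p by (simp add: ln_div m_def)
  qed
  also have "\<dots> = (ln m - 1) + (1/m) * m"
    unfolding circle_mean_add[OF continuous_on_const continuous_on_mult_left[OF cont] r]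
    by (simp only: circle_mean_cmult circle_mean_const m_def)
  also have "\<dots> = ln m" using m by simp
  finally show "circle_mean (\<lambda>z. ln (v z)) r \<le> ln (circle_mean v r)" by (simp add: m_def)
qed

text \<open>
  If D = v_x - i v_y this is, up to the factor 2 pi, the flux of the gradient of v through the
  circle of radius r.
\<close>

definition circle_flux :: "(complex \<Rightarrow> complex) \<Rightarrow> real \<Rightarrow> real" where
  "circle_flux D r = circle_mean (\<lambda>z. Re (D z * z)) r"

lemma rcis_has_vector_derivative_radius:
  "((\<lambda>s. rcis s t) has_vector_derivative cis t) (at s within S)"
  unfolding rcis_def by (auto intro!: derivative_eq_intros simp: has_vector_derivative_def scaleR_conv_of_real)

lemma rcis_has_vector_derivative_angle:
  "((\<lambda>t. rcis s t) has_vector_derivative \<i> * rcis s t) (at t within S)"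
proof -
  have "((\<lambda>t. cis t) has_vector_derivative \<i> * cis t) (at t within S)"
    unfolding cis_conv_exp
    by (rule has_vector_derivative_real_field[of "\<lambda>z. exp (\<i> * z)"]) (auto intro!: derivative_eq_intros)
  from has_vector_derivative_mult_right[OF this, of "of_real s"] show ?thesis
    by (simp add: rcis_def algebra_simps)
qed

text \<open>
  The Laplacian in polar coordinates: the mean \<phi> of v over the circle of radius r satisfies
  (r \<phi>')' = r times the mean of the Laplacian.  The quantity r \<phi>' is the flux.
\<close>

lemma circle_mean_has_derivative:
  assumes v: "potential_on (ball 0 R) v D L" and r: "0 < r" "r < R"
  shows "(circle_mean v has_real_derivative circle_flux D r / r) (at r)"
    and "(circle_flux D has_real_derivative r * circle_mean L r) (at r)"
proof -
  obtain A where A: "continuous_on (ball 0 R) A"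
    "\<And>z. z \<in> ball 0 R \<Longrightarrow> (D has_derivative (\<lambda>h. A z * h + of_real (L z / 2) * cnj h)) (at z)"
    using v unfolding potential_on_def by auto
  have dv: "\<And>z. z \<in> ball 0 R \<Longrightarrow> (v has_derivative (\<lambda>h. Re (D z * h))) (at z)"
    using v by (auto simp: potential_on_def)
  note [continuous_intros] = continuous_on_compose2[OF potential_onD(1)[OF v]]
    continuous_on_compose2[OF potential_onD(2)[OF v]] continuous_on_compose2[OF potential_onD(3)[OF v]]
    continuous_on_compose2[OF A(1)]
  define r1 r2 where "r1 = r / 2" and "r2 = (r + R) / 2"
  define U where "U = {r1..r2}"
  have U: "r \<in> interior U" "r \<in> U" "convex U" "\<And>s. s \<in> U \<Longrightarrow> 0 < s \<and> s < R"
    using r by (auto simp: U_def r1_def r2_def)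
  have cU: "continuous_on (U \<times> cbox 0 (2*pi)) (\<lambda>x. rcis (fst x) (snd x))"
    by (intro continuous_intros)
  have imU: "(\<lambda>x. rcis (fst x) (snd x)) ` (U \<times> X) \<subseteq> ball 0 R" for X
    by (auto dest!: U(4))
  have "((\<lambda>r. integral (cbox 0 (2*pi)) (\<lambda>t. v (rcis r t))) has_vector_derivative
        integral (cbox 0 (2*pi)) (\<lambda>t. Re (D (rcis r t) * cis t))) (at r within U)"
  proof (rule leibniz_rule_vector_derivative[OF _ _ _ U(2,3)])
    fix s t assume s: "s \<in> U"
    show "((\<lambda>s. v (rcis s t)) has_vector_derivative Re (D (rcis s t) * cis t)) (at s within U)"
      unfolding has_vector_derivative_def
      by (rule has_derivative_eq_rhs[OF has_derivative_compose[OF rcis_has_vector_derivative_radius[unfolded has_vector_derivative_def] dv]])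
         (use U(4)[OF s] in \<open>auto simp: fun_eq_iff algebra_simps\<close>)
  next
    fix s assume s: "s \<in> U"
    show "(\<lambda>t. v (rcis s t)) integrable_on cbox 0 (2*pi)"
      unfolding cbox_interval using U(4)[OF s]
      by (intro integrable_continuous_real continuous_intros) auto
  next
    show "continuous_on (U \<times> cbox 0 (2*pi)) (\<lambda>(s, t). Re (D (rcis s t) * cis t))"
      unfolding case_prod_beta by (intro continuous_intros imU)
  qed
  also have "at r within U = at r"
    using U(1) by (rule at_within_interior)
  finally have 1: "((\<lambda>r. integral {0..2*pi} (\<lambda>t. v (rcis r t))) has_real_derivative
        integral {0..2*pi} (\<lambda>t. Re (D (rcis r t) * cis t))) (at r)"
    by (simp add: has_real_derivative_iff_has_vector_derivative)
  have "circle_flux D r / r = integral {0..2*pi} (\<lambda>t. (1/r) * Re (D (rcis r t) * rcis r t)) / (2*pi)"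
    by (simp add: circle_flux_def circle_mean_def)
  also have "(\<lambda>t. (1/r) * Re (D (rcis r t) * rcis r t)) = (\<lambda>t. Re (D (rcis r t) * cis t))"
    using r by (auto simp: fun_eq_iff rcis_def field_simps)
  finally show "(circle_mean v has_real_derivative circle_flux D r / r) (at r)"
    unfolding circle_mean_def[abs_def] using DERIV_cdivide[OF 1, of "2*pi"] by simp
  let ?F = "\<lambda>s t. Re ((A (rcis s t) * cis t + of_real (L (rcis s t) / 2) * cnj (cis t)) * rcis s t + D (rcis s t) * cis t)"
  have "((\<lambda>r. integral (cbox 0 (2*pi)) (\<lambda>t. Re (D (rcis r t) * rcis r t))) has_vector_derivative
        integral (cbox 0 (2*pi)) (\<lambda>t. ?F r t)) (at r within U)"
  proof (rule leibniz_rule_vector_derivative[OF _ _ _ U(2,3)])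
    fix s t assume s: "s \<in> U"
    have 1: "((\<lambda>s. D (rcis s t)) has_derivative (\<lambda>h. h *\<^sub>R (A (rcis s t) * cis t + of_real (L (rcis s t) / 2) * cnj (cis t)))) (at s within U)"
      by (rule has_derivative_eq_rhs[OF has_derivative_compose[OF rcis_has_vector_derivative_radius[unfolded has_vector_derivative_def] A(2)]])
         (use U(4)[OF s] in \<open>auto simp: fun_eq_iff scaleR_conv_of_real algebra_simps\<close>)
    show "((\<lambda>s. Re (D (rcis s t) * rcis s t)) has_vector_derivative ?F s t) (at s within U)"
      unfolding has_vector_derivative_def
      by (rule has_derivative_eq_rhs[OF bounded_linear.has_derivative[OF bounded_linear_Re
           has_derivative_mult[OF 1 rcis_has_vector_derivative_radius[unfolded has_vector_derivative_def]]]])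
         (auto simp: fun_eq_iff algebra_simps)
  next
    fix s assume s: "s \<in> U"
    show "(\<lambda>t. Re (D (rcis s t) * rcis s t)) integrable_on cbox 0 (2*pi)"
      unfolding cbox_interval using U(4)[OF s]
      by (intro integrable_continuous_real continuous_intros) auto
  next
    show "continuous_on (U \<times> cbox 0 (2*pi)) (\<lambda>(s, t). ?F s t)"
      unfolding case_prod_beta by (intro continuous_intros imU) auto
  qed
  also have "at r within U = at r"
    using U(1) by (rule at_within_interior)
  finally have 2: "((\<lambda>r. integral {0..2*pi} (\<lambda>t. Re (D (rcis r t) * rcis r t))) has_real_derivative
        integral {0..2*pi} (\<lambda>t. ?F r t)) (at r)"
    by (simp add: has_real_derivative_iff_has_vector_derivative)
  \<comment> \<open>By periodicity the second angular derivative of v has mean zero, so only the radial part of the Laplacian survives.\<close>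
  let ?G = "\<lambda>t. Re ((A (rcis r t) * (\<i> * rcis r t) + of_real (L (rcis r t) / 2) * cnj (\<i> * rcis r t)) * (\<i> * rcis r t) + D (rcis r t) * (\<i> * (\<i> * rcis r t)))"
  have "(?G has_integral (Re (D (rcis r (2*pi)) * (\<i> * rcis r (2*pi))) - Re (D (rcis r 0) * (\<i> * rcis r 0)))) {0..2*pi}"
  proof (rule fundamental_theorem_of_calculus)
    fix t
    note d = rcis_has_vector_derivative_angle[unfolded has_vector_derivative_def]
    have 1: "((\<lambda>t. D (rcis r t)) has_derivative (\<lambda>h. h *\<^sub>R (A (rcis r t) * (\<i> * rcis r t) + of_real (L (rcis r t) / 2) * cnj (\<i> * rcis r t)))) (at t within {0..2*pi})"
      by (rule has_derivative_eq_rhs[OF has_derivative_compose[OF d A(2)]])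
         (use r in \<open>auto simp: fun_eq_iff scaleR_conv_of_real algebra_simps\<close>)
    show "((\<lambda>t. Re (D (rcis r t) * (\<i> * rcis r t))) has_vector_derivative ?G t) (at t within {0..2*pi})"
      unfolding has_vector_derivative_def
      by (rule has_derivative_eq_rhs[OF bounded_linear.has_derivative[OF bounded_linear_Re
           has_derivative_mult[OF 1 has_derivative_mult_right[OF d]]]])
         (auto simp: fun_eq_iff algebra_simps)
  qed (use pi_gt_zero in auto)
  hence G0: "(?G has_integral 0) {0..2*pi}"
    by (simp add: rcis_def)
  have Re_mult: "Re (of_real x * z) = x * Re z" for x z by simp
  have FG: "r * ?F r t + ?G t = r^2 * L (rcis r t)" for t
  proof -
    have c: "cis t * cnj (cis t) = 1" by (simp add: cis_cnj cis_mult)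
    let ?w = "cis t" and ?l = "of_real (L (rcis r t) / 2)"
    have "of_real r * ((A (rcis r t) * ?w + ?l * cnj ?w) * rcis r t + D (rcis r t) * ?w)
         + ((A (rcis r t) * (\<i> * rcis r t) + ?l * cnj (\<i> * rcis r t)) * (\<i> * rcis r t) + D (rcis r t) * (\<i> * (\<i> * rcis r t)))
       = of_real r^2 * (2 * ?l) * (?w * cnj ?w)"
      unfolding rcis_def by (simp add: algebra_simps power2_eq_square)
    also have "\<dots> = of_real (r^2 * L (rcis r t))" by (simp add: c)
    finally have "Re (of_real r * ((A (rcis r t) * ?w + ?l * cnj ?w) * rcis r t + D (rcis r t) * ?w))
         + ?G t = r^2 * L (rcis r t)"
      by (metis Re_complex_of_real plus_complex.sel(1))
    thus ?thesis by (simp only: Re_mult)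
  qed
  have iF: "(\<lambda>t. ?F r t) integrable_on {0..2*pi}"
    using r by (intro integrable_continuous_real continuous_intros) auto
  have "r * integral {0..2*pi} (\<lambda>t. ?F r t) = integral {0..2*pi} (\<lambda>t. r * ?F r t + ?G t)"
    using integral_unique[OF has_integral_add[OF has_integral_mult_right[OF integrable_integral[OF iF], of r] G0]]
    by simp
  also have "\<dots> = r^2 * (2 * pi * circle_mean L r)"
    unfolding FG by (simp add: circle_mean_def)
  finally have "integral {0..2*pi} (\<lambda>t. ?F r t) / (2*pi) = r * circle_mean L r"
    using r by (simp add: field_simps power2_eq_square)
  thus "(circle_flux D has_real_derivative r * circle_mean L r) (at r)"
    unfolding circle_flux_def[abs_def] circle_mean_def[of "\<lambda>z. Re (D z * z)", abs_def]
    using DERIV_cdivide[OF 2, of "2*pi"] by simp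
qed

section \<open>Green's formula on discs\<close>

text \<open>
  Identifies Lebesgue measure on the complex plane with the product measure, which makes Fubini's
  theorem available.
\<close>

lemma lborel_complex_eq_distr:
  "(lborel :: complex measure) = distr (lborel \<Otimes>\<^sub>M lborel) borel (\<lambda>(x, y). Complex x y)"
proof (rule lborel_eqI)
  have meas: "(\<lambda>(x, y). Complex x y) \<in> (lborel \<Otimes>\<^sub>M lborel :: (real \<times> real) measure) \<rightarrow>\<^sub>M borel"
    unfolding lborel_prod measurable_lborel2
    by (intro borel_measurable_continuous_onI) (auto simp: case_prod_beta Complex_eq intro!: continuous_intros)
  fix l u :: complex
  assume le: "\<And>b. b \<in> Basis \<Longrightarrow> l \<bullet> b \<le> u \<bullet> b"
  have *: "(\<lambda>(x, y). Complex x y) -` box l u \<inter> space (lborel \<Otimes>\<^sub>M lborel) = box (Re l, Im l) (Re u, Im u)"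
    by (auto simp: box_def Basis_complex_def Basis_prod_def space_pair_measure)
  show "emeasure (distr (lborel \<Otimes>\<^sub>M lborel) borel (\<lambda>(x, y). Complex x y)) (box l u) = (\<Prod>b\<in>Basis. (u - l) \<bullet> b)"
    unfolding emeasure_distr[OF meas box_borel] * unfolding lborel_prod
    using le[of 1] le[of \<i>]
    by (subst emeasure_lborel_box) (auto simp: Basis_complex_def Basis_prod_def prod.union_disjoint)
qed simp

lemma integral_complex_iterated:
  fixes f :: "complex \<Rightarrow> real"
  assumes f: "integrable lborel f"
  shows "integral\<^sup>L lborel f = (\<integral>y. (\<integral>x. f (Complex x y) \<partial>lborel) \<partial>lborel)"
    and "integral\<^sup>L lborel f = (\<integral>x. (\<integral>y. f (Complex x y) \<partial>lborel) \<partial>lborel)"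
proof -
  have meas: "(\<lambda>(x, y). Complex x y) \<in> (lborel \<Otimes>\<^sub>M lborel :: (real \<times> real) measure) \<rightarrow>\<^sub>M borel"
    unfolding lborel_prod measurable_lborel2
    by (intro borel_measurable_continuous_onI) (auto simp: case_prod_beta Complex_eq intro!: continuous_intros)
  have fm: "f \<in> borel_measurable borel"
    using f by auto
  have int: "integrable (lborel \<Otimes>\<^sub>M lborel) (\<lambda>(x, y). f (Complex x y))"
    using f integrable_distr_eq[OF meas fm] unfolding lborel_complex_eq_distr[symmetric] by (simp add: case_prod_unfold)
  have "integral\<^sup>L lborel f = integral\<^sup>L (lborel \<Otimes>\<^sub>M lborel) (\<lambda>(x, y). f (Complex x y))"
    by (subst lborel_complex_eq_distr, subst integral_distr[OF meas fm]) (simp add: case_prod_unfold)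
  with lborel_pair.integral_snd[OF int] lborel_pair.integral_fst[OF int]
  show "integral\<^sup>L lborel f = (\<integral>y. (\<integral>x. f (Complex x y) \<partial>lborel) \<partial>lborel)"
    "integral\<^sup>L lborel f = (\<integral>x. (\<integral>y. f (Complex x y) \<partial>lborel) \<partial>lborel)" by auto
qed

lemma integrable_indicator_ball:
  fixes p :: "complex \<Rightarrow> real"
  assumes "continuous_on UNIV p"
  shows "integrable lborel (\<lambda>z. indicator (ball 0 t) z * p z)"
proof -
  have "integrable lborel (\<lambda>z. indicator (cball 0 t) z *\<^sub>R p z)"
    by (intro borel_integrable_compact) (auto intro: continuous_on_subset[OF assms])
  hence "set_integrable lborel (ball 0 t) p"
    unfolding set_integrable_def[symmetric] by (rule set_integrable_subset) auto
  thus ?thesis by (simp add: set_integrable_def)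
qed

lemma norm_Complex_less_iff:
  assumes "t > 0"
  shows "norm (Complex x y) < t \<longleftrightarrow> \<bar>y\<bar> < t \<and> \<bar>x\<bar> < sqrt (t\<^sup>2 - y\<^sup>2)"
proof -
  have "norm (Complex x y) < t \<longleftrightarrow> x\<^sup>2 + y\<^sup>2 < t\<^sup>2"
    unfolding cmod_def complex.sel using assms by (metis real_sqrt_abs abs_of_pos real_sqrt_less_iff)
  also have "\<dots> \<longleftrightarrow> \<bar>y\<bar> < t \<and> \<bar>x\<bar> < sqrt (t\<^sup>2 - y\<^sup>2)"
  proof safe
    assume a: "x\<^sup>2 + y\<^sup>2 < t\<^sup>2"
    hence "y\<^sup>2 < t\<^sup>2" by (smt (verit) zero_le_power2)
    thus "\<bar>y\<bar> < t" using assms by (metis abs_of_pos real_sqrt_abs real_sqrt_less_iff)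
    from a have "x\<^sup>2 < t\<^sup>2 - y\<^sup>2" by simp
    thus "\<bar>x\<bar> < sqrt (t\<^sup>2 - y\<^sup>2)" by (metis real_sqrt_abs real_sqrt_less_iff)
  next
    assume "\<bar>x\<bar> < sqrt (t\<^sup>2 - y\<^sup>2)"
    hence "x\<^sup>2 < t\<^sup>2 - y\<^sup>2" by (metis real_sqrt_abs real_sqrt_less_iff)
    thus "x\<^sup>2 + y\<^sup>2 < t\<^sup>2" by simp
  qed
  finally show ?thesis .
qed

lemma slice_integral_FTC:
  fixes P p :: "real \<Rightarrow> real"
  assumes t: "t > 0" and P: "\<And>x. (P has_real_derivative p x) (at x)" and p: "continuous_on UNIV p"
  shows "(\<integral>x. of_bool (\<bar>y\<bar> < t \<and> \<bar>x\<bar> < sqrt (t\<^sup>2 - y\<^sup>2)) * p x \<partial>lborel)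
       = of_bool (y \<in> {-t..t}) * (P (sqrt (t\<^sup>2 - y\<^sup>2)) - P (- sqrt (t\<^sup>2 - y\<^sup>2)))"
proof (cases "\<bar>y\<bar> < t")
  case True
  define c where "c = sqrt (t\<^sup>2 - y\<^sup>2)"
  have c: "c \<ge> 0" using True t by (auto simp: c_def abs_le_square_iff[symmetric])
  have "(\<integral>x. of_bool (\<bar>y\<bar> < t \<and> \<bar>x\<bar> < c) * p x \<partial>lborel) = (\<integral>x. p x * indicator {-c..c} x \<partial>lborel)"
    by (rule integral_discrete_difference[of "{-c,c}"]) (use True in \<open>auto simp: indicator_def\<close>)
  also have "\<dots> = P c - P (-c)"
    using c P p by (intro integral_FTC_Icc_real) (auto simp: continuous_on_eq_continuous_at)
  finally show ?thesis using True by (auto simp add: c_def abs_less_iff)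
next
  case False
  have "of_bool (y \<in> {-t..t}) * (P (sqrt (t\<^sup>2 - y\<^sup>2)) - P (- sqrt (t\<^sup>2 - y\<^sup>2))) = 0"
  proof (cases "\<bar>y\<bar> = t")
    case True
    hence "y\<^sup>2 = t\<^sup>2" by auto
    thus ?thesis by simp
  qed (use False in auto)
  thus ?thesis using False by simp
qed

lemma sqrt_diff_sin: "t > 0 \<Longrightarrow> sqrt (t\<^sup>2 - (t * sin a)\<^sup>2) = t * \<bar>cos a\<bar>"
proof -
  assume t: "t > 0"
  have "t\<^sup>2 - (t * sin a)\<^sup>2 = (t * cos a)\<^sup>2"
    using sin_cos_squared_add[of a] unfolding power_mult_distrib
    by (metis add_diff_cancel_left' distrib_left mult.right_neutral)
  thus ?thesis using t by (simp add: abs_mult)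
qed

lemma sqrt_diff_cos: "t > 0 \<Longrightarrow> sqrt (t\<^sup>2 - (t * cos a)\<^sup>2) = t * \<bar>sin a\<bar>"
proof -
  assume t: "t > 0"
  have "t\<^sup>2 - (t * cos a)\<^sup>2 = (t * sin a)\<^sup>2"
    using sin_cos_squared_add2[of a] unfolding power_mult_distrib
    by (metis add_diff_cancel_left' distrib_left mult.right_neutral)
  thus ?thesis using t by (simp add: abs_mult)
qed

lemma abs_prod_sin_cos_le: "t > 0 \<Longrightarrow> \<bar>t * sin a\<bar> \<le> t" "t > 0 \<Longrightarrow> \<bar>t * cos a\<bar> \<le> t" for t a :: real
  by (auto simp: abs_mult)

text \<open>
  The divergence theorem for a horizontal vector field.  Integrating the derivative along a chord
  leaves the difference of P at its two ends; the substitution y = t sin a turns the integral over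
  all chords into one over the circle.  The right half of the circle is met in two pieces because
  the angle runs from 0 to 2 pi.
\<close>

lemma disc_integral_dx:
  fixes P p :: "complex \<Rightarrow> real"
  assumes t: "t > 0" and cP: "continuous_on UNIV P" and cp: "continuous_on UNIV p"
    and P: "\<And>x y. ((\<lambda>x. P (Complex x y)) has_real_derivative p (Complex x y)) (at x)"
  shows "(\<integral>z. indicator (ball 0 t) z * p z \<partial>lborel) = integral {0..2*pi} (\<lambda>a. P (rcis t a) * (t * cos a))"
proof -
  define F1 F2 where "F1 = (\<lambda>y. P (Complex (sqrt (t\<^sup>2 - y\<^sup>2)) y))"
    and "F2 = (\<lambda>y. P (Complex (- sqrt (t\<^sup>2 - y\<^sup>2)) y))"
  have cont: "continuous_on {-t..t} F1" "continuous_on {-t..t} F2"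
    unfolding F1_def F2_def Complex_eq by (auto intro!: continuous_intros continuous_on_compose2[OF cP])
  have cx: "continuous_on UNIV (\<lambda>x. p (Complex x y))" for y
    unfolding Complex_eq by (auto intro!: continuous_intros continuous_on_compose2[OF cp])
  have "(\<integral>z. indicator (ball 0 t) z * p z \<partial>lborel)
      = (\<integral>y. (\<integral>x. indicator (ball 0 t) (Complex x y) * p (Complex x y) \<partial>lborel) \<partial>lborel)"
    by (rule integral_complex_iterated integrable_indicator_ball cp)+
  also have "\<dots> = (\<integral>y. indicator {-t..t} y * (F1 y - F2 y) \<partial>lborel)"
    unfolding F1_def F2_def indicator_def mem_ball dist_0_norm norm_Complex_less_iff[OF t]
    by (intro Bochner_Integration.integral_cong refl slice_integral_FTC[OF t P cx])
  also have "\<dots> = (LBINT y:{-t..t}. F1 y - F2 y)"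
    by (simp add: set_lebesgue_integral_def)
  also have "\<dots> = integral {-t..t} (\<lambda>y. F1 y - F2 y)"
    by (rule set_borel_integral_eq_integral, unfold set_integrable_def, rule borel_integrable_compact)
       (auto intro!: continuous_intros cont)
  also have "\<dots> = integral {-t..t} F1 - integral {-t..t} F2"
    by (intro integral_diff integrable_continuous_real cont)
  also have "integral {-t..t} F1 = integral {-t..0} F1 + integral {0..t} F1"
    using t by (intro Henstock_Kurzweil_Integration.integral_combine[symmetric] integrable_continuous_real cont) auto
  finally have lhs: "(\<integral>z. indicator (ball 0 t) z * p z \<partial>lborel) =
    integral {0..t} F1 + (0 - integral {-t..t} F2) + integral {-t..0} F1" by simp
  let ?f = "\<lambda>a. P (rcis t a) * (t * cos a)"
  have der: "((\<lambda>a. t * sin a) has_real_derivative t * cos a) (at a within S)" for a S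
    by (auto intro!: derivative_eq_intros)
  have F1: "(t * cos a) *\<^sub>R F1 (t * sin a) = ?f a" if "cos a \<ge> 0" for a
    using that t unfolding F1_def sqrt_diff_sin[OF t]
    by (simp add: rcis_def cis.code Complex_eq algebra_simps)
  have F2: "(t * cos a) *\<^sub>R F2 (t * sin a) = ?f a" if "cos a \<le> 0" for a
    using that t unfolding F2_def sqrt_diff_sin[OF t]
    by (simp add: rcis_def cis.code Complex_eq algebra_simps)
  note sub = has_integral_substitution_general[where s="{}" and g="\<lambda>a. t * sin a" and g'="\<lambda>a. t * cos a" and c="-t" and d=t]
  have sub': "(\<lambda>a. t * sin a) ` X \<subseteq> {-t..t}" for X
    using abs_prod_sin_cos_le(1)[OF t] by (auto simp: abs_le_iff minus_le_iff)
  have s32: "sin (3 / 2 * pi) = -1"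
    by (metis sin_3over2_pi)
  have "((\<lambda>a. (t * cos a) *\<^sub>R F1 (t * sin a)) has_integral (integral {t * sin 0..t * sin (pi/2)} F1 - integral {t * sin (pi/2)..t * sin 0} F1)) {0..pi/2}"
    by (rule sub) (auto intro!: cont continuous_intros der sub')
  also have "integral {t * sin 0..t * sin (pi/2)} F1 - integral {t * sin (pi/2)..t * sin 0} F1 = integral {0..t} F1"
    using t by simp
  finally have 1: "(?f has_integral integral {0..t} F1) {0..pi/2}"
    by (rule has_integral_cong[THEN iffD1, rotated -1]) (rule F1, rule cos_ge_zero, auto)
  have "((\<lambda>a. (t * cos a) *\<^sub>R F2 (t * sin a)) has_integral (integral {t * sin (pi/2)..t * sin (3/2*pi)} F2 - integral {t * sin (3/2*pi)..t * sin (pi/2)} F2)) {pi/2..3/2*pi}"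
    by (rule sub) (auto intro!: cont continuous_intros der sub')
  also have "(integral {t * sin (pi/2)..t * sin (3/2*pi)} F2 - integral {t * sin (3/2*pi)..t * sin (pi/2)} F2) = 0 - integral {-t..t} F2"
    unfolding s32 using t by simp
  finally have 2: "(?f has_integral 0 - integral {-t..t} F2) {pi/2..3/2*pi}"
  proof (rule has_integral_cong[THEN iffD1, rotated -1])
    fix a assume a: "a \<in> {pi/2..3/2*pi}"
    have "cos (a - pi) \<ge> 0" using a by (intro cos_ge_zero) auto
    thus "(t * cos a) *\<^sub>R F2 (t * sin a) = ?f a" by (intro F2) simp
  qed
  have "((\<lambda>a. (t * cos a) *\<^sub>R F1 (t * sin a)) has_integral (integral {t * sin (3/2*pi)..t * sin (2*pi)} F1 - integral {t * sin (2*pi)..t * sin (3/2*pi)} F1)) {3/2*pi..2*pi}"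
    by (rule sub) (auto intro!: cont continuous_intros der sub')
  also have "(integral {t * sin (3/2*pi)..t * sin (2*pi)} F1 - integral {t * sin (2*pi)..t * sin (3/2*pi)} F1) = integral {-t..0} F1"
    unfolding s32 using t by simp
  finally have 3: "(?f has_integral integral {-t..0} F1) {3/2*pi..2*pi}"
  proof (rule has_integral_cong[THEN iffD1, rotated -1])
    fix a assume a: "a \<in> {3/2*pi..2*pi}"
    have "cos (a - 2 * pi) \<ge> 0" using a by (intro cos_ge_zero) auto
    thus "(t * cos a) *\<^sub>R F1 (t * sin a) = ?f a" by (intro F1) (simp add: cos_diff)
  qed
  have "(?f has_integral (integral {0..t} F1 + (0 - integral {-t..t} F2))) {0..3/2*pi}"
    by (rule has_integral_combine[OF _ _ 1 2]) auto
  from has_integral_combine[OF _ _ this 3]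
  have "(?f has_integral (integral {0..t} F1 + (0 - integral {-t..t} F2) + integral {-t..0} F1)) {0..2*pi}"
    by auto
  thus ?thesis unfolding lhs by (rule integral_unique[symmetric])
qed

lemma disc_integral_dy:
  fixes P p :: "complex \<Rightarrow> real"
  assumes t: "t > 0" and cP: "continuous_on UNIV P" and cp: "continuous_on UNIV p"
    and P: "\<And>x y. ((\<lambda>y. P (Complex x y)) has_real_derivative p (Complex x y)) (at y)"
  shows "(\<integral>z. indicator (ball 0 t) z * p z \<partial>lborel) = integral {0..2*pi} (\<lambda>a. P (rcis t a) * (t * sin a))"
proof -
  define F1 F2 where "F1 = (\<lambda>x. P (Complex x (sqrt (t\<^sup>2 - x\<^sup>2))))"
    and "F2 = (\<lambda>x. P (Complex x (- sqrt (t\<^sup>2 - x\<^sup>2))))"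
  have cont: "continuous_on {-t..t} F1" "continuous_on {-t..t} F2"
    unfolding F1_def F2_def Complex_eq by (auto intro!: continuous_intros continuous_on_compose2[OF cP])
  have cy: "continuous_on UNIV (\<lambda>y. p (Complex x y))" for x
    unfolding Complex_eq by (auto intro!: continuous_intros continuous_on_compose2[OF cp])
  have nc: "norm (Complex x y) < t \<longleftrightarrow> \<bar>x\<bar> < t \<and> \<bar>y\<bar> < sqrt (t\<^sup>2 - x\<^sup>2)" for x y
    using norm_Complex_less_iff[OF t, of y x] by (simp add: cmod_def add.commute)
  have "(\<integral>z. indicator (ball 0 t) z * p z \<partial>lborel)
      = (\<integral>x. (\<integral>y. indicator (ball 0 t) (Complex x y) * p (Complex x y) \<partial>lborel) \<partial>lborel)"
    by (rule integral_complex_iterated integrable_indicator_ball cp)+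
  also have "\<dots> = (\<integral>x. indicator {-t..t} x * (F1 x - F2 x) \<partial>lborel)"
    unfolding F1_def F2_def indicator_def mem_ball dist_0_norm nc
    by (intro Bochner_Integration.integral_cong refl slice_integral_FTC[OF t P cy])
  also have "\<dots> = (LBINT x:{-t..t}. F1 x - F2 x)"
    by (simp add: set_lebesgue_integral_def)
  also have "\<dots> = integral {-t..t} (\<lambda>y. F1 y - F2 y)"
    by (rule set_borel_integral_eq_integral, unfold set_integrable_def, rule borel_integrable_compact)
       (auto intro!: continuous_intros cont)
  also have "\<dots> = integral {-t..t} F1 - integral {-t..t} F2"
    by (intro integral_diff integrable_continuous_real cont)
  finally have lhs: "(\<integral>z. indicator (ball 0 t) z * p z \<partial>lborel) =
    - (0 - integral {-t..t} F1) + - integral {-t..t} F2" by simp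
  let ?f = "\<lambda>a. P (rcis t a) * (t * sin a)"
  have der: "((\<lambda>a. t * cos a) has_real_derivative - (t * sin a)) (at a within S)" for a S
    by (auto intro!: derivative_eq_intros)
  have F1: "- ((- (t * sin a)) *\<^sub>R F1 (t * cos a)) = ?f a" if "sin a \<ge> 0" for a
    using that t unfolding F1_def sqrt_diff_cos[OF t]
    by (simp add: rcis_def cis.code Complex_eq algebra_simps)
  have F2: "- ((- (t * sin a)) *\<^sub>R F2 (t * cos a)) = ?f a" if "sin a \<le> 0" for a
    using that t unfolding F2_def sqrt_diff_cos[OF t]
    by (simp add: rcis_def cis.code Complex_eq algebra_simps)
  note sub = has_integral_substitution_general[where s="{}" and g="\<lambda>a. t * cos a" and g'="\<lambda>a. - (t * sin a)" and c="-t" and d=t]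
  have sub': "(\<lambda>a. t * cos a) ` X \<subseteq> {-t..t}" for X
    using abs_prod_sin_cos_le(2)[OF t] by (auto simp: abs_le_iff minus_le_iff)
  have "((\<lambda>a. (- (t * sin a)) *\<^sub>R F1 (t * cos a)) has_integral (integral {t * cos 0..t * cos pi} F1 - integral {t * cos pi..t * cos 0} F1)) {0..pi}"
    by (rule sub) (auto intro!: cont continuous_intros der sub')
  also have "(integral {t * cos 0..t * cos pi} F1 - integral {t * cos pi..t * cos 0} F1) = 0 - integral {-t..t} F1"
    using t by simp
  finally have "((\<lambda>a. - ((- (t * sin a)) *\<^sub>R F1 (t * cos a))) has_integral - (0 - integral {-t..t} F1)) {0..pi}"
    by (rule has_integral_neg)
  hence 1: "(?f has_integral - (0 - integral {-t..t} F1)) {0..pi}"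
    by (rule has_integral_cong[THEN iffD1, rotated -1]) (rule F1, rule sin_ge_zero, auto)
  have "((\<lambda>a. (- (t * sin a)) *\<^sub>R F2 (t * cos a)) has_integral (integral {t * cos pi..t * cos (2*pi)} F2 - integral {t * cos (2*pi)..t * cos pi} F2)) {pi..2*pi}"
    by (rule sub) (auto intro!: cont continuous_intros der sub')
  also have "(integral {t * cos pi..t * cos (2*pi)} F2 - integral {t * cos (2*pi)..t * cos pi} F2) = integral {-t..t} F2"
    using t by simp
  finally have "((\<lambda>a. - ((- (t * sin a)) *\<^sub>R F2 (t * cos a))) has_integral - integral {-t..t} F2) {pi..2*pi}"
    by (rule has_integral_neg)
  hence 2: "(?f has_integral - integral {-t..t} F2) {pi..2*pi}"
  proof (rule has_integral_cong[THEN iffD1, rotated -1])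
    fix a assume a: "a \<in> {pi..2*pi}"
    have "sin (a - pi) \<ge> 0" using a by (intro sin_ge_zero) auto
    thus "- ((- (t * sin a)) *\<^sub>R F2 (t * cos a)) = ?f a" by (intro F2) simp
  qed
  from has_integral_combine[OF _ _ 1 2]
  have "(?f has_integral (- (0 - integral {-t..t} F1) + - integral {-t..t} F2)) {0..2*pi}"
    by auto
  thus ?thesis unfolding lhs by (rule integral_unique[symmetric])
qed

text \<open>
  Green's formula, the sum of the divergence theorem for the two components of the gradient.
\<close>

lemma disc_integral_laplacian:
  assumes v: "potential_on UNIV v D L" and t: "t > 0"
  shows "(LINT z:ball 0 t|lborel. L z) = 2 * pi * circle_flux D t"
proof -
  obtain A where A: "continuous_on UNIV A"
    "\<And>z. (D has_derivative (\<lambda>h. A z * h + of_real (L z / 2) * cnj h)) (at z)"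
    using v unfolding potential_on_def by auto
  note cont = potential_onD[OF v]
  have dx: "((\<lambda>x. Re (D (Complex x y))) has_real_derivative Re (A (Complex x y)) + L (Complex x y) / 2) (at x)" for x y
  proof -
    have "((\<lambda>x. Complex x y) has_derivative (\<lambda>h. of_real h)) (at x)"
      unfolding Complex_eq by (auto intro!: derivative_eq_intros)
    from bounded_linear.has_derivative[OF bounded_linear_Re has_derivative_compose[OF this A(2)]]
    show ?thesis unfolding has_field_derivative_def
      by (rule has_derivative_eq_rhs) (auto simp: fun_eq_iff algebra_simps)
  qed
  have dy: "((\<lambda>y. - Im (D (Complex x y))) has_real_derivative L (Complex x y) / 2 - Re (A (Complex x y))) (at y)" for x y
  proof -
    have "((\<lambda>y. Complex x y) has_derivative (\<lambda>h. \<i> * of_real h)) (at y)"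
      unfolding Complex_eq by (auto intro!: derivative_eq_intros)
    from has_derivative_minus[OF bounded_linear.has_derivative[OF bounded_linear_Im has_derivative_compose[OF this A(2)]]]
    show ?thesis unfolding has_field_derivative_def
      by (rule has_derivative_eq_rhs) (auto simp: fun_eq_iff algebra_simps)
  qed
  have c: "continuous_on UNIV (\<lambda>z. Re (D z))" "continuous_on UNIV (\<lambda>z. - Im (D z))"
    "continuous_on UNIV (\<lambda>z. Re (A z) + L z / 2)" "continuous_on UNIV (\<lambda>z. L z / 2 - Re (A z))"
    by (auto intro!: continuous_intros A cont)
  have "(LINT z:ball 0 t|lborel. L z) = (\<integral>z. indicator (ball 0 t) z * (Re (A z) + L z / 2) + indicator (ball 0 t) z * (L z / 2 - Re (A z)) \<partial>lborel)"
    unfolding set_lebesgue_integral_def by (rule Bochner_Integration.integral_cong) (auto simp: algebra_simps)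
  also have "\<dots> = integral {0..2*pi} (\<lambda>a. Re (D (rcis t a)) * (t * cos a)) + integral {0..2*pi} (\<lambda>a. - Im (D (rcis t a)) * (t * sin a))"
    by (subst Bochner_Integration.integral_add[OF integrable_indicator_ball[OF c(3)] integrable_indicator_ball[OF c(4)]])
       (simp only: disc_integral_dx[OF t c(1) c(3) dx] disc_integral_dy[OF t c(2) c(4) dy])
  also have "\<dots> = integral {0..2*pi} (\<lambda>a. Re (D (rcis t a)) * (t * cos a) + - Im (D (rcis t a)) * (t * sin a))"
    by (intro integral_add[symmetric] integrable_continuous_real continuous_intros
       continuous_on_compose2[OF c(1)] continuous_on_compose2[OF c(2)]) auto
  also have "(\<lambda>a. Re (D (rcis t a)) * (t * cos a) + - Im (D (rcis t a)) * (t * sin a)) = (\<lambda>a. Re (D (rcis t a) * rcis t a))"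
    by (auto simp: fun_eq_iff rcis_def)
  finally show ?thesis by (simp add: circle_flux_def circle_mean_def)
qed

section \<open>Subharmonicity and the characteristic function\<close>

lemma potential_on_subset: "potential_on U v D L \<Longrightarrow> V \<subseteq> U \<Longrightarrow> potential_on V v D L"
  unfolding potential_on_def by (meson continuous_on_subset subsetD)

text \<open>
  The factors i / (2 pi) of dd^c, 1/4 of the two Wirtinger derivatives and -2i of dz dzbar combine
  to 1 / (4 pi).
\<close>

lemma ddc_density_eq_laplacian:
  assumes v: "potential_on UNIV v D L"
  shows "ddc_density v z = L z / (4 * pi)"
proof -
  obtain A where A: "\<And>z. (D has_derivative (\<lambda>h. A z * h + of_real (L z / 2) * cnj h)) (at z)"
    using v unfolding potential_on_def by auto
  have bar: "wirtinger_bar (\<lambda>w. of_real (v w)) z = cnj (D z) / 2" for z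
  proof -
    have "((\<lambda>w. complex_of_real (v w)) has_derivative (\<lambda>h. of_real (Re (D z * h)))) (at z)"
      using v by (intro has_derivative_of_real) (auto simp: potential_on_def)
    from frechet_derivative_at[OF this, symmetric] show ?thesis
      by (simp add: wirtinger_bar_def complex_eq_iff)
  qed
  have "((\<lambda>z. cnj (D z) / 2) has_derivative (\<lambda>h. cnj (A z * h + of_real (L z / 2) * cnj h) / 2)) (at z)"
    using has_derivative_mult_left[OF bounded_linear.has_derivative[OF bounded_linear_cnj A], where y="1/2"] by simp
  from frechet_derivative_at[OF this, symmetric]
  have w: "wirtinger (\<lambda>z. cnj (D z) / 2) z = of_real (L z / 4)"
    by (simp add: wirtinger_def complex_eq_iff field_simps)
  show ?thesis unfolding ddc_density_def bar w by simp
qed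

lemma ddc_density_fs_potential:
  "ddc_density (\<lambda>w. fs_potential 1 w) w = 1 / (pi * (1 + (cmod w)\<^sup>2)\<^sup>2)"
proof -
  have "potential_on UNIV (\<lambda>w. fs_potential 1 w)
    (\<lambda>z. 2 * (deriv (\<lambda>_. 1) z * cnj 1 + deriv (\<lambda>w. w) z * cnj z) / of_real ((cmod 1)\<^sup>2 + (cmod z)\<^sup>2))
     (\<lambda>z. 4 * (cmod (1 * deriv (\<lambda>w. w) z - deriv (\<lambda>_. 1) z * z))\<^sup>2 / ((cmod 1)\<^sup>2 + (cmod z)\<^sup>2)\<^sup>2)"
    unfolding fs_potential_def by (rule potential_on_ln_norms) auto
  from ddc_density_eq_laplacian[OF this] show ?thesis by simp
qed

lemma continuous_on_circle_mean:
  fixes v :: "complex \<Rightarrow> real"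
  assumes v: "continuous_on (ball 0 R) v"
  shows "continuous_on {0..<R} (circle_mean v)"
proof -
  have "continuous_on {0..<R} (\<lambda>r. integral (cbox 0 (2*pi)) (\<lambda>\<theta>. v (rcis r \<theta>)))"
    by (rule integral_continuous_on_param, unfold case_prod_beta)
       (auto intro!: continuous_intros continuous_on_compose2[OF v])
  thus ?thesis unfolding circle_mean_def[abs_def] by (auto intro!: continuous_intros)
qed

lemma circle_mean_nonneg:
  assumes "continuous_on (sphere 0 r) v" "r \<ge> 0" "\<And>z. norm z = r \<Longrightarrow> v z \<ge> 0"
  shows "circle_mean v r \<ge> 0"
  using circle_mean_mono[OF continuous_on_const assms(1,2), of 0] assms(3) by simp

lemma circle_flux_mono:
  assumes v: "potential_on (ball 0 R) v D L" and L: "\<And>z. z \<in> ball 0 R \<Longrightarrow> L z \<ge> 0"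
    and r: "0 \<le> s" "s \<le> r" "r < R"
  shows "circle_flux D s \<le> circle_flux D r"
proof (rule DERIV_nonneg_imp_increasing_open[OF r(2)])
  fix x assume x: "s < x" "x < r"
  hence x0: "0 < x" "x < R" using r by auto
  have "0 \<le> circle_mean L x"
    by (rule circle_mean_nonneg[OF continuous_on_subset[OF potential_onD(3)[OF v]]]) (use x0 L in auto)
  thus "\<exists>y. (circle_flux D has_real_derivative y) (at x) \<and> 0 \<le> y"
    using circle_mean_has_derivative(2)[OF v x0] x0 by (meson less_imp_le mult_nonneg_nonneg)
next
  have "continuous_on (ball 0 R) (\<lambda>z. Re (D z * z))"
    by (intro continuous_intros potential_onD[OF v])
  from continuous_on_circle_mean[OF this] show "continuous_on {s..r} (circle_flux D)"
    unfolding circle_flux_def[abs_def] by (rule continuous_on_subset) (use r in auto)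
qed

lemma circle_flux_0 [simp]: "circle_flux D 0 = 0"
  by (simp add: circle_flux_def circle_mean_def)

lemma circle_flux_nonneg:
  assumes "potential_on (ball 0 R) v D L" "\<And>z. z \<in> ball 0 R \<Longrightarrow> L z \<ge> 0" "0 \<le> r" "r < R"
  shows "circle_flux D r \<ge> 0"
  using circle_flux_mono[OF assms(1,2) order.refl assms(3,4)] by simp

lemma circle_mean_subharmonic_mono:
  assumes v: "potential_on (ball 0 R) v D L" and L: "\<And>z. z \<in> ball 0 R \<Longrightarrow> L z \<ge> 0"
    and r: "0 \<le> s" "s \<le> r" "r < R"
  shows "circle_mean v s \<le> circle_mean v r"
proof (rule DERIV_nonneg_imp_increasing_open[OF r(2)])
  fix x assume x: "s < x" "x < r"
  hence x0: "0 < x" "x < R" using r by auto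
  have "circle_flux D x \<ge> 0"
    by (rule circle_flux_nonneg[OF v L]) (use x0 in auto)
  thus "\<exists>y. (circle_mean v has_real_derivative y) (at x) \<and> 0 \<le> y"
    using circle_mean_has_derivative(1)[OF v x0] x0 by (meson divide_nonneg_pos)
next
  show "continuous_on {s..r} (circle_mean v)"
    by (rule continuous_on_subset[OF continuous_on_circle_mean[OF potential_onD(1)[OF v]]]) (use r in auto)
qed

lemma potential_on_neg:
  assumes "potential_on U v D L"
  shows "potential_on U (\<lambda>z. - v z) (\<lambda>z. - D z) (\<lambda>z. - L z)"
  using potential_on_cmult[OF assms, of "-1"] by simp

lemma circle_mean_harmonic:
  assumes v: "potential_on (ball 0 R) v D (\<lambda>_. 0)" and r: "0 \<le> r" "r < R"
  shows "circle_mean v r = v 0"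
proof -
  have "circle_mean v 0 \<le> circle_mean v r"
    by (rule circle_mean_subharmonic_mono[OF v]) (use r in auto)
  moreover have "circle_mean (\<lambda>z. - v z) 0 \<le> circle_mean (\<lambda>z. - v z) r"
    by (rule circle_mean_subharmonic_mono[OF potential_on_neg[OF v]]) (use r in auto)
  moreover have "circle_mean (\<lambda>z. - v z) s = - circle_mean v s" for s
    using circle_mean_cmult[of "-1" v s] by simp
  ultimately have "circle_mean v r = circle_mean v 0" by simp
  also have "\<dots> = v 0" by (simp add: circle_mean_def)
  finally show ?thesis .
qed

lemma nevanlinna_T_nonneg: "nevanlinna_T f r \<ge> 0"
proof -
  have "fs_pullback_density f z \<ge> 0" for z
  proof -
    have "potential_on UNIV (\<lambda>w. fs_potential w 1)
      (\<lambda>z. 2 * (deriv (\<lambda>w. w) z * cnj z + deriv (\<lambda>_. 1) z * cnj 1) / of_real ((cmod z)\<^sup>2 + (cmod 1)\<^sup>2))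
       (\<lambda>z. 4 * (cmod (z * deriv (\<lambda>_. 1) z - deriv (\<lambda>w. w) z * 1))\<^sup>2 / ((cmod z)\<^sup>2 + (cmod 1)\<^sup>2)\<^sup>2)"
      unfolding fs_potential_def by (rule potential_on_ln_norms) auto
    from ddc_density_eq_laplacian[OF this] show ?thesis
      by (auto simp: fs_pullback_density_def ddc_density_fs_potential)
  qed
  thus ?thesis unfolding nevanlinna_T_def set_lebesgue_integral_def
    by (intro Bochner_Integration.integral_nonneg) (auto simp: indicator_def intro!: divide_nonneg_pos Bochner_Integration.integral_nonneg)
qed

text \<open>
  The Ahlfors--Shimizu form of the first main theorem.  For f = F1 / F0 without common zeros, the
  Fubini--Study density is the Laplacian of ln (|F0|^2 + |F1|^2) over 4 pi away from the countably
  many poles, so Green's formula identifies the inner integral with a flux, which is then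
  integrated in t.
\<close>

lemma nevanlinna_T_eq_circle_mean:
  assumes hol: "F0 holomorphic_on UNIV" "F1 holomorphic_on UNIV"
    and nz: "\<And>z. F0 z \<noteq> 0 \<or> F1 z \<noteq> 0" and F0: "\<exists>z. F0 z \<noteq> 0"
    and f: "\<And>z. f z = F1 z / F0 z" and pole: "\<And>z. is_pole f z \<longleftrightarrow> F0 z = 0" and r: "r \<ge> 1"
  shows "nevanlinna_T f r = circle_mean (\<lambda>z. 1/2 * ln ((cmod (F0 z))\<^sup>2 + (cmod (F1 z))\<^sup>2)) r
                          - circle_mean (\<lambda>z. 1/2 * ln ((cmod (F0 z))\<^sup>2 + (cmod (F1 z))\<^sup>2)) 1"
proof -
  define u where "u = (\<lambda>z. 1/2 * ln ((cmod (F0 z))\<^sup>2 + (cmod (F1 z))\<^sup>2))"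
  define L where "L = (\<lambda>z. 1/2 * (4 * (cmod (F0 z * deriv F1 z - deriv F0 z * F1 z))\<^sup>2 / ((cmod (F0 z))\<^sup>2 + (cmod (F1 z))\<^sup>2)\<^sup>2))"
  obtain D where pot: "potential_on UNIV u D L"
    using potential_on_cmult[OF potential_on_ln_norms[OF open_UNIV hol], of "1/2"] nz
    unfolding u_def L_def by blast
  have potR: "potential_on (ball 0 R) u D L" for R
    by (rule potential_on_subset[OF pot]) auto
  have dens: "fs_pullback_density f z = L z / (2 * pi)" if z: "F0 z \<noteq> 0" for z
  proof -
    have "(f has_field_derivative (deriv F1 z * F0 z - F1 z * deriv F0 z) / (F0 z * F0 z)) (at z)"
      using hol z unfolding f[abs_def]
      by (intro DERIV_divide holomorphic_derivI[of _ UNIV]) auto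
    hence d: "deriv f z = (deriv F1 z * F0 z - F1 z * deriv F0 z) / (F0 z * F0 z)"
      by (rule DERIV_imp_deriv)
    have n: "cmod (F0 z) > 0" using z by simp
    have 1: "1 + (cmod (f z))\<^sup>2 = ((cmod (F0 z))\<^sup>2 + (cmod (F1 z))\<^sup>2) / (cmod (F0 z))\<^sup>2"
      using n by (simp add: f norm_divide field_simps)
    have 2: "(cmod (deriv f z))\<^sup>2 = (cmod (F0 z * deriv F1 z - deriv F0 z * F1 z))\<^sup>2 / ((cmod (F0 z))\<^sup>2)\<^sup>2"
      by (simp add: d norm_divide norm_mult power_mult_distrib power_divide power2_eq_square mult.commute)
    have "(cmod (F0 z))\<^sup>2 + (cmod (F1 z))\<^sup>2 > 0"
      using n by (simp add: add_pos_nonneg)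
    thus ?thesis
      unfolding fs_pullback_density_def ddc_density_fs_potential 1 2 L_def
      using pole z n by (simp add: power_divide)
  qed
  have cz: "countable {z. F0 z = 0}"
  proof (cases "F0 constant_on UNIV")
    case True
    thus ?thesis using F0 by (auto simp: constant_on_def)
  next
    case False
    from holomorphic_countable_zeros[OF hol(1) _ _ _ False] show ?thesis by auto
  qed
  have inner: "(LINT z:ball 0 t|lborel. fs_pullback_density f z) = circle_flux D t" if t: "t > 0" for t
  proof -
    have "(LINT z:ball 0 t|lborel. fs_pullback_density f z) = (LINT z:ball 0 t|lborel. L z / (2 * pi))"
      unfolding set_lebesgue_integral_def
      by (rule integral_discrete_difference[OF cz]) (auto simp: dens)
    also have "\<dots> = (LINT z:ball 0 t|lborel. L z) / (2 * pi)"
      by (rule set_integral_divide_zero)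
    also have "\<dots> = circle_flux D t"
      using disc_integral_laplacian[OF pot t] by simp
    finally show ?thesis .
  qed
  have "nevanlinna_T f r = (\<integral>t. (circle_flux D t / t) * indicator {1..r} t \<partial>lborel)"
    unfolding nevanlinna_T_def set_lebesgue_integral_def
  proof (rule Bochner_Integration.integral_cong[OF refl])
    fix x show "indicator {1..r} x *\<^sub>R ((LINT z|lborel. indicator (ball 0 x) z *\<^sub>R fs_pullback_density f z) / x) =
      circle_flux D x / x * indicator {1..r} x"
      by (cases "x \<in> {1..r}") (simp_all add: inner[unfolded set_lebesgue_integral_def real_scaleR_def])
  qed
  also have "\<dots> = circle_mean u r - circle_mean u 1"
  proof (rule integral_FTC_Icc_real[OF r])
    fix x assume x: "1 \<le> x" "x \<le> r"
    show "(circle_mean u has_real_derivative circle_flux D x / x) (at x)"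
      by (rule circle_mean_has_derivative[OF potR[of "x+1"]]) (use x in auto)
    have "isCont (circle_flux D) x"
      by (rule DERIV_isCont, rule circle_mean_has_derivative[OF potR[of "x+1"]]) (use x in auto)
    thus "isCont (\<lambda>x. circle_flux D x / x) x" using x by (intro continuous_intros) auto
  qed
  finally show ?thesis by (simp add: u_def)
qed

section \<open>The growth lemma\<close>

lemma emeasure_le_by_truncation:
  fixes S :: "real set"
  assumes S: "S \<in> sets borel" "S \<subseteq> {a..}" and le: "\<And>b. b \<ge> a \<Longrightarrow> emeasure lborel (S \<inter> {a..b}) \<le> c"
  shows "emeasure lborel S \<le> c"
proof -
  define T where "T = (\<lambda>n::nat. S \<inter> {a..a + real n})"
  have T: "range T \<subseteq> sets lborel" "incseq T"
    using S(1) by (auto simp: T_def incseq_def)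
  have "S = (\<Union>n. T n)"
  proof (intro equalityI subsetI)
    fix r assume r: "r \<in> S"
    then show "r \<in> (\<Union>n. T n)"
      using real_arch_simple[of "r - a"] S(2) by (auto simp: algebra_simps T_def)
  qed (auto simp: T_def)
  hence "emeasure lborel S = (SUP n. emeasure lborel (T n))"
    using SUP_emeasure_incseq[OF T] by simp
  also have "\<dots> \<le> c"
    unfolding T_def by (intro SUP_least le) auto
  finally show ?thesis .
qed

text \<open>
  Borel's growth lemma.  On the set in question 1 is at most \<phi>' / (1 + \<phi>)^(1 + d), and that
  quotient has integral at most 1 / d because it is the derivative of -(1 + \<phi>)^(-d) / d.  The
  bound does not depend on \<phi>; this is what permits a passage to the limit in a family of functions.
\<close>

lemma growth_exceptional_set:
  fixes \<phi> \<phi>' :: "real \<Rightarrow> real"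
  assumes d: "d > 0" and der: "\<And>r. r \<ge> a \<Longrightarrow> (\<phi> has_real_derivative \<phi>' r) (at r)"
    and cont: "continuous_on {a..} \<phi>'" and nn: "\<And>r. r \<ge> a \<Longrightarrow> \<phi> r \<ge> 0" "\<And>r. r \<ge> a \<Longrightarrow> \<phi>' r \<ge> 0"
  shows "{r\<in>{a..}. \<phi>' r > (1 + \<phi> r) powr (1 + d)} \<in> sets borel"
    and "emeasure lborel {r\<in>{a..}. \<phi>' r > (1 + \<phi> r) powr (1 + d)} \<le> ennreal (1 / d)"
proof -
  let ?E = "{r\<in>{a..}. \<phi>' r > (1 + \<phi> r) powr (1 + d)}"
  have c\<phi>: "continuous_on {a..} \<phi>"
    using der by (intro continuous_at_imp_continuous_on) (auto intro: DERIV_isCont)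
  have pos: "1 + \<phi> r > 0" if "r \<ge> a" for r using nn(1)[OF that] by simp
  have "(\<lambda>r. indicator {a..} r *\<^sub>R (\<phi>' r - (1 + \<phi> r) powr (1 + d))) \<in> borel_measurable borel"
    by (intro borel_measurable_continuous_on_indicator continuous_intros cont c\<phi>) (use pos in force)+
  hence "{r \<in> space borel. indicator {a..} r *\<^sub>R (\<phi>' r - (1 + \<phi> r) powr (1 + d)) > 0} \<in> sets borel"
    by measurable
  also have "{r \<in> space borel. indicator {a..} r *\<^sub>R (\<phi>' r - (1 + \<phi> r) powr (1 + d)) > 0} = ?E"
    by (auto simp: indicator_def split: if_splits)
  finally show E: "?E \<in> sets borel" .
  define g where "g = (\<lambda>r. indicator {a..} r *\<^sub>R (\<phi>' r * (1 + \<phi> r) powr (- d - 1)))"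
  have g: "g \<in> borel_measurable borel"
    unfolding g_def
    by (intro borel_measurable_continuous_on_indicator continuous_intros cont c\<phi>) (use pos in force)+
  have gnn: "g r \<ge> 0" for r using nn by (auto simp: g_def indicator_def)
  have bound: "emeasure lborel (?E \<inter> {a..b}) \<le> ennreal (1/d)" if b: "b \<ge> a" for b
  proof -
    have "emeasure lborel (?E \<inter> {a..b}) = (\<integral>\<^sup>+r. indicator (?E \<inter> {a..b}) r \<partial>lborel)"
      using E by simp
    also have "\<dots> \<le> (\<integral>\<^sup>+r. ennreal (g r) * indicator {a..b} r \<partial>lborel)"
    proof (rule nn_integral_mono)
      fix r
      show "indicator (?E \<inter> {a..b}) r \<le> ennreal (g r) * indicator {a..b} r"
      proof (cases "r \<in> ?E \<inter> {a..b}")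
        case True
        have "1 = (1 + \<phi> r) powr (1 + d) * (1 + \<phi> r) powr (- d - 1)"
          using pos[of r] True by (simp flip: powr_add)
        also have "\<dots> \<le> \<phi>' r * (1 + \<phi> r) powr (- d - 1)"
          using True by (intro mult_right_mono) auto
        finally have "1 \<le> g r" using True by (simp add: g_def)
        thus ?thesis using True ennreal_leI[of 1 "g r"] by simp
      qed simp
    qed
    also have "\<dots> = ennreal ((- ((1 + \<phi> b) powr - d) / d) - (- ((1 + \<phi> a) powr - d) / d))"
    proof (rule nn_integral_FTC_Icc[OF _ _ _ b])
      show "g \<in> borel_measurable borel" by (rule g)
      fix x assume x: "x \<in> {a..b}"
      show "((\<lambda>x. - ((1 + \<phi> x) powr - d) / d) has_real_derivative g x) (at x)"
        using x d pos[of x] by (auto intro!: derivative_eq_intros der simp: g_def)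
      show "g x \<ge> 0" by (rule gnn)
    qed
    also have "\<dots> \<le> ennreal (1 / d)"
    proof (rule ennreal_leI)
      have "(1 + \<phi> a) powr - d \<le> 1"
        using d nn(1)[of a] powr_mono2'[of "-d" 1 "1 + \<phi> a"] by simp
      hence "(1 + \<phi> a) powr - d / d \<le> 1 / d"
        using d by (intro divide_right_mono) auto
      moreover have "(1 + \<phi> b) powr - d / d \<ge> 0" using d by simp
      ultimately show "(- ((1 + \<phi> b) powr - d) / d) - (- ((1 + \<phi> a) powr - d) / d) \<le> 1 / d" by simp
    qed
    finally show ?thesis .
  qed
  show "emeasure lborel ?E \<le> ennreal (1 / d)"
    by (rule emeasure_le_by_truncation[OF E _ bound]) auto
qed

text \<open>
  By the polar form of the Laplacian, the mean of L is obtained from the mean of v by two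
  differentiations, one after multiplication by r.  The growth lemma, applied to the flux and to
  the mean, undoes both of them; the surplus factor r powr d is the reason for the term
  \<delta> ln r in the final estimate.
\<close>

lemma circle_mean_laplacian_le:
  assumes v: "potential_on UNIV v D L" and L: "\<And>z. L z \<ge> 0" and a: "a \<ge> 1" and d: "0 < d" "d \<le> 1"
  obtains E where "E \<in> sets borel" "emeasure lborel E \<le> ennreal (2 / d)"
    "\<And>r. r \<ge> a \<Longrightarrow> r \<notin> E \<Longrightarrow>
       circle_mean L r \<le> 4 * r powr d * (1 + (circle_mean v r - circle_mean v a)) ^ 4"
proof -
  have vR: "potential_on (ball 0 R) v D L" for R
    by (rule potential_on_subset[OF v]) auto
  define \<phi>0 where "\<phi>0 = (\<lambda>r. circle_mean v r - circle_mean v a)"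
  have der0: "(\<phi>0 has_real_derivative circle_flux D r / r) (at r)" if "r \<ge> a" for r
    using that a unfolding \<phi>0_def
    by (auto intro!: derivative_eq_intros circle_mean_has_derivative(1)[OF vR[of "r+1"]])
  have der1: "(circle_flux D has_real_derivative r * circle_mean L r) (at r)" if "r \<ge> a" for r
    using that a by (intro circle_mean_has_derivative(2)[OF vR[of "r+1"]]) auto
  have flux: "circle_flux D r \<ge> 0" if "r \<ge> a" for r
    using that a by (intro circle_flux_nonneg[OF vR[of "r+1"] L]) auto
  have \<phi>0: "\<phi>0 r \<ge> 0" if "r \<ge> a" for r
    using that a circle_mean_subharmonic_mono[OF vR[of "r+1"] L, of a r] unfolding \<phi>0_def by auto
  have mL: "circle_mean L r \<ge> 0" if "r \<ge> a" for r
    by (rule circle_mean_nonneg[OF continuous_on_subset[OF potential_onD(3)[OF v]]]) (use that a L in auto)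
  have cmL: "continuous_on {a..} (circle_mean L)"
  proof (intro continuous_at_imp_continuous_on ballI)
    fix r assume r: "r \<in> {a..}"
    have "continuous_on {0..<r+1} (circle_mean L)"
      by (rule continuous_on_circle_mean[OF potential_onD(3)[OF vR]])
    hence "continuous_on {0<..<r+1} (circle_mean L)"
      by (rule continuous_on_subset) auto
    thus "isCont (circle_mean L) r"
      using r a by (auto simp: continuous_on_eq_continuous_at)
  qed
  have cfl: "continuous_on {a..} (circle_flux D)"
    using der1 by (intro continuous_at_imp_continuous_on) (auto intro: DERIV_isCont)
  define E0 where "E0 = {r\<in>{a..}. circle_flux D r / r > (1 + \<phi>0 r) powr (1 + d)}"
  define E1 where "E1 = {r\<in>{a..}. r * circle_mean L r > (1 + circle_flux D r) powr (1 + d)}"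
  have E0: "E0 \<in> sets borel" "emeasure lborel E0 \<le> ennreal (1/d)"
    unfolding E0_def
    by (rule growth_exceptional_set[OF d(1) der0 _ \<phi>0];
        use a flux in \<open>force intro!: continuous_intros cfl\<close>)+
  have E1: "E1 \<in> sets borel" "emeasure lborel E1 \<le> ennreal (1/d)"
    unfolding E1_def
    by (rule growth_exceptional_set[OF d(1) der1 _ flux];
        use a mL in \<open>force intro!: continuous_intros cmL\<close>)+
  show thesis
  proof
    show "E0 \<union> E1 \<in> sets borel" using E0 E1 by auto
    have "emeasure lborel (E0 \<union> E1) \<le> emeasure lborel E0 + emeasure lborel E1"
      using E0 E1 by (intro emeasure_subadditive) auto
    also have "\<dots> \<le> ennreal (1/d) + ennreal (1/d)"
      by (intro add_mono E0 E1)
    also have "\<dots> = ennreal (2/d)" using d by (subst ennreal_plus[symmetric]) auto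
    finally show "emeasure lborel (E0 \<union> E1) \<le> ennreal (2/d)" .
    fix r assume r: "r \<ge> a" "r \<notin> E0 \<union> E1"
    define x where "x = 1 + \<phi>0 r"
    have x: "x \<ge> 1" using \<phi>0[OF r(1)] by (simp add: x_def)
    have r1: "r \<ge> 1" using r a by simp
    have 0: "circle_flux D r \<le> r * x powr (1 + d)"
      using r r1 by (auto simp: E0_def x_def field_simps not_less)
    have 1: "r * circle_mean L r \<le> (1 + circle_flux D r) powr (1 + d)"
      using r by (auto simp: E1_def not_less)
    have "1 * 1 \<le> r * x powr (1 + d)"
      using r1 x d by (intro mult_mono ge_one_powr_ge_zero) auto
    hence "1 + circle_flux D r \<le> (2 * r) * x powr (1 + d)" using 0 by simp
    hence "(1 + circle_flux D r) powr (1 + d) \<le> ((2 * r) * x powr (1 + d)) powr (1 + d)"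
      using d flux[OF r(1)] by (intro powr_mono2) auto
    also have "\<dots> = 2 powr (1 + d) * r powr (1 + d) * x powr ((1 + d) * (1 + d))"
      using r1 x by (simp add: powr_mult powr_powr)
    also have "\<dots> \<le> 4 * (r * r powr d) * x ^ 4"
    proof (intro mult_mono)
      have "(2::real) powr (1 + d) \<le> 2 powr 2" using d by (intro powr_mono) auto
      thus "(2::real) powr (1 + d) \<le> 4" by simp
      show "r powr (1 + d) \<le> r * r powr d" using r1 by (simp add: powr_add)
      have "(1 + d) * (1 + d) \<le> 2 * 2" using d by (intro mult_mono) auto
      hence "x powr ((1 + d) * (1 + d)) \<le> x powr 4" using x by (intro powr_mono) auto
      thus "x powr ((1 + d) * (1 + d)) \<le> x ^ 4" using x by simp
    qed (use r1 in auto)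
    finally have "r * circle_mean L r \<le> r * (4 * r powr d * x ^ 4)"
      using 1 by (simp add: algebra_simps)
    thus "circle_mean L r \<le> 4 * r powr d * (1 + (circle_mean v r - circle_mean v a)) ^ 4"
      using r1 by (simp add: x_def \<phi>0_def)
  qed
qed

section \<open>Means of logarithms of holomorphic functions\<close>

lemma potential_on_ln_dist:
  assumes U: "open U" and a: "a \<notin> U"
  shows "\<exists>D. potential_on U (\<lambda>z. ln (cmod (z - a))) D (\<lambda>_. 0)"
proof -
  have "\<exists>D. potential_on U (\<lambda>z. 1/2 * ln ((cmod (z - a))\<^sup>2 + (cmod 0)\<^sup>2)) D (\<lambda>z. 1/2 * (4 * (cmod ((z - a) * deriv (\<lambda>_. 0) z - deriv (\<lambda>z. z - a) z * 0))\<^sup>2 / ((cmod (z - a))\<^sup>2 + (cmod 0)\<^sup>2)\<^sup>2))"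
    by (rule exI, rule potential_on_cmult, rule potential_on_ln_norms[OF U])
       (use a in \<open>auto intro!: holomorphic_intros\<close>)
  moreover have "1/2 * ln ((cmod (z - a))\<^sup>2 + (cmod 0)\<^sup>2) = ln (cmod (z - a))" for z
    by (cases "z = a") (simp_all add: ln_realpow)
  ultimately show ?thesis by simp
qed

text \<open>
  Jensen's formula for a linear factor.  For a outside the circle it is the mean value property of
  a harmonic function; a point inside is reflected to the outside.
\<close>

lemma circle_mean_ln_dist:
  assumes r: "r > 0" "cmod a \<noteq> r"
  shows "circle_mean (\<lambda>z. ln (cmod (z - a))) r = ln (max r (cmod a))"
proof -
  have out: "circle_mean (\<lambda>z. ln (cmod (z - a))) r = ln (cmod a)" if "cmod a > r" for a
  proof -
    obtain D where D: "potential_on (ball 0 (cmod a)) (\<lambda>z. ln (cmod (z - a))) D (\<lambda>_. 0)"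
      using potential_on_ln_dist[of "ball 0 (cmod a)" a] by auto
    show ?thesis using circle_mean_harmonic[OF D, of r] that r by simp
  qed
  consider "cmod a > r" | "a = 0" | "a \<noteq> 0" "cmod a < r" using r by force
  thus ?thesis
  proof cases
    case 1 thus ?thesis using out[OF 1] by simp
  next
    case 2
    have "circle_mean (\<lambda>z. ln (cmod (z - a))) r = circle_mean (\<lambda>z. ln r) r"
      using r 2 by (intro circle_mean_cong) auto
    thus ?thesis using r 2 by simp
  next
    case 3
    \<comment> \<open>b is the reflection of a in the circle; on the circle the distances to a and to b have constant ratio, and b lies outside.\<close>
    define b where "b = of_real (r\<^sup>2) / cnj a"
    have nb: "cmod b = r\<^sup>2 / cmod a" by (simp add: b_def norm_divide norm_power)
    have b: "cmod b > r"
      using 3 r by (simp add: nb field_simps power2_eq_square)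
    have "circle_mean (\<lambda>z. ln (cmod (z - a))) r = circle_mean (\<lambda>z. ln (cmod a / r) + ln (cmod (z - b))) r"
    proof (rule circle_mean_cong)
      fix z assume z: "cmod z = r"
      have zz: "z * cnj z = of_real (r\<^sup>2)" using complex_norm_square[of z] z by simp
      have "z \<noteq> 0" "z \<noteq> b" using z r b by auto
      have "cnj a * (z - b) = - (z * (cnj z - cnj a))"
        using 3 by (simp add: b_def algebra_simps zz)
      hence "cmod a * cmod (z - b) = r * cmod (cnj z - cnj a)"
        using z by (metis complex_mod_cnj norm_minus_cancel norm_mult)
      also have "cmod (cnj z - cnj a) = cmod (z - a)"
        by (metis complex_cnj_diff complex_mod_cnj)
      finally have "cmod (z - a) = (cmod a / r) * cmod (z - b)"
        using r by (simp add: field_simps)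
      thus "ln (cmod (z - a)) = ln (cmod a / r) + ln (cmod (z - b))"
        using r 3 \<open>z \<noteq> b\<close> by (simp add: ln_mult ln_div)
    qed (use r in auto)
    also have "\<dots> = ln (cmod a / r) + ln (cmod b)"
      using r b by (subst circle_mean_add) (auto intro!: continuous_intros simp: out)
    also have "\<dots> = ln r"
      using r 3 by (simp add: nb ln_div ln_mult ln_realpow power2_eq_square)
    finally show ?thesis using 3 by simp
  qed
qed

text \<open>
  Jensen's inequality for holomorphic k, i.e. subharmonicity of ln |k|.
\<close>

lemma circle_mean_ln_holomorphic_mono:
  assumes k: "k holomorphic_on ball 0 R" and r: "0 < s" "s \<le> r" "r < R"
    and nz: "\<And>z. cmod z = s \<or> cmod z = r \<Longrightarrow> k z \<noteq> 0"
  shows "circle_mean (\<lambda>z. ln (cmod (k z))) s \<le> circle_mean (\<lambda>z. ln (cmod (k z))) r"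
proof -
  have ck: "continuous_on (sphere 0 x) k" if "0 < x" "x \<le> r" for x
    using holomorphic_on_imp_continuous_on[OF k] by (rule continuous_on_subset) (use r that in auto)
  have cl: "continuous_on (sphere 0 x) (\<lambda>z. ln (cmod (k z)))" if "x = s \<or> x = r" for x
    using that r nz by (intro continuous_intros ck) auto
  have "sphere (0::complex) r \<noteq> {}" using r by simp
  then obtain z0 where z0: "z0 \<in> sphere 0 r" "\<And>z. z \<in> sphere 0 r \<Longrightarrow> cmod (k z0) \<le> cmod (k z)"
    using continuous_attains_inf[OF compact_sphere _ continuous_on_norm[OF ck[of r]]] r by auto
  define m where "m = cmod (k z0)"
  have m: "m > 0" using nz z0(1) by (auto simp: m_def)
  have "2 * circle_mean (\<lambda>z. ln (cmod (k z))) s \<le> 2 * circle_mean (\<lambda>z. ln (cmod (k z))) r"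
  proof (rule field_le_epsilon)
    fix e :: real assume e: "e > 0"
    \<comment> \<open>ln (|k|^2 + c^2) is smooth and subharmonic also at the zeros of k, and on the outer circle it exceeds ln |k|^2 by at most e.\<close>
    define c where "c = m * sqrt e"
    have c: "c > 0" using m e by (simp add: c_def)
    let ?v = "\<lambda>z. ln ((cmod (k z))\<^sup>2 + (cmod (of_real c))\<^sup>2)"
    have "circle_mean ?v s \<le> circle_mean ?v r"
      by (rule circle_mean_subharmonic_mono[OF potential_on_ln_norms[OF open_ball k]])
         (use r c in auto)
    moreover have cont: "continuous_on (sphere 0 x) ?v" if "0 < x" "x \<le> r" for x
      using c by (intro continuous_intros ck that) (auto simp: add_nonneg_eq_0_iff)
    have "circle_mean (\<lambda>z. 2 * ln (cmod (k z))) s \<le> circle_mean ?v s"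
    proof (rule circle_mean_mono[OF continuous_on_mult_left[OF cl] cont])
      fix z assume "cmod z = s"
      hence "k z \<noteq> 0" using nz by auto
      hence "2 * ln (cmod (k z)) = ln ((cmod (k z))\<^sup>2)" by (simp add: ln_realpow)
      also have "\<dots> \<le> ?v z"
        using \<open>k z \<noteq> 0\<close> by (intro ln_mono) (auto simp: add_pos_nonneg)
      finally show "2 * ln (cmod (k z)) \<le> ?v z" .
    qed (use r in auto)
    moreover have "circle_mean ?v r \<le> circle_mean (\<lambda>z. 2 * ln (cmod (k z)) + e) r"
    proof (rule circle_mean_mono[OF cont continuous_on_add[OF continuous_on_mult_left[OF cl] continuous_on_const]])
      fix z assume z: "cmod z = r"
      hence k0: "k z \<noteq> 0" using nz by auto
      have "m \<le> cmod (k z)" using z0 z by (auto simp: m_def)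
      hence "m\<^sup>2 \<le> (cmod (k z))\<^sup>2" using m by (intro power_mono) auto
      hence "c\<^sup>2 \<le> (cmod (k z))\<^sup>2 * e" using e by (simp add: c_def power_mult_distrib)
      hence "(cmod (k z))\<^sup>2 + (cmod (of_real c))\<^sup>2 \<le> (cmod (k z))\<^sup>2 * (1 + e)"
        by (simp add: algebra_simps)
      also have "\<dots> \<le> (cmod (k z))\<^sup>2 * exp e" by (intro mult_left_mono) auto
      finally have "?v z \<le> ln ((cmod (k z))\<^sup>2 * exp e)"
        using k0 by (intro ln_mono) (auto simp: add_pos_nonneg)
      thus "?v z \<le> 2 * ln (cmod (k z)) + e"
        using k0 by (simp add: ln_mult ln_realpow)
    qed (use r in auto)
    moreover have "circle_mean (\<lambda>z. 2 * ln (cmod (k z)) + e) r = 2 * circle_mean (\<lambda>z. ln (cmod (k z))) r + e"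
      using r by (subst circle_mean_add) (auto intro!: continuous_on_mult_left cl simp: circle_mean_cmult)
    ultimately show "2 * circle_mean (\<lambda>z. ln (cmod (k z))) s \<le> 2 * circle_mean (\<lambda>z. ln (cmod (k z))) r + e"
      by (simp add: circle_mean_cmult)
  qed
  thus ?thesis by simp
qed

text \<open>
  Divisibility of holomorphic functions is a local matter: the local quotients agree with P / G off
  the isolated zeros of G, hence fit together.
\<close>

lemma holomorphic_quotient_exists:
  assumes U: "open U" "connected U" and G: "G holomorphic_on U" and P: "P holomorphic_on U"
    and G0: "\<exists>z\<in>U. G z \<noteq> 0"
    and loc: "\<And>z0. z0 \<in> U \<Longrightarrow> G z0 = 0 \<Longrightarrow>
       \<exists>k e. e > 0 \<and> ball z0 e \<subseteq> U \<and> k holomorphic_on ball z0 e \<and> (\<forall>z\<in>ball z0 e. P z = G z * k z)"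
  obtains K where "K holomorphic_on U" "\<And>z. z \<in> U \<Longrightarrow> P z = G z * K z"
proof -
  obtain k e where ke: "\<And>z0. z0 \<in> U \<Longrightarrow> G z0 = 0 \<Longrightarrow>
       e z0 > 0 \<and> ball z0 (e z0) \<subseteq> U \<and> k z0 holomorphic_on ball z0 (e z0) \<and> (\<forall>z\<in>ball z0 (e z0). P z = G z * k z0 z)"
    using loc by metis
  define K where "K = (\<lambda>z. if G z = 0 then k z z else P z / G z)"
  have "K field_differentiable at z0" if z0: "z0 \<in> U" for z0
  proof (cases "G z0 = 0")
    case True
    note k = ke[OF z0 True]
    obtain r where r: "r > 0" "\<And>w. w \<in> ball z0 r - {z0} \<Longrightarrow> G w \<noteq> 0"
      using isolated_zeros[OF G U z0 True] G0 by (metis Diff_iff insertCI)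
    define r' where "r' = min r (e z0)"
    have r': "r' > 0" using r k by (simp add: r'_def)
    have "k z0 field_differentiable at z0"
      using k by (meson centre_in_ball holomorphic_on_imp_differentiable_at open_ball)
    moreover have "k z0 w = K w" if "dist w z0 < r'" for w
    proof (cases "w = z0")
      case False
      hence "G w \<noteq> 0" using r(2)[of w] that by (auto simp: r'_def dist_commute)
      moreover have "P w = G w * k z0 w" using k that by (auto simp: r'_def dist_commute)
      ultimately show ?thesis by (simp add: K_def)
    qed (use True in \<open>simp add: K_def\<close>)
    ultimately show ?thesis
      using field_differentiable_transform_within[of r' z0 UNIV "k z0" K] r' by auto
  next
    case False
    have "(\<lambda>z. P z / G z) field_differentiable at z0"
      using P G U z0 False by (intro field_differentiable_divide) (auto simp: holomorphic_on_imp_differentiable_at)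
    moreover obtain r where r: "r > 0" "\<And>w. dist w z0 < r \<Longrightarrow> G w \<noteq> 0"
      using continuous_at_avoid[of z0 G 0] G U z0 False
      by (metis dist_commute holomorphic_on_imp_continuous_on continuous_on_eq_continuous_at)
    ultimately show ?thesis
      using field_differentiable_transform_within[of r z0 UNIV "\<lambda>z. P z / G z" K] by (auto simp: K_def)
  qed
  hence "K holomorphic_on U"
    using U by (auto simp: holomorphic_on_open field_differentiable_def)
  moreover have "P z = G z * K z" if "z \<in> U" for z
    using ke[OF that] by (cases "G z = 0") (auto simp: K_def)
  ultimately show thesis by (rule that)
qed

section \<open>Linear forms and counting functions\<close>

text \<open>
  The linear form in the homogeneous coordinates [x : y] whose zero is the point a, where a finite
  point w is [1 : w] and infinity is [0 : 1].
\<close>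

definition target_form :: "complex option \<Rightarrow> complex \<Rightarrow> complex \<Rightarrow> complex" where
  "target_form a x y = (case a of None \<Rightarrow> x | Some w \<Rightarrow> y - w * x)"

text \<open>
  A linear form orthogonal to \<open>target_form\<close> and of the same norm, so that the pair is a unitary
  change of coordinates up to scaling.
\<close>

definition conj_form :: "complex option \<Rightarrow> complex \<Rightarrow> complex \<Rightarrow> complex" where
  "conj_form a x y = (case a of None \<Rightarrow> y | Some w \<Rightarrow> x + cnj w * y)"

definition form_det :: "complex option \<Rightarrow> complex" where
  "form_det a = (case a of None \<Rightarrow> 1 | Some w \<Rightarrow> - (1 + w * cnj w))"

lemma cmod_form_det: "cmod (form_det a) = (case a of None \<Rightarrow> 1 | Some w \<Rightarrow> 1 + (cmod w)\<^sup>2)"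
proof (cases a)
  case (Some w)
  have "1 + w * cnj w = of_real (1 + (cmod w)\<^sup>2)"
    by (simp only: complex_norm_square of_real_add of_real_1)
  thus ?thesis by (simp add: form_det_def Some del: of_real_add)
qed (simp add: form_det_def)

lemma cmod_form_det_ge_1: "cmod (form_det a) \<ge> 1"
  by (cases a) (auto simp: cmod_form_det)

lemma form_det_nz [simp]: "form_det a \<noteq> 0"
  using cmod_form_det_ge_1[of a] by auto

lemma form_norm_sum:
  "(cmod (target_form a x y))\<^sup>2 + (cmod (conj_form a x y))\<^sup>2 = cmod (form_det a) * ((cmod x)\<^sup>2 + (cmod y)\<^sup>2)"
proof (cases a)
  case (Some w)
  have "complex_of_real ((cmod (y - w * x))\<^sup>2 + (cmod (x + cnj w * y))\<^sup>2)
      = complex_of_real ((1 + (cmod w)\<^sup>2) * ((cmod x)\<^sup>2 + (cmod y)\<^sup>2))"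
    unfolding of_real_add of_real_mult of_real_1 complex_norm_square by (simp add: algebra_simps)
  hence "(cmod (y - w * x))\<^sup>2 + (cmod (x + cnj w * y))\<^sup>2 = (1 + (cmod w)\<^sup>2) * ((cmod x)\<^sup>2 + (cmod y)\<^sup>2)"
    by (simp only: of_real_eq_iff)
  thus ?thesis by (simp add: target_form_def conj_form_def cmod_form_det Some)
qed (simp add: target_form_def conj_form_def form_det_def)

lemma form_wronskian:
  "target_form a x y * conj_form a x' y' - target_form a x' y' * conj_form a x y = form_det a * (x * y' - x' * y)"
  by (cases a) (simp_all add: target_form_def conj_form_def form_det_def algebra_simps)

lemma target_forms_independent:
  assumes "a \<noteq> b"
  shows "\<exists>K>0. \<forall>x y. (cmod x)\<^sup>2 + (cmod y)\<^sup>2 \<le> K * ((cmod (target_form a x y))\<^sup>2 + (cmod (target_form b x y))\<^sup>2)"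
proof -
  have sq: "(cmod (x + c * y))\<^sup>2 \<le> 2 * (cmod x)\<^sup>2 + 2 * (cmod c)\<^sup>2 * (cmod y)\<^sup>2" for x y c
  proof -
    have "(cmod (x + c * y))\<^sup>2 \<le> (cmod x + cmod c * cmod y)\<^sup>2"
      by (metis norm_ge_zero norm_mult norm_triangle_ineq power_mono)
    also have "\<dots> \<le> 2 * (cmod x)\<^sup>2 + 2 * (cmod c * cmod y)\<^sup>2"
      using sum_squares_bound[of "cmod x" "cmod c * cmod y"] by (simp add: power2_sum)
    finally show ?thesis by (simp add: power_mult_distrib)
  qed
  have comb: "X + Y \<le> (2 * (p + q + s + t) + 1) * (G + H)"
    if "X \<le> 2 * (p * G) + 2 * q * H" "Y \<le> 2 * (s * G) + 2 * t * H"
      "0 \<le> p" "0 \<le> q" "0 \<le> s" "0 \<le> t" "0 \<le> G" "0 \<le> H" for X Y p q s t G H :: real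
  proof -
    have "0 \<le> p * H" "0 \<le> s * H" "0 \<le> q * G" "0 \<le> t * G" using that by auto
    moreover have "(2 * (p + q + s + t) + 1) * (G + H) = 2 * (p * G) + 2 * (p * H) + 2 * (q * G) + 2 * (q * H)
        + 2 * (s * G) + 2 * (s * H) + 2 * (t * G) + 2 * (t * H) + G + H"
      by (simp add: algebra_simps)
    ultimately show ?thesis using that by linarith
  qed
  \<comment> \<open>Two different points give linearly independent forms, so both coordinates are linear combinations of the forms.\<close>
  have lin: ?thesis if "\<And>x y. x = c1 * target_form a x y + c2 * target_form b x y"
     "\<And>x y. y = c3 * target_form a x y + c4 * target_form b x y" for c1 c2 c3 c4
  proof (intro exI conjI allI)
    let ?K = "2 * ((cmod c1)\<^sup>2 + (cmod c2)\<^sup>2 + (cmod c3)\<^sup>2 + (cmod c4)\<^sup>2) + 1"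
    show "?K > 0" by (simp add: add_nonneg_pos)
    fix x y
    let ?g = "target_form a x y" and ?h = "target_form b x y"
    have "(cmod x)\<^sup>2 \<le> 2 * (cmod (c1 * ?g))\<^sup>2 + 2 * (cmod c2)\<^sup>2 * (cmod ?h)\<^sup>2"
      using sq[of "c1 * ?g" c2 ?h] that(1)[of x y] by simp
    moreover have "(cmod y)\<^sup>2 \<le> 2 * (cmod (c3 * ?g))\<^sup>2 + 2 * (cmod c4)\<^sup>2 * (cmod ?h)\<^sup>2"
      using sq[of "c3 * ?g" c4 ?h] that(2)[of y x] by simp
    ultimately show "(cmod x)\<^sup>2 + (cmod y)\<^sup>2 \<le> ?K * ((cmod ?g)\<^sup>2 + (cmod ?h)\<^sup>2)"
      unfolding norm_mult power_mult_distrib by (intro comb) (auto simp: algebra_simps)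
  qed
  show ?thesis
  proof (cases a; cases b)
    fix w assume "a = None" "b = Some w"
    thus ?thesis by (intro lin[of 1 0 w 1]) (auto simp: target_form_def)
  next
    fix w assume "a = Some w" "b = None"
    thus ?thesis by (intro lin[of 0 1 1 w]) (auto simp: target_form_def)
  next
    fix w v assume ab: "a = Some w" "b = Some v"
    hence "(w - v) * (w - v) \<noteq> 0" using assms by auto
    hence "w \<noteq> v" "v * v + w * w \<noteq> v * (w * 2)" by (auto simp: algebra_simps)
    thus ?thesis using ab
      by (intro lin[of "1 / (v - w)" "- 1 / (v - w)" "v / (v - w)" "- w / (v - w)"])
         (auto simp: target_form_def divide_simps algebra_simps)
  qed (use assms in auto)
qed

lemma integral_of_bool_less_over:
  assumes r: "r \<ge> 1" and m: "0 \<le> m" "m < r"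
  shows "integrable lborel (\<lambda>t. indicator {1..r} t * (of_bool (m < t) / t :: real))"
    and "(\<integral>t. indicator {1..r} t * (of_bool (m < t) / t) \<partial>lborel) = ln r - ln (max 1 m)"
proof -
  let ?M = "max 1 m"
  have M: "1 \<le> ?M" "?M \<le> r" using r m by auto
  have "has_bochner_integral lborel (\<lambda>t. (1 / t) * indicator {?M..r} t) (ln r - ln ?M)"
    by (rule has_bochner_integral_FTC_Icc_real[OF M(2)])
       (use M in \<open>auto intro!: derivative_eq_intros continuous_intros\<close>)
  hence "has_bochner_integral lborel (\<lambda>t. indicator {1..r} t * (of_bool (m < t) / t)) (ln r - ln ?M)"
    by (rule has_bochner_integral_discrete_difference[where X="{?M}", THEN iffD1, rotated 4])
       (auto simp: indicator_def)
  thus "integrable lborel (\<lambda>t. indicator {1..r} t * (of_bool (m < t) / t :: real))"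
    "(\<integral>t. indicator {1..r} t * (of_bool (m < t) / t) \<partial>lborel) = ln r - ln (max 1 m)"
    by (auto simp: has_bochner_integral_iff)
qed

text \<open>
  Each point z counted before radius r contributes the integral of 1 / t from max 1 |z| to r.
\<close>

lemma nevanlinna_Nbar_ge:
  assumes fin: "finite Z" and Z: "Z = {z \<in> ball 0 r. sphere_map f z = a}" and s: "1 \<le> s" "s \<le> r"
  shows "(\<Sum>z\<in>Z. ln r - ln (max s (cmod z))) \<le> nevanlinna_Nbar f r a"
proof -
  have nb: "real (nbar f t a) = (\<Sum>z\<in>Z. of_bool (cmod z < t))" if "t \<le> r" for t
  proof -
    have "{z \<in> ball 0 t. sphere_map f z = a} = {z\<in>Z. cmod z < t}"
      using that by (auto simp: Z)
    thus ?thesis using fin by (simp add: nbar_def sum.If_cases Int_def of_bool_def)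
  qed
  have "nevanlinna_Nbar f r a = (\<integral>t. (\<Sum>z\<in>Z. indicator {1..r} t * (of_bool (cmod z < t) / t)) \<partial>lborel)"
    unfolding nevanlinna_Nbar_def set_lebesgue_integral_def
  proof (rule Bochner_Integration.integral_cong[OF refl])
    fix t show "indicator {1..r} t *\<^sub>R (real (nbar f t a) / t) = (\<Sum>z\<in>Z. indicator {1..r} t * (of_bool (cmod z < t) / t))"
      by (cases "t \<in> {1..r}") (simp_all add: nb sum_divide_distrib)
  qed
  also have "\<dots> = (\<Sum>z\<in>Z. \<integral>t. indicator {1..r} t * (of_bool (cmod z < t) / t) \<partial>lborel)"
    by (intro Bochner_Integration.integral_sum integral_of_bool_less_over) (use Z s in auto)
  also have "\<dots> = (\<Sum>z\<in>Z. ln r - ln (max 1 (cmod z)))"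
    by (intro sum.cong integral_of_bool_less_over refl) (use Z s in auto)
  finally show ?thesis
    using s by (auto intro!: sum_mono ln_mono)
qed

lemma entire_zeros:
  assumes "g holomorphic_on UNIV" "\<exists>z. g z \<noteq> 0"
  shows "countable {z. g z = 0}" "finite {z\<in>ball 0 R. g z = 0}"
proof -
  have "countable {z. g z = 0} \<and> finite {z\<in>ball 0 R. g z = 0}"
  proof (cases "g constant_on UNIV")
    case True
    thus ?thesis using assms(2) by (auto simp: constant_on_def)
  next
    case False
    have "finite {z\<in>cball 0 R. g z = 0}"
      by (rule holomorphic_compact_finite_zeros[OF assms(1) _ _ _ _ False]) auto
    hence "finite {z\<in>ball 0 R. g z = 0}" by (rule rev_finite_subset) auto
    with holomorphic_countable_zeros[OF assms(1) _ _ _ False] show ?thesis by auto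
  qed
  thus "countable {z. g z = 0}" "finite {z\<in>ball 0 R. g z = 0}" by auto
qed

text \<open>
  A holomorphic lift of a nonconstant map to the projective line: two entire functions without
  common zeros.  Nonconstancy is expressed by the Wronskian.
\<close>

locale reduced_lift =
  fixes F0 F1 :: "complex \<Rightarrow> complex"
  assumes hol0: "F0 holomorphic_on UNIV" and hol1: "F1 holomorphic_on UNIV"
    and no_common_zero: "F0 z \<noteq> 0 \<or> F1 z \<noteq> 0"
    and nondegenerate: "\<exists>z. F0 z * deriv F1 z - deriv F0 z * F1 z \<noteq> 0"
begin

definition wronskian :: "complex \<Rightarrow> complex" where
  "wronskian z = F0 z * deriv F1 z - deriv F0 z * F1 z"

definition form :: "complex option \<Rightarrow> complex \<Rightarrow> complex" where
  "form a z = target_form a (F0 z) (F1 z)"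

definition coform :: "complex option \<Rightarrow> complex \<Rightarrow> complex" where
  "coform a z = conj_form a (F0 z) (F1 z)"

definition sqnorm :: "complex \<Rightarrow> real" where
  "sqnorm z = (cmod (F0 z))\<^sup>2 + (cmod (F1 z))\<^sup>2"

lemma sqnorm_pos: "sqnorm z > 0"
  using no_common_zero[of z] by (auto simp: sqnorm_def add_pos_nonneg add_nonneg_pos)

lemma hol_form: "form a holomorphic_on UNIV" and hol_coform: "coform a holomorphic_on UNIV"
  unfolding form_def[abs_def] coform_def[abs_def] target_form_def conj_form_def
  using hol0 hol1 by (cases a; auto intro!: holomorphic_intros)+

lemma hol_wronskian: "wronskian holomorphic_on UNIV"
  unfolding wronskian_def[abs_def] using hol0 hol1 by (intro holomorphic_intros) auto

lemma deriv_form: "deriv (form a) z = target_form a (deriv F0 z) (deriv F1 z)"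
  and deriv_coform: "deriv (coform a) z = conj_form a (deriv F0 z) (deriv F1 z)"
proof -
  have "(F0 has_field_derivative deriv F0 z) (at z)" "(F1 has_field_derivative deriv F1 z) (at z)"
    using hol0 hol1 by (auto intro: holomorphic_derivI[of _ UNIV])
  thus "deriv (form a) z = target_form a (deriv F0 z) (deriv F1 z)"
    "deriv (coform a) z = conj_form a (deriv F0 z) (deriv F1 z)"
    unfolding form_def[abs_def] coform_def[abs_def] target_form_def conj_form_def
    by (cases a; auto intro!: DERIV_imp_deriv derivative_eq_intros)+
qed

lemma wronskian_form: "form a z * deriv (coform a) z - deriv (form a) z * coform a z = form_det a * wronskian z"
  unfolding deriv_form deriv_coform unfolding form_def coform_def form_wronskian wronskian_def ..

lemma norm_form_coform: "(cmod (form a z))\<^sup>2 + (cmod (coform a z))\<^sup>2 = cmod (form_det a) * sqnorm z"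
  by (simp add: form_def coform_def form_norm_sum sqnorm_def)

lemma form_eq_0_distinct:
  assumes "form a z = 0" "form b z = 0"
  shows "a = b"
proof (rule ccontr)
  assume "a \<noteq> b"
  from target_forms_independent[OF this] obtain K where
    "\<forall>x y. (cmod x)\<^sup>2 + (cmod y)\<^sup>2 \<le> K * ((cmod (target_form a x y))\<^sup>2 + (cmod (target_form b x y))\<^sup>2)"
    by blast
  from this[rule_format, of "F0 z" "F1 z"] have "sqnorm z \<le> 0"
    using assms by (simp add: form_def sqnorm_def)
  thus False using sqnorm_pos[of z] by simp
qed

lemma form_not_constantly_0: "\<exists>z. form a z \<noteq> 0"
proof (rule ccontr)
  assume "\<not> ?thesis"
  hence "form a = (\<lambda>_. 0)" by auto
  hence "form_det a * wronskian z = 0" for z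
    using wronskian_form[of a z] by (simp add: deriv_const)
  thus False using nondegenerate by (auto simp: wronskian_def)
qed

text \<open>
  Where the truncation of the counting functions comes from.  If a form vanishes to order m at a
  point, then the Wronskian vanishes there to order at least m - 1, because it can be computed from
  that form and its orthogonal form.  One additional simple zero makes the Wronskian divisible by
  the form.  No two forms vanish at the same point, so this may be done for all targets at once.
\<close>

lemma ramified_quotient:
  assumes J: "finite J" "inj_on a J"
    and S: "finite S" "S = (\<Union>j\<in>J. {z \<in> ball 0 R. form (a j) z = 0})" and R: "R > 0"
  obtains K where "K holomorphic_on ball 0 R"
    "\<And>z. z \<in> ball 0 R \<Longrightarrow> wronskian z * (\<Prod>w\<in>S. z - w) = (\<Prod>j\<in>J. form (a j) z) * K z"
proof (rule holomorphic_quotient_exists[of "ball 0 R" "\<lambda>z. \<Prod>j\<in>J. form (a j) z" "\<lambda>z. wronskian z * (\<Prod>w\<in>S. z - w)"])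
  show "(\<lambda>z. \<Prod>j\<in>J. form (a j) z) holomorphic_on ball 0 R"
    by (intro holomorphic_on_prod holomorphic_on_subset[OF hol_form]) auto
  show "(\<lambda>z. wronskian z * (\<Prod>w\<in>S. z - w)) holomorphic_on ball 0 R"
    by (intro holomorphic_intros holomorphic_on_subset[OF hol_wronskian]) auto
  have "\<not> ball 0 R \<subseteq> S"
    using uncountable_ball[OF R] S(1) by (meson countable_finite countable_subset)
  then obtain z where "z \<in> ball 0 R" "z \<notin> S" by blast
  thus "\<exists>z\<in>ball 0 R. (\<Prod>j\<in>J. form (a j) z) \<noteq> 0"
    using S(2) J by (auto simp: prod_zero_iff)
next
  fix z0 assume z0: "z0 \<in> ball 0 R" "(\<Prod>j\<in>J. form (a j) z0) = 0"
  then obtain j where j: "j \<in> J" "form (a j) z0 = 0" using J by (auto simp: prod_zero_iff)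
  have z0S: "z0 \<in> S" using z0 j S by auto
  have nc: "\<not> form (a j) constant_on UNIV"
    using form_not_constantly_0[of "a j"] j(2) by (metis UNIV_I constant_on_def)
  obtain h e1 m where h: "0 < (m::nat)" "0 < e1" "ball z0 e1 \<subseteq> UNIV" "h holomorphic_on ball z0 e1"
      "\<And>w. w \<in> ball z0 e1 \<Longrightarrow> form (a j) w = (w - z0) ^ m * h w" "\<And>w. w \<in> ball z0 e1 \<Longrightarrow> h w \<noteq> 0"
    by (rule holomorphic_factor_zero_nonconstant[OF hol_form open_UNIV Convex.connected_UNIV UNIV_I j(2) nc])
       (rule that; assumption)
  define G' where "G' = (\<lambda>z. \<Prod>i\<in>J - {j}. form (a i) z)"
  have G'hol: "G' holomorphic_on UNIV"
    unfolding G'_def by (intro holomorphic_on_prod hol_form)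
  have "G' z0 \<noteq> 0"
    using J j form_eq_0_distinct[of "a j" z0] by (auto simp: G'_def prod_zero_iff inj_on_def)
  then obtain e2 where e2: "e2 > 0" "\<And>z. dist z0 z < e2 \<Longrightarrow> G' z \<noteq> 0"
    using continuous_at_avoid[of z0 G' 0] G'hol
    by (metis UNIV_I continuous_on_eq_continuous_at holomorphic_on_imp_continuous_on open_UNIV)
  obtain e3 where e3: "e3 > 0" "ball z0 e3 \<subseteq> ball 0 R"
    using z0(1) open_ball openE by blast
  define e where "e = min e1 (min e2 e3)"
  have e: "e > 0" "e \<le> e1" "e \<le> e2" "e \<le> e3" using h e2 e3 by (auto simp: e_def)
  have sub: "ball z0 e \<subseteq> ball z0 e1" using e by auto
  let ?H = "coform (a j)"
  define X where "X = (\<lambda>z. ((z - z0) * h z * deriv ?H z - (of_nat m * h z + (z - z0) * deriv h z) * ?H z) / form_det (a j))"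
  define k where "k = (\<lambda>z. X z * (\<Prod>w\<in>S - {z0}. z - w) / (h z * G' z))"
  have hh: "h holomorphic_on ball z0 e" by (rule holomorphic_on_subset[OF h(4) sub])
  have XW: "wronskian z * (z - z0) = (z - z0) ^ m * X z" if z: "z \<in> ball z0 e" for z
  proof -
    have z1: "z \<in> ball z0 e1" using z sub by auto
    have "(form (a j) has_field_derivative (of_nat m * (z - z0) ^ (m - 1) * h z + (z - z0) ^ m * deriv h z)) (at z)"
    proof (rule has_field_derivative_transform_within_open[OF _ open_ball z1])
      have "(h has_field_derivative deriv h z) (at z)"
        using h(4) z1 by (rule holomorphic_derivI[OF _ open_ball])
      thus "((\<lambda>z. (z - z0) ^ m * h z) has_field_derivative (of_nat m * (z - z0) ^ (m - 1) * h z + (z - z0) ^ m * deriv h z)) (at z)"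
        by (auto intro!: derivative_eq_intros)
      show "(w - z0) ^ m * h w = form (a j) w" if "w \<in> ball z0 e1" for w
        using h(5)[OF that] by simp
    qed
    hence d: "deriv (form (a j)) z = of_nat m * (z - z0) ^ (m - 1) * h z + (z - z0) ^ m * deriv h z"
      by (rule DERIV_imp_deriv)
    have m: "(z - z0) ^ m = (z - z0) * (z - z0) ^ (m - 1)"
      using h(1) by (metis Suc_pred' power_Suc)
    have "form_det (a j) * (wronskian z * (z - z0)) = (form (a j) z * deriv ?H z - deriv (form (a j)) z * ?H z) * (z - z0)"
      by (simp add: wronskian_form)
    also have "\<dots> = (z - z0) ^ m * ((z - z0) * h z * deriv ?H z - (of_nat m * h z + (z - z0) * deriv h z) * ?H z)"
      unfolding d h(5)[OF z1] m by (simp add: algebra_simps)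
    also have "\<dots> = form_det (a j) * ((z - z0) ^ m * X z)" by (simp add: X_def)
    finally show ?thesis by (simp only: mult_cancel_left form_det_nz) simp
  qed
  show "\<exists>k e. e > 0 \<and> ball z0 e \<subseteq> ball 0 R \<and> k holomorphic_on ball z0 e \<and>
       (\<forall>z\<in>ball z0 e. wronskian z * (\<Prod>w\<in>S. z - w) = (\<Prod>j\<in>J. form (a j) z) * k z)"
  proof (intro exI conjI ballI)
    show "e > 0" "ball z0 e \<subseteq> ball 0 R" using e e3 by auto
    have nz: "h z \<noteq> 0" "G' z \<noteq> 0" if "z \<in> ball z0 e" for z
      using that e h(6)[of z] e2(2)[of z] by auto
    show "k holomorphic_on ball z0 e"
      unfolding k_def X_def using nz
      by (intro holomorphic_intros hh holomorphic_on_subset[OF hol_coform] holomorphic_on_subset[OF G'hol]) auto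
    fix z assume z: "z \<in> ball z0 e"
    have "wronskian z * (\<Prod>w\<in>S. z - w) = (wronskian z * (z - z0)) * (\<Prod>w\<in>S - {z0}. z - w)"
      using prod.remove[OF S(1) z0S, of "\<lambda>w. z - w"] by simp
    also have "\<dots> = ((z - z0) ^ m * h z) * G' z * k z"
      unfolding XW[OF z] k_def using nz[OF z] by simp
    also have "((z - z0) ^ m * h z) * G' z = (\<Prod>j\<in>J. form (a j) z)"
      using h(5)[of z] z sub prod.remove[OF J(1) j(1), of "\<lambda>i. form (a i) z"] by (auto simp: G'_def)
    finally show "wronskian z * (\<Prod>w\<in>S. z - w) = (\<Prod>j\<in>J. form (a j) z) * k z" .
  qed
qed auto

text \<open>
  Jensen's inequality for the holomorphic quotient K: its logarithm is the one of the Wronskian plus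
  the simple factors minus the forms, and the simple factors are evaluated by Jensen's formula.
\<close>

lemma circle_mean_ln_forms_le:
  assumes J: "finite J" "inj_on a J" and r: "0 < s" "s \<le> r"
    and good: "\<And>z j. cmod z = s \<or> cmod z = r \<Longrightarrow> wronskian z \<noteq> 0 \<and> (j \<in> J \<longrightarrow> form (a j) z \<noteq> 0)"
  defines "M \<equiv> \<lambda>g. circle_mean (\<lambda>z. ln (cmod (g z)))"
  shows "(\<Sum>j\<in>J. M (form (a j)) r) - M wronskian r \<le> (\<Sum>j\<in>J. M (form (a j)) s) - M wronskian s
          + (\<Sum>j\<in>J. \<Sum>z\<in>{z\<in>ball 0 r. form (a j) z = 0}. ln r - ln (max s (cmod z)))"
proof -
  \<comment> \<open>The disc has to contain the closed disc of radius r; zeros beyond that radius contribute 0 below.\<close>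
  define R where "R = r + 1"
  define Z where "Z = (\<lambda>j. {z\<in>ball 0 R. form (a j) z = 0})"
  define S where "S = (\<Union>j\<in>J. Z j)"
  have R: "R > 0" "r < R" using r by (auto simp: R_def)
  have finZ: "finite (Z j)" for j
    unfolding Z_def using entire_zeros(2)[OF hol_form form_not_constantly_0] by auto
  have S: "finite S" using J finZ by (auto simp: S_def)
  obtain K where K: "K holomorphic_on ball 0 R"
    "\<And>z. z \<in> ball 0 R \<Longrightarrow> wronskian z * (\<Prod>w\<in>S. z - w) = (\<Prod>j\<in>J. form (a j) z) * K z"
    using ramified_quotient[OF J S _ R(1)] unfolding S_def Z_def by blast
  have Sgood: "z \<noteq> w" if "cmod z = s \<or> cmod z = r" "w \<in> S" for z w
    using that good[OF that(1)] by (auto simp: S_def Z_def)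
  have lnK: "ln (cmod (K z)) = ln (cmod (wronskian z)) + (\<Sum>w\<in>S. ln (cmod (z - w))) - (\<Sum>j\<in>J. ln (cmod (form (a j) z)))"
    and K0: "K z \<noteq> 0"
    if z: "cmod z = s \<or> cmod z = r" for z
  proof -
    have zR: "z \<in> ball 0 R" using z r R by auto
    have nz: "wronskian z \<noteq> 0" "(\<Prod>w\<in>S. z - w) \<noteq> 0" "(\<Prod>j\<in>J. form (a j) z) \<noteq> 0"
      using good[OF z] Sgood[OF z] S J by (auto simp: prod_zero_iff)
    show K0: "K z \<noteq> 0" using K(2)[OF zR] nz by auto
    have "ln (cmod (wronskian z * (\<Prod>w\<in>S. z - w))) = ln (cmod ((\<Prod>j\<in>J. form (a j) z) * K z))"
      using K(2)[OF zR] by simp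
    hence "ln (cmod (wronskian z)) + ln (\<Prod>w\<in>S. cmod (z - w)) = ln (\<Prod>j\<in>J. cmod (form (a j) z)) + ln (cmod (K z))"
      using nz K0 by (simp add: norm_mult ln_mult prod_norm)
    moreover have "ln (\<Prod>w\<in>S. cmod (z - w)) = (\<Sum>w\<in>S. ln (cmod (z - w)))"
      using Sgood[OF z] S by (intro ln_prod) auto
    moreover have "ln (\<Prod>j\<in>J. cmod (form (a j) z)) = (\<Sum>j\<in>J. ln (cmod (form (a j) z)))"
      using good[OF z] J by (intro ln_prod) auto
    ultimately show "ln (cmod (K z)) = ln (cmod (wronskian z)) + (\<Sum>w\<in>S. ln (cmod (z - w))) - (\<Sum>j\<in>J. ln (cmod (form (a j) z)))"
      by simp
  qed
  have mean: "M K x = M wronskian x + (\<Sum>w\<in>S. ln (max x (cmod w))) - (\<Sum>j\<in>J. M (form (a j)) x)"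
    if x: "x = s \<or> x = r" for x
  proof -
    have x0: "x > 0" using x r by auto
    have c: "continuous_on (sphere 0 x) (\<lambda>z. ln (cmod (g z)))"
      if "g holomorphic_on UNIV" "\<And>z. cmod z = x \<Longrightarrow> g z \<noteq> 0" for g
      using that by (intro continuous_intros holomorphic_on_imp_continuous_on holomorphic_on_subset[OF that(1)]) auto
    have cW: "continuous_on (sphere 0 x) (\<lambda>z. ln (cmod (wronskian z)))"
      using good x by (intro c hol_wronskian) auto
    have cf: "continuous_on (sphere 0 x) (\<lambda>z. ln (cmod (form (a j) z)))" if "j \<in> J" for j
      using good x that by (intro c hol_form) auto
    have cS: "continuous_on (sphere 0 x) (\<lambda>z. ln (cmod (z - w)))" if "w \<in> S" for w
      using Sgood x that by (intro c holomorphic_intros) auto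
    have "M K x = circle_mean (\<lambda>z. ln (cmod (wronskian z)) + (\<Sum>w\<in>S. ln (cmod (z - w))) - (\<Sum>j\<in>J. ln (cmod (form (a j) z)))) x"
      unfolding M_def by (intro circle_mean_cong lnK) (use x x0 in auto)
    also have "\<dots> = M wronskian x + (\<Sum>w\<in>S. circle_mean (\<lambda>z. ln (cmod (z - w))) x) - (\<Sum>j\<in>J. M (form (a j)) x)"
      unfolding M_def using x0
      by (simp add: circle_mean_diff circle_mean_add circle_mean_sum cW cf cS continuous_on_sum continuous_on_add)
    also have "(\<Sum>w\<in>S. circle_mean (\<lambda>z. ln (cmod (z - w))) x) = (\<Sum>w\<in>S. ln (max x (cmod w)))"
    proof (intro sum.cong refl circle_mean_ln_dist x0)
      fix w assume "w \<in> S" thus "cmod w \<noteq> x" using Sgood[of w w] x by auto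
    qed
    finally show ?thesis .
  qed
  have "M K s \<le> M K r"
    unfolding M_def by (rule circle_mean_ln_holomorphic_mono[OF K(1)]) (use r R K0 in auto)
  hence *: "(\<Sum>j\<in>J. M (form (a j)) r) - M wronskian r \<le> (\<Sum>j\<in>J. M (form (a j)) s) - M wronskian s
     + (\<Sum>w\<in>S. ln (max r (cmod w)) - ln (max s (cmod w)))"
    using mean[of s] mean[of r] by (simp add: sum_subtractf)
  have "(\<Sum>w\<in>S. ln (max r (cmod w)) - ln (max s (cmod w))) = (\<Sum>j\<in>J. \<Sum>w\<in>Z j. ln (max r (cmod w)) - ln (max s (cmod w)))"
    unfolding S_def
  proof (intro sum.UNION_disjoint J finZ ballI impI)
    fix i j assume "i \<in> J" "j \<in> J" "i \<noteq> j"
    thus "Z i \<inter> Z j = {}"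
      using form_eq_0_distinct[of "a i" _ "a j"] J(2) by (auto simp: Z_def inj_on_def)
  qed
  also have "\<dots> = (\<Sum>j\<in>J. \<Sum>z\<in>{z\<in>ball 0 r. form (a j) z = 0}. ln (max r (cmod z)) - ln (max s (cmod z)))"
    by (intro sum.cong refl sum.mono_neutral_right finZ)
       (use r in \<open>auto simp: Z_def R_def max_def\<close>)
  also have "\<dots> = (\<Sum>j\<in>J. \<Sum>z\<in>{z\<in>ball 0 r. form (a j) z = 0}. ln r - ln (max s (cmod z)))"
    by (intro sum.cong refl) (auto simp: max_def)
  finally show ?thesis using * by simp
qed

end

section \<open>The curvature estimate\<close>

context reduced_lift
begin

text \<open>
  The squared spherical derivative, up to normalisation.
\<close>

definition fs_density :: "complex \<Rightarrow> real" where
  "fs_density z = (cmod (wronskian z))\<^sup>2 / (sqnorm z)\<^sup>2"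

text \<open>
  The square of the chordal distance between the image point and a, scaled so that its maximum on
  the sphere is 1.
\<close>

definition chordal_sq :: "complex option \<Rightarrow> complex \<Rightarrow> real" where
  "chordal_sq a z = (cmod (form a z))\<^sup>2 / (cmod (form_det a) * sqnorm z)"

lemma det_sqnorm_pos: "cmod (form_det a) * sqnorm z > 0"
  using sqnorm_pos[of z] by simp

lemma chordal_sq_nonneg: "chordal_sq a z \<ge> 0"
  using det_sqnorm_pos[of a z] by (simp add: chordal_sq_def)

lemma form_sq: "(cmod (form a z))\<^sup>2 = chordal_sq a z * (cmod (form_det a) * sqnorm z)"
  using sqnorm_pos[of z] by (simp add: chordal_sq_def)

lemma coform_sq: "(cmod (coform a z))\<^sup>2 = (1 - chordal_sq a z) * (cmod (form_det a) * sqnorm z)"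
  using norm_form_coform[of a z] form_sq[of a z] by (simp add: algebra_simps)

lemma chordal_sq_le_1: "chordal_sq a z \<le> 1"
  using coform_sq[of a z] det_sqnorm_pos[of a z]
  by (metis diff_ge_0_iff_ge not_less mult_less_0_iff order_less_asym zero_le_power2)

lemma chordal_sq_pos: "form a z \<noteq> 0 \<Longrightarrow> chordal_sq a z > 0"
  using det_sqnorm_pos[of a z] by (simp add: chordal_sq_def)

lemma fs_density_nonneg: "fs_density z \<ge> 0"
  by (simp add: fs_density_def)

lemma continuous_sqnorm: "continuous_on S sqnorm"
  and continuous_fs_density: "continuous_on S fs_density"
  and continuous_chordal_sq: "continuous_on S (chordal_sq a)"
proof -
  have c: "continuous_on S g" if "g holomorphic_on UNIV" for g
    using that by (meson holomorphic_on_imp_continuous_on continuous_on_subset subset_UNIV)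
  show 1: "continuous_on S sqnorm"
    unfolding sqnorm_def[abs_def] by (intro continuous_intros c hol0 hol1)
  show "continuous_on S fs_density"
    unfolding fs_density_def[abs_def] using sqnorm_pos
    by (intro continuous_intros c hol_wronskian 1) (auto simp: order.strict_implies_not_eq[symmetric])
  show "continuous_on S (chordal_sq a)"
    unfolding chordal_sq_def[abs_def] using sqnorm_pos
    by (intro continuous_intros c hol_form 1) (auto simp: order.strict_implies_not_eq[symmetric])
qed

lemma potential_ln_sqnorm: "\<exists>D. potential_on UNIV (\<lambda>z. 1/2 * ln (sqnorm z)) D (\<lambda>z. 2 * fs_density z)"
proof -
  have "\<exists>D. potential_on UNIV (\<lambda>z. 1/2 * ln (sqnorm z)) D (\<lambda>z. 1/2 * (4 * (cmod (F0 z * deriv F1 z - deriv F0 z * F1 z))\<^sup>2 / ((cmod (F0 z))\<^sup>2 + (cmod (F1 z))\<^sup>2)\<^sup>2))"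
    unfolding sqnorm_def
    by (rule exI, rule potential_on_cmult[OF potential_on_ln_norms[OF open_UNIV hol0 hol1 no_common_zero]])
  thus ?thesis by (simp add: fs_density_def wronskian_def sqnorm_def)
qed

text \<open>
  The negative curvature at the heart of the proof.  Write s for the squared chordal distance to a.
  The function -ln (3 - ln s) has a Laplacian of size fs_density / (s (ln s)^2) near a, up to a
  bounded multiple of fs_density, although the function itself tends to minus infinity only like an
  iterated logarithm and is bounded above.  Replacing s by s + e makes it smooth also at the points where
  the value a is taken.  The constant 3 keeps \<psi> at least 2 on the whole sphere, since s + e \<le> 2.
\<close>

lemma curvature_potential:
  fixes a :: "complex option" and e :: real
  assumes e: "0 < e" "e \<le> 1"
  defines "\<psi> \<equiv> \<lambda>z. 3 - ln (chordal_sq a z + e)"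
  shows "\<exists>D L. potential_on UNIV (\<lambda>z. - ln (\<psi> z)) D L \<and>
     (\<forall>z. 4 * fs_density z * (chordal_sq a z / ((chordal_sq a z + e)\<^sup>2 * (\<psi> z)\<^sup>2)) \<le> L z + 4 * fs_density z)"
proof -
  define s where "s = chordal_sq a"
  define c where "c = cmod (form_det a)"
  define p where "p = (\<lambda>z. c * sqnorm z)"
  define G where "G = form a"
  define H where "H = coform a"
  define \<alpha> \<beta> where "\<alpha> = sqrt (1 + e)" and "\<beta> = sqrt e"
  have ab: "\<alpha>\<^sup>2 = 1 + e" "\<beta>\<^sup>2 = e" using e by (auto simp: \<alpha>_def \<beta>_def)
  have p: "p z > 0" for z using det_sqnorm_pos by (simp add: p_def c_def)
  have s: "0 \<le> s z" "s z \<le> 1" for z using chordal_sq_nonneg chordal_sq_le_1 by (auto simp: s_def)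
  have se: "s z + e > 0" for z using s(1)[of z] e by simp
  have GH: "(cmod (G z))\<^sup>2 = s z * p z" "(cmod (H z))\<^sup>2 = (1 - s z) * p z" for z
    unfolding G_def H_def s_def p_def c_def by (rule form_sq coform_sq)+
  have holGH: "G holomorphic_on UNIV" "H holomorphic_on UNIV"
    unfolding G_def H_def by (rule hol_form hol_coform)+
  \<comment> \<open>With these factors ln (s + e) becomes a difference of two potentials of the form ln (|G|^2 + |H|^2).\<close>
  let ?G1 = "\<lambda>z. of_real \<alpha> * G z" and ?H1 = "\<lambda>z. of_real \<beta> * H z"
  have GH1: "(cmod (?G1 z))\<^sup>2 + (cmod (?H1 z))\<^sup>2 = (s z + e) * p z" for z
    by (simp add: norm_mult power_mult_distrib ab GH algebra_simps)
  have GH2: "(cmod (G z))\<^sup>2 + (cmod (H z))\<^sup>2 = p z" for z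
    by (simp add: GH algebra_simps)
  have d1: "deriv ?G1 z = of_real \<alpha> * deriv G z" "deriv ?H1 z = of_real \<beta> * deriv H z" for z
    using holGH by (auto intro!: deriv_cmult simp: holomorphic_on_imp_differentiable_at)
  have W: "cmod (G z * deriv H z - deriv G z * H z) = c * cmod (wronskian z)" for z
    unfolding G_def H_def wronskian_form by (simp add: norm_mult c_def)
  have fsd: "(c * cmod (wronskian z))\<^sup>2 = fs_density z * (p z)\<^sup>2" for z
    using sqnorm_pos[of z] by (simp add: fs_density_def p_def power_mult_distrib)
  have nz1: "?G1 z \<noteq> 0 \<or> ?H1 z \<noteq> 0" for z
  proof (rule ccontr)
    assume "\<not> ?thesis"
    hence "(s z + e) * p z = 0" unfolding GH1[symmetric] by simp
    thus False using se[of z] p[of z] by auto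
  qed
  have nz2: "G z \<noteq> 0 \<or> H z \<noteq> 0" for z
    using GH2[of z] p[of z] by auto
  let ?N1 = "\<lambda>z. deriv ?G1 z * cnj (?G1 z) + deriv ?H1 z * cnj (?H1 z)"
  let ?N2 = "\<lambda>z. deriv G z * cnj (G z) + deriv H z * cnj (H z)"
  define D1 where "D1 = (\<lambda>z. 2 * ?N1 z / of_real ((s z + e) * p z))"
  define D2 where "D2 = (\<lambda>z. 2 * ?N2 z / of_real (p z))"
  define L1 where "L1 = (\<lambda>z. 4 * fs_density z * (e * (1 + e)) / (s z + e)\<^sup>2)"
  have pot1: "potential_on UNIV (\<lambda>z. ln ((s z + e) * p z)) D1 L1"
  proof -
    have "4 * (cmod (?G1 z * deriv ?H1 z - deriv ?G1 z * ?H1 z))\<^sup>2 / ((s z + e) * p z)\<^sup>2 = L1 z" for z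
    proof -
      have "?G1 z * deriv ?H1 z - deriv ?G1 z * ?H1 z = of_real (\<alpha> * \<beta>) * (G z * deriv H z - deriv G z * H z)"
        unfolding d1 by (simp add: algebra_simps)
      hence "(cmod (?G1 z * deriv ?H1 z - deriv ?G1 z * ?H1 z))\<^sup>2 = (\<alpha>\<^sup>2 * \<beta>\<^sup>2) * (c * cmod (wronskian z))\<^sup>2"
        by (simp only: norm_mult W norm_of_real power_mult_distrib power2_abs)
      hence "4 * (cmod (?G1 z * deriv ?H1 z - deriv ?G1 z * ?H1 z))\<^sup>2 / ((s z + e) * p z)\<^sup>2
          = (4 * fs_density z * (e * (1 + e)) * (p z)\<^sup>2) / ((s z + e)\<^sup>2 * (p z)\<^sup>2)"
        unfolding fsd ab by (simp only: power_mult_distrib mult.assoc mult.left_commute mult.commute)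
      also have "\<dots> = L1 z" unfolding L1_def using p[of z] by simp
      finally show ?thesis .
    qed
    moreover have "potential_on UNIV (\<lambda>z. ln ((s z + e) * p z)) D1
       (\<lambda>z. 4 * (cmod (?G1 z * deriv ?H1 z - deriv ?G1 z * ?H1 z))\<^sup>2 / ((s z + e) * p z)\<^sup>2)"
      unfolding D1_def GH1[symmetric]
      by (rule potential_on_ln_norms) (use holGH nz1 in \<open>auto intro!: holomorphic_intros\<close>)
    ultimately show ?thesis by simp
  qed
  have pot2: "potential_on UNIV (\<lambda>z. ln (p z)) D2 (\<lambda>z. 4 * fs_density z)"
  proof -
    have "potential_on UNIV (\<lambda>z. ln (p z)) D2 (\<lambda>z. 4 * (cmod (G z * deriv H z - deriv G z * H z))\<^sup>2 / (p z)\<^sup>2)"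
      unfolding D2_def GH2[symmetric] by (rule potential_on_ln_norms[OF open_UNIV holGH nz2])
    thus ?thesis unfolding W fsd using p by (simp add: order.strict_implies_not_eq[symmetric])
  qed
  define D L where "D = (\<lambda>z. D2 z - D1 z)" and "L = (\<lambda>z. 4 * fs_density z - L1 z)"
  have pot\<psi>: "potential_on UNIV \<psi> D L"
  proof -
    have "potential_on UNIV (\<lambda>z. 3 + (ln (p z) + - ln ((s z + e) * p z))) (\<lambda>z. 0 + (D2 z + - D1 z)) (\<lambda>z. 0 + (4 * fs_density z + - L1 z))"
      by (intro potential_on_add potential_on_const potential_on_neg pot1 pot2)
    moreover have "3 + (ln (p z) + - ln ((s z + e) * p z)) = \<psi> z" for z
      using p[of z] se[of z] by (simp add: \<psi>_def ln_mult s_def)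
    ultimately show ?thesis by (simp add: D_def L_def)
  qed
  \<comment> \<open>Since \<alpha>^2 - \<beta>^2 = 1, the two gradients combine to a multiple of the Wronskian of G and H.\<close>
  have normD: "(cmod (D z))\<^sup>2 = 4 * fs_density z * (s z * (1 - s z)) / (s z + e)\<^sup>2" for z
  proof -
    have pc: "of_real (p z) = G z * cnj (G z) + H z * cnj (H z)"
      unfolding GH2[symmetric] by (simp only: of_real_add complex_norm_square)
    have sc: "of_real ((s z + e) * p z) = of_real (1 + e) * (G z * cnj (G z)) + of_real e * (H z * cnj (H z))"
      unfolding GH1[symmetric] norm_mult power_mult_distrib norm_of_real power2_abs ab
      by (simp only: of_real_add of_real_mult complex_norm_square)
    have N1: "?N1 z = of_real (1 + e) * (deriv G z * cnj (G z)) + of_real e * (deriv H z * cnj (H z))"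
    proof -
      have "of_real (1 + e) = complex_of_real \<alpha> * of_real \<alpha>" "of_real e = complex_of_real \<beta> * of_real \<beta>"
        by (metis ab(1) of_real_mult power2_eq_square, metis ab(2) of_real_mult power2_eq_square)
      thus ?thesis unfolding d1 by simp
    qed
    have "D z = 2 * (?N2 z * of_real ((s z + e) * p z) - ?N1 z * of_real (p z)) / (of_real (p z) * of_real ((s z + e) * p z))"
    proof -
      have frac: "2 * x / A - 2 * y / B = 2 * (x * B - y * A) / (A * B)" if "A \<noteq> 0" "B \<noteq> 0" for x y A B :: complex
        using that by (simp add: field_simps)
      have "complex_of_real (p z) \<noteq> 0" "complex_of_real ((s z + e) * p z) \<noteq> 0"
        unfolding of_real_eq_0_iff using p[of z] se[of z] by auto
      thus ?thesis unfolding D_def D1_def D2_def by (rule frac)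
    qed
    also have "?N2 z * of_real ((s z + e) * p z) - ?N1 z * of_real (p z)
        = cnj (G z) * cnj (H z) * (G z * deriv H z - deriv G z * H z)"
      unfolding N1 pc sc by (simp add: algebra_simps)
    finally have Dz: "D z = 2 * (cnj (G z) * cnj (H z) * (G z * deriv H z - deriv G z * H z)) / (of_real (p z) * of_real ((s z + e) * p z))"
      (is "_ = 2 * ?num / ?den") .
    have "p z * ((s z + e) * p z) > 0" using p[of z] se[of z] by auto
    moreover have "cmod ?den = \<bar>p z * ((s z + e) * p z)\<bar>"
      by (simp only: of_real_mult[symmetric] norm_of_real)
    moreover have "cmod ?num = cmod (G z) * cmod (H z) * (c * cmod (wronskian z))"
      by (simp only: norm_mult complex_mod_cnj W)
    moreover have "cmod (D z) = 2 * cmod ?num / cmod ?den"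
      unfolding Dz by (simp only: norm_divide norm_mult[of 2] norm_numeral)
    ultimately have "cmod (D z) = 2 * (cmod (G z) * cmod (H z) * (c * cmod (wronskian z))) / (p z * ((s z + e) * p z))"
      by (simp only: abs_of_pos)
    hence "(cmod (D z))\<^sup>2 = 4 * ((cmod (G z))\<^sup>2 * (cmod (H z))\<^sup>2 * (c * cmod (wronskian z))\<^sup>2) / (p z * ((s z + e) * p z))\<^sup>2"
      by (simp add: power_mult_distrib power_divide)
    also have "\<dots> = 4 * fs_density z * (s z * (1 - s z)) / (s z + e)\<^sup>2"
    proof -
      have "4 * (s z * p z * ((1 - s z) * p z) * (fs_density z * (p z)\<^sup>2)) / (p z * ((s z + e) * p z))\<^sup>2
          = (4 * fs_density z * (s z * (1 - s z))) * ((p z)\<^sup>2 * (p z)\<^sup>2) / ((s z + e)\<^sup>2 * ((p z)\<^sup>2 * (p z)\<^sup>2))"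
        by (simp only: power2_eq_square mult.assoc mult.commute mult.left_commute)
      also have "\<dots> = 4 * fs_density z * (s z * (1 - s z)) / (s z + e)\<^sup>2"
        using p[of z] by simp
      finally show ?thesis unfolding GH fsd .
    qed
    finally show ?thesis .
  qed
  have \<psi>2: "\<psi> z \<ge> 2" for z
  proof -
    have "ln (s z + e) \<le> (s z + e) - 1" using se by (intro ln_le_minus_one)
    thus ?thesis using s(2)[of z] e by (simp add: \<psi>_def s_def)
  qed
  have pot: "potential_on UNIV (\<lambda>z. - ln (\<psi> z)) (\<lambda>z. of_real (- 1 / \<psi> z) * D z)
       (\<lambda>z. 1 / (\<psi> z)\<^sup>2 * (cmod (D z))\<^sup>2 + (- 1 / \<psi> z) * L z)"
  proof (rule potential_on_compose[OF pot\<psi>, where k="\<lambda>x. - ln x" and k'="\<lambda>x. - 1 / x" and k''="\<lambda>x. 1 / x\<^sup>2"])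
    fix z
    have pos: "\<psi> z > 0" using \<psi>2[of z] by simp
    show "((\<lambda>x. - ln x) has_real_derivative - 1 / \<psi> z) (at (\<psi> z))"
      using pos by (auto intro!: derivative_eq_intros)
    show "((\<lambda>x. - 1 / x) has_real_derivative 1 / (\<psi> z)\<^sup>2) (at (\<psi> z))"
      using pos by (auto intro!: derivative_eq_intros simp: power2_eq_square)
  next
    have "\<psi> z \<noteq> 0" for z using \<psi>2[of z] by auto
    thus "continuous_on UNIV (\<lambda>z. 1 / (\<psi> z)\<^sup>2)"
      by (intro continuous_intros potential_onD(1)[OF pot\<psi>]) auto
  qed
  have lower: "4 * fs_density z * (s z / ((s z + e)\<^sup>2 * (\<psi> z)\<^sup>2)) \<le> (1 / (\<psi> z)\<^sup>2 * (cmod (D z))\<^sup>2 + (- 1 / \<psi> z) * L z) + 4 * fs_density z" for z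
  proof -
    define x y f where "x = s z" and "y = \<psi> z" and "f = fs_density z"
    have x: "0 \<le> x" "x + e > 0" using s se by (auto simp: x_def)
    have y: "y \<ge> 2" using \<psi>2 by (simp add: y_def)
    have f: "f \<ge> 0" by (simp add: f_def fs_density_nonneg)
    have "x\<^sup>2 / ((x + e)\<^sup>2 * y\<^sup>2) \<le> 1 / y\<^sup>2"
    proof -
      have "x\<^sup>2 \<le> (x + e)\<^sup>2" using x e by (intro power_mono) auto
      hence "x\<^sup>2 / (x + e)\<^sup>2 \<le> 1" using x by (simp add: divide_le_eq_1)
      hence "x\<^sup>2 / (x + e)\<^sup>2 / y\<^sup>2 \<le> 1 / y\<^sup>2" by (intro divide_right_mono) auto
      thus ?thesis by simp
    qed
    also have "1 / y\<^sup>2 \<le> 1 / 2\<^sup>2" using y by (intro divide_left_mono power_mono) auto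
    finally have 1: "x\<^sup>2 / ((x + e)\<^sup>2 * y\<^sup>2) \<le> 1 / 4" by simp
    have 2: "1 / y \<le> 1 / 2" using y by (intro divide_left_mono) auto
    have 3: "e * (1 + e) / (x + e)\<^sup>2 / y \<ge> 0" using e y by auto
    have "x / ((x + e)\<^sup>2 * y\<^sup>2) \<le> x / ((x + e)\<^sup>2 * y\<^sup>2) - x\<^sup>2 / ((x + e)\<^sup>2 * y\<^sup>2) - 1 / y + e * (1 + e) / (x + e)\<^sup>2 / y + 1"
      using 1 2 3 by linarith
    hence "4 * f * (x / ((x + e)\<^sup>2 * y\<^sup>2)) \<le> 4 * f * (x / ((x + e)\<^sup>2 * y\<^sup>2) - x\<^sup>2 / ((x + e)\<^sup>2 * y\<^sup>2) - 1 / y + e * (1 + e) / (x + e)\<^sup>2 / y + 1)"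
      using f by (intro mult_left_mono) auto
    also have "\<dots> = (1 / y\<^sup>2 * (4 * f * (x * (1 - x)) / (x + e)\<^sup>2) + (- 1 / y) * (4 * f - 4 * f * (e * (1 + e)) / (x + e)\<^sup>2)) + 4 * f"
    proof -
      have "4 * f * (x / (A * B) - x\<^sup>2 / (A * B) - 1 / y + K / A / y + 1)
          = (1 / B * (4 * f * (x * (1 - x)) / A) + (- 1 / y) * (4 * f - 4 * f * K / A)) + 4 * f"
        if "A \<noteq> 0" "B \<noteq> 0" for A B K
        using that y by (simp add: field_simps power2_eq_square)
      from this[of "(x + e)\<^sup>2" "y\<^sup>2" "e * (1 + e)"] show ?thesis using x y by simp
    qed
    finally show ?thesis unfolding normD L_def L1_def x_def y_def f_def .
  qed
  show ?thesis using pot lower unfolding s_def by blast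
qed

text \<open>
  The potentials of the previous lemma, summed over the targets and corrected by a multiple of
  ln |F|, have nonnegative Laplacian and means bounded above by the characteristic function.  Hence
  the growth lemma bounds the mean of their Laplacian.  The bounds for e = 1 / (k + 1) hold off sets
  Ek of uniformly bounded measure.  On a given circle without zeros of the forms, e eventually drops
  below s, and then the regularised density is at least a quarter of the one for e = 0.
\<close>

lemma chordal_average_bound:
  fixes a :: "nat \<Rightarrow> complex option" and s0 :: real
  assumes J: "finite J" and s0: "s0 \<ge> 1" and good0: "\<And>z j. cmod z = s0 \<Longrightarrow> j \<in> J \<Longrightarrow> form (a j) z \<noteq> 0"
  defines "m \<equiv> circle_mean (\<lambda>z. 1/2 * ln (sqnorm z))"
  shows "\<exists>C. \<forall>d. 0 < d \<longrightarrow> d \<le> 1 \<longrightarrow> (\<exists>E\<in>sets borel. emeasure lborel E \<le> ennreal (2 / d) \<and>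
     (\<forall>r. r \<ge> s0 \<longrightarrow> r \<notin> E \<longrightarrow> (\<forall>z j. cmod z = r \<longrightarrow> j \<in> J \<longrightarrow> form (a j) z \<noteq> 0) \<longrightarrow>
        circle_mean (\<lambda>z. fs_density z * (\<Sum>j\<in>J. 1 / (chordal_sq (a j) z * (3 - ln (chordal_sq (a j) z))\<^sup>2))) r
          \<le> 4 * r powr d * (C + 2 * real (card J) * (m r - m s0)) ^ 4))"
proof -
  let ?n = "real (card J)"
  define s where "s = (\<lambda>j. chordal_sq (a j))"
  have s: "0 \<le> s j z" "s j z \<le> 1" for j z using chordal_sq_nonneg chordal_sq_le_1 by (auto simp: s_def)
  have sp: "0 < s j z" if "form (a j) z \<noteq> 0" for j z using chordal_sq_pos[OF that] by (simp add: s_def)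
  have cs: "continuous_on S (s j)" for S j unfolding s_def by (rule continuous_chordal_sq)
  define C where "C = 1 + (\<Sum>j\<in>J. circle_mean (\<lambda>z. ln (3 - ln (s j z))) s0)"
  define ep where "ep = (\<lambda>k::nat. 1 / (real k + 1))"
  have ep: "0 < ep k" "ep k \<le> 1" for k by (auto simp: ep_def)
  define v where "v = (\<lambda>k j z. - ln (3 - ln (s j z + ep k)))"
  obtain Du where Du: "potential_on UNIV (\<lambda>z. 1/2 * ln (sqnorm z)) Du (\<lambda>z. 2 * fs_density z)"
    using potential_ln_sqnorm by blast
  have "\<exists>D L. potential_on UNIV (v k j) D L \<and>
     (\<forall>z. 4 * fs_density z * (s j z / ((s j z + ep k)\<^sup>2 * (3 - ln (s j z + ep k))\<^sup>2)) \<le> L z + 4 * fs_density z)" for k j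
    using curvature_potential[OF ep] unfolding v_def s_def by blast
  then obtain D L where DL: "\<And>k j. potential_on UNIV (v k j) (D k j) (L k j)"
    "\<And>k j z. 4 * fs_density z * (s j z / ((s j z + ep k)\<^sup>2 * (3 - ln (s j z + ep k))\<^sup>2)) \<le> L k j z + 4 * fs_density z"
    by metis
  define Y where "Y = (\<lambda>k z. (\<Sum>j\<in>J. v k j z) + (2 * ?n) * (1/2 * ln (sqnorm z)))"
  define LY where "LY = (\<lambda>k z. (\<Sum>j\<in>J. L k j z) + (2 * ?n) * (2 * fs_density z))"
  have potY: "\<exists>DY. potential_on UNIV (Y k) DY (LY k)" for k
    unfolding Y_def LY_def by (rule exI, rule potential_on_add[OF potential_on_sum[OF DL(1)] potential_on_cmult[OF Du]])
  have LY: "4 * fs_density z * (\<Sum>j\<in>J. s j z / ((s j z + ep k)\<^sup>2 * (3 - ln (s j z + ep k))\<^sup>2)) \<le> LY k z" for k z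
  proof -
    have "(\<Sum>j\<in>J. 4 * fs_density z * (s j z / ((s j z + ep k)\<^sup>2 * (3 - ln (s j z + ep k))\<^sup>2))) \<le> (\<Sum>j\<in>J. L k j z + 4 * fs_density z)"
      by (intro sum_mono DL)
    thus ?thesis by (simp add: LY_def sum.distrib sum_distrib_left)
  qed
  have LY0: "LY k z \<ge> 0" for k z
    by (rule order.trans[OF _ LY]) (intro mult_nonneg_nonneg sum_nonneg divide_nonneg_nonneg fs_density_nonneg s, auto)
  have cu: "continuous_on S (\<lambda>z. 1/2 * ln (sqnorm z))" for S
    using continuous_on_subset[OF potential_onD(1)[OF Du]] by auto
  have cv: "continuous_on S (v k j)" for S k j
    using continuous_on_subset[OF potential_onD(1)[OF DL(1)]] by auto
  have meanY: "circle_mean (Y k) r = (\<Sum>j\<in>J. circle_mean (v k j) r) + 2 * ?n * m r" if "r \<ge> 0" for k r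
    unfolding Y_def m_def circle_mean_add[OF continuous_on_sum[OF cv] continuous_on_mult_left[OF cu] that]
    by (simp only: circle_mean_cmult circle_mean_sum[OF cv that])
  have mean_bound: "1 + (circle_mean (Y k) r - circle_mean (Y k) s0) \<le> C + 2 * ?n * (m r - m s0)" if r: "r \<ge> s0" for k r
  proof -
    have "circle_mean (v k j) r \<le> 0" for j
    proof -
      have "circle_mean (v k j) r \<le> circle_mean (\<lambda>_. 0) r"
      proof (rule circle_mean_mono[OF cv continuous_on_const])
        fix z
        have "ln (s j z + ep k) \<le> (s j z + ep k) - 1" using s[of j z] ep[of k] by (intro ln_le_minus_one) linarith
        hence "3 - ln (s j z + ep k) \<ge> 1" using s[of j z] ep[of k] by linarith
        thus "v k j z \<le> 0" by (simp add: v_def)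
      qed (use r s0 in auto)
      thus ?thesis by simp
    qed
    hence 1: "(\<Sum>j\<in>J. circle_mean (v k j) r) \<le> 0" by (intro sum_nonpos)
    have "- circle_mean (\<lambda>z. ln (3 - ln (s j z))) s0 \<le> circle_mean (v k j) s0" if j: "j \<in> J" for j
    proof -
      have nz: "s j z \<noteq> 0" "3 - ln (s j z) \<noteq> 0" if "cmod z = s0" for z
      proof -
        have "s j z > 0" using sp good0 j that by blast
        thus "s j z \<noteq> 0" by simp
        have "ln (s j z) \<le> 0" using s[of j z] \<open>s j z > 0\<close> by (simp add: ln_le_zero_iff)
        thus "3 - ln (s j z) \<noteq> 0" by simp
      qed
      have c: "continuous_on (sphere 0 s0) (\<lambda>z. ln (3 - ln (s j z)))"
        by (intro continuous_intros cs) (use nz in auto)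
      have "circle_mean (\<lambda>z. - 1 * ln (3 - ln (s j z))) s0 \<le> circle_mean (v k j) s0"
      proof (rule circle_mean_mono[OF continuous_on_mult_left[OF c] cv])
        fix z assume z: "cmod z = s0"
        have pos: "s j z > 0" using sp good0 z j by blast
        have "ln (s j z + ep k) \<le> (s j z + ep k) - 1" using s[of j z] ep[of k] pos by (intro ln_le_minus_one) linarith
        hence "3 - ln (s j z + ep k) \<ge> 1" using s[of j z] ep[of k] by linarith
        moreover have "ln (s j z) \<le> ln (s j z + ep k)"
          using pos ep[of k] by (intro ln_mono) auto
        ultimately show "- 1 * ln (3 - ln (s j z)) \<le> v k j z"
          by (simp add: v_def)
      qed (use s0 in auto)
      thus ?thesis using circle_mean_cmult[of "-1" "\<lambda>z. ln (3 - ln (s j z))" s0] by simp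
    qed
    hence "- (\<Sum>j\<in>J. circle_mean (\<lambda>z. ln (3 - ln (s j z))) s0) \<le> (\<Sum>j\<in>J. circle_mean (v k j) s0)"
      unfolding sum_negf[symmetric] by (intro sum_mono)
    thus ?thesis using 1 r s0 by (simp add: meanY C_def algebra_simps)
  qed
  show ?thesis
  proof (intro exI[of _ C] allI impI)
    fix d :: real assume d: "0 < d" "d \<le> 1"
    have "\<exists>E. E \<in> sets borel \<and> emeasure lborel E \<le> ennreal (2 / d) \<and>
       (\<forall>r. r \<ge> s0 \<longrightarrow> r \<notin> E \<longrightarrow> circle_mean (LY k) r \<le> 4 * r powr d * (1 + (circle_mean (Y k) r - circle_mean (Y k) s0)) ^ 4)" for k
    proof -
      obtain DY where "potential_on UNIV (Y k) DY (LY k)" using potY by blast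
      from circle_mean_laplacian_le[OF this LY0 s0 d] show ?thesis by metis
    qed
    then obtain Ek where Ek: "\<And>k. Ek k \<in> sets borel" "\<And>k. emeasure lborel (Ek k) \<le> ennreal (2 / d)"
       "\<And>k r. r \<ge> s0 \<Longrightarrow> r \<notin> Ek k \<Longrightarrow> circle_mean (LY k) r \<le> 4 * r powr d * (1 + (circle_mean (Y k) r - circle_mean (Y k) s0)) ^ 4"
      by metis
    \<comment> \<open>The lower limit of the exceptional sets: its measure obeys the common bound, and outside it the estimate holds for infinitely many k.\<close>
    define E where "E = (\<Union>n. \<Inter>k\<in>{n..}. Ek k)"
    have Em: "(\<Inter>k\<in>{n..}. Ek k) \<in> sets borel" for n
      using Ek(1) by (intro sets.countable_INT') auto
    have E: "E \<in> sets borel" unfolding E_def using Em by auto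
    have "emeasure lborel E = (SUP n. emeasure lborel (\<Inter>k\<in>{n..}. Ek k))"
      unfolding E_def using Em by (intro SUP_emeasure_incseq[symmetric]) (auto simp: incseq_def)
    also have "\<dots> \<le> ennreal (2 / d)"
    proof (rule SUP_least)
      fix n
      have "emeasure lborel (\<Inter>k\<in>{n..}. Ek k) \<le> emeasure lborel (Ek n)"
        using Ek(1) by (intro emeasure_mono) auto
      thus "emeasure lborel (\<Inter>k\<in>{n..}. Ek k) \<le> ennreal (2 / d)" using Ek(2) order.trans by blast
    qed
    finally have E2: "emeasure lborel E \<le> ennreal (2 / d)" .
    have main: "circle_mean (\<lambda>z. fs_density z * (\<Sum>j\<in>J. 1 / (s j z * (3 - ln (s j z))\<^sup>2))) r
          \<le> 4 * r powr d * (C + 2 * ?n * (m r - m s0)) ^ 4"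
      if r: "r \<ge> s0" "r \<notin> E" and good: "\<And>z j. cmod z = r \<Longrightarrow> j \<in> J \<Longrightarrow> form (a j) z \<noteq> 0" for r
    proof -
      have r0: "r > 0" using r s0 by simp
      have sr: "s j z > 0" if "cmod z = r" "j \<in> J" for j z using sp good that by blast
      have "\<exists>\<mu>>0. \<forall>z. cmod z = r \<longrightarrow> \<mu> \<le> s j z" if j: "j \<in> J" for j
      proof -
        have "sphere (0::complex) r \<noteq> {}" using r0 by simp
        then obtain z0 where "z0 \<in> sphere 0 r" "\<And>z. z \<in> sphere 0 r \<Longrightarrow> s j z0 \<le> s j z"
          using continuous_attains_inf[OF compact_sphere _ cs] by blast
        thus ?thesis using sr[of z0 j] j by (intro exI[of _ "s j z0"]) auto
      qed
      then obtain \<mu> where \<mu>: "\<And>j. j \<in> J \<Longrightarrow> \<mu> j > 0" "\<And>j z. j \<in> J \<Longrightarrow> cmod z = r \<Longrightarrow> \<mu> j \<le> s j z"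
        by metis
      obtain N where N: "\<And>j k. j \<in> J \<Longrightarrow> k \<ge> N \<Longrightarrow> ep k \<le> \<mu> j"
      proof -
        have "\<exists>N. \<forall>k\<ge>N. ep k \<le> \<mu> j" if "j \<in> J" for j
        proof -
          obtain N :: nat where N: "1 / \<mu> j \<le> real N" using real_arch_simple by blast
          have "ep k \<le> \<mu> j" if k: "k \<ge> N" for k
          proof -
            have "1 / \<mu> j \<le> real k + 1" using N k by linarith
            thus ?thesis using \<mu>(1)[OF \<open>j \<in> J\<close>] by (simp add: ep_def field_simps)
          qed
          thus ?thesis by blast
        qed
        then obtain M where M: "\<And>j k. j \<in> J \<Longrightarrow> k \<ge> M j \<Longrightarrow> ep k \<le> \<mu> j" by metis
        have "ep k \<le> \<mu> j" if "j \<in> J" "k \<ge> (\<Sum>j\<in>J. M j)" for j k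
          using M[OF that(1), of k] member_le_sum[of j J M] that J by auto
        thus thesis using that by blast
      qed
      obtain k where k: "k \<ge> N" "r \<notin> Ek k" using r(2) unfolding E_def by auto
      let ?f = "\<lambda>z. fs_density z * (\<Sum>j\<in>J. 1 / (s j z * (3 - ln (s j z))\<^sup>2))"
      have ln0: "ln (s j z) \<le> 0" if "cmod z = r" "j \<in> J" for j z
        using s[of j z] sr[OF that] by (simp add: ln_le_zero_iff)
      have "circle_mean ?f r \<le> circle_mean (LY k) r"
      proof (rule circle_mean_mono)
        have nz: "s j z * (3 - ln (s j z))\<^sup>2 \<noteq> 0" if "cmod z = r" "j \<in> J" for z j
        proof -
          have "3 - ln (s j z) \<noteq> 0" using ln0[OF that] by linarith
          thus ?thesis using sr[OF that] by (metis less_irrefl mult_eq_0_iff power_eq_0_iff)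
        qed
        show "continuous_on (sphere 0 r) ?f"
          by (intro continuous_intros continuous_fs_density cs) (use nz sr in fastforce)+
        show "continuous_on (sphere 0 r) (LY k)"
          using potY[of k] potential_onD(3) continuous_on_subset by (metis subset_UNIV)
        fix z assume z: "cmod z = r"
        have "?f z = 4 * fs_density z * (\<Sum>j\<in>J. 1 / (4 * (s j z * (3 - ln (s j z))\<^sup>2)))"
          by (simp add: sum_distrib_left mult.commute)
        also have "\<dots> \<le> 4 * fs_density z * (\<Sum>j\<in>J. s j z / ((s j z + ep k)\<^sup>2 * (3 - ln (s j z + ep k))\<^sup>2))"
        proof (intro mult_left_mono sum_mono)
          fix j assume j: "j \<in> J"
          define x where "x = s j z"
          have x: "x > 0" using sr[OF z j] by (simp add: x_def)
          have ex: "ep k \<le> x" using N[OF j k(1)] \<mu>(2)[OF j z] by (simp add: x_def)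
          have "ln (x + ep k) \<le> (x + ep k) - 1" using x ep[of k] by (intro ln_le_minus_one) linarith
          hence p1: "3 - ln (x + ep k) \<ge> 1" using s[of j z] ep[of k] by (simp add: x_def)
          have p2: "3 - ln (x + ep k) \<le> 3 - ln x" using x ep[of k] by simp
          have "1 / (4 * (x * (3 - ln x)\<^sup>2)) = x / ((2 * x)\<^sup>2 * (3 - ln x)\<^sup>2)"
            using x by (simp add: power2_eq_square)
          also have "\<dots> \<le> x / ((x + ep k)\<^sup>2 * (3 - ln (x + ep k))\<^sup>2)"
          proof (rule divide_left_mono)
            have p3: "3 - ln x > 0" using p1 p2 by linarith
            have "0 < (2 * x)\<^sup>2 * (3 - ln x)\<^sup>2" using x p3 by (intro mult_pos_pos zero_less_power) auto
            moreover have "0 < (x + ep k)\<^sup>2 * (3 - ln (x + ep k))\<^sup>2"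
              using x ep[of k] p1 by (intro mult_pos_pos zero_less_power) linarith+
            ultimately show "0 < (2 * x)\<^sup>2 * (3 - ln x)\<^sup>2 * ((x + ep k)\<^sup>2 * (3 - ln (x + ep k))\<^sup>2)"
              by (rule mult_pos_pos)
            show "(x + ep k)\<^sup>2 * (3 - ln (x + ep k))\<^sup>2 \<le> (2 * x)\<^sup>2 * (3 - ln x)\<^sup>2"
              using x ex p1 p2 ep[of k] by (intro mult_mono power_mono zero_le_power2) linarith+
          qed (use x in simp)
          finally show "1 / (4 * (s j z * (3 - ln (s j z))\<^sup>2)) \<le> s j z / ((s j z + ep k)\<^sup>2 * (3 - ln (s j z + ep k))\<^sup>2)"
            by (simp add: x_def)
        qed (simp add: fs_density_nonneg)
        also have "\<dots> \<le> LY k z" by (rule LY)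
        finally show "?f z \<le> LY k z" .
      qed (use r0 in auto)
      also have "\<dots> \<le> 4 * r powr d * (1 + (circle_mean (Y k) r - circle_mean (Y k) s0)) ^ 4"
        by (rule Ek(3)[OF r(1) k(2)])
      also have "\<dots> \<le> 4 * r powr d * (C + 2 * ?n * (m r - m s0)) ^ 4"
      proof (intro mult_left_mono power_mono mean_bound r(1))
        obtain DY where DY: "potential_on UNIV (Y k) DY (LY k)" using potY by blast
        have "circle_mean (Y k) s0 \<le> circle_mean (Y k) r"
          by (rule circle_mean_subharmonic_mono[OF potential_on_subset[OF DY], where R="r+1"]) (use r s0 LY0 in auto)
        thus "0 \<le> 1 + (circle_mean (Y k) r - circle_mean (Y k) s0)" by simp
      qed auto
      finally show ?thesis .
    qed
    show "\<exists>E\<in>sets borel. emeasure lborel E \<le> ennreal (2 / d) \<and>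
     (\<forall>r. r \<ge> s0 \<longrightarrow> r \<notin> E \<longrightarrow> (\<forall>z j. cmod z = r \<longrightarrow> j \<in> J \<longrightarrow> form (a j) z \<noteq> 0) \<longrightarrow>
        circle_mean (\<lambda>z. fs_density z * (\<Sum>j\<in>J. 1 / (chordal_sq (a j) z * (3 - ln (chordal_sq (a j) z))\<^sup>2))) r
          \<le> 4 * r powr d * (C + 2 * real (card J) * (m r - m s0)) ^ 4)"
      using main E E2 unfolding s_def by blast
  qed
qed

end

section \<open>The second main theorem\<close>

lemma ln_one_plus_le: "T \<ge> 0 \<Longrightarrow> A > 0 \<Longrightarrow> ln (A * (1 + T)) \<le> ln A + ln 2 + max (ln T) (0::real)"
proof -
  assume T: "T \<ge> 0" and A: "A > 0"
  have "ln (1 + T) \<le> ln 2 + max (ln T) 0"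
  proof (cases "T \<le> 1")
    case True
    hence "ln (1 + T) \<le> ln 2" using T by (intro ln_mono) auto
    thus ?thesis by simp
  next
    case False
    hence "ln (1 + T) \<le> ln (2 * T)" by (intro ln_mono) auto
    also have "\<dots> = ln 2 + ln T" using False by (simp add: ln_mult)
    finally show ?thesis by simp
  qed
  thus ?thesis using A T by (simp add: ln_mult)
qed

context reduced_lift
begin

text \<open>
  Distinct points of the sphere have positive distance, so no point is close to two of them.
\<close>

lemma chordal_sq_separated:
  assumes J: "finite J" "inj_on a J"
  shows "\<exists>\<eta>>0. \<forall>z. \<forall>i\<in>J. \<forall>j\<in>J. i \<noteq> j \<longrightarrow> chordal_sq (a i) z \<ge> \<eta> \<or> chordal_sq (a j) z \<ge> \<eta>"
proof -
  have "\<exists>K>0. \<forall>z. 1 \<le> K * (chordal_sq (a i) z + chordal_sq (a j) z)" if ij: "i \<in> J" "j \<in> J" "i \<noteq> j" for i j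
  proof -
    have "a i \<noteq> a j" using ij J by (auto simp: inj_on_def)
    then obtain K where K: "K > 0" "\<And>x y. (cmod x)\<^sup>2 + (cmod y)\<^sup>2 \<le> K * ((cmod (target_form (a i) x y))\<^sup>2 + (cmod (target_form (a j) x y))\<^sup>2)"
      using target_forms_independent by blast
    define di dj where "di = cmod (form_det (a i))" and "dj = cmod (form_det (a j))"
    have d: "di \<ge> 1" "dj \<ge> 1" using cmod_form_det_ge_1 by (auto simp: di_def dj_def)
    have "1 \<le> K * (di + dj) * (chordal_sq (a i) z + chordal_sq (a j) z)" for z
    proof -
      define x y where "x = chordal_sq (a i) z" and "y = chordal_sq (a j) z"
      have xy: "x \<ge> 0" "y \<ge> 0" using chordal_sq_nonneg by (auto simp: x_def y_def)
      have "sqnorm z \<le> K * ((cmod (form (a i) z))\<^sup>2 + (cmod (form (a j) z))\<^sup>2)"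
        using K(2)[of "F0 z" "F1 z"] by (simp add: sqnorm_def form_def)
      also have "\<dots> = K * (x * di + y * dj) * sqnorm z"
        unfolding form_sq x_def y_def di_def dj_def by (simp add: algebra_simps)
      finally have "1 \<le> K * (x * di + y * dj)" using sqnorm_pos[of z] by simp
      also have "\<dots> \<le> K * ((di + dj) * (x + y))"
      proof -
        have "x * di + y * dj \<le> (di + dj) * (x + y)"
          using xy d by (simp add: algebra_simps)
        thus ?thesis using K(1) by (intro mult_left_mono) auto
      qed
      finally show ?thesis by (simp add: x_def y_def mult.assoc)
    qed
    thus ?thesis using K(1) d by (intro exI[of _ "K * (di + dj)"]) auto
  qed
  then obtain K where K: "\<And>i j. i \<in> J \<Longrightarrow> j \<in> J \<Longrightarrow> i \<noteq> j \<Longrightarrow> K i j > 0"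
    "\<And>i j z. i \<in> J \<Longrightarrow> j \<in> J \<Longrightarrow> i \<noteq> j \<Longrightarrow> 1 \<le> K i j * (chordal_sq (a i) z + chordal_sq (a j) z)"
    by metis
  define M where "M = 1 + (\<Sum>p\<in>J\<times>J. \<bar>K (fst p) (snd p)\<bar>)"
  have M: "M > 0" by (simp add: M_def add_pos_nonneg sum_nonneg)
  have KM: "K i j \<le> M" if "i \<in> J" "j \<in> J" for i j
    using member_le_sum[of "(i, j)" "J \<times> J" "\<lambda>p. \<bar>K (fst p) (snd p)\<bar>"] that J by (auto simp: M_def)
  have "chordal_sq (a i) z \<ge> 1 / (2 * M) \<or> chordal_sq (a j) z \<ge> 1 / (2 * M)"
    if ij: "i \<in> J" "j \<in> J" "i \<noteq> j" for i j z
  proof (rule ccontr)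
    assume "\<not> ?thesis"
    hence *: "chordal_sq (a i) z + chordal_sq (a j) z < 1 / M" using M by (simp add: field_simps)
    have "1 \<le> K i j * (chordal_sq (a i) z + chordal_sq (a j) z)" using K ij by blast
    also have "\<dots> \<le> M * (chordal_sq (a i) z + chordal_sq (a j) z)"
      using KM ij chordal_sq_nonneg by (intro mult_right_mono) auto
    also have "\<dots> < M * (1 / M)" using * M by (intro mult_strict_left_mono) auto
    finally show False using M by simp
  qed
  thus ?thesis using M by (intro exI[of _ "1 / (2 * M)"]) auto
qed

text \<open>
  Passage from the sum, for which there is an upper bound in the mean, to the product, whose
  logarithm occurs in Jensen's inequality.
\<close>

lemma prod_chordal_le_sum:
  assumes J: "finite J" "J \<noteq> {}" "inj_on a J"
  defines "x \<equiv> \<lambda>j z. 1 / (chordal_sq (a j) z * (3 - ln (chordal_sq (a j) z))\<^sup>2)"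
  shows "\<exists>K>0. \<forall>z. (\<forall>j\<in>J. form (a j) z \<noteq> 0) \<longrightarrow> (\<Prod>j\<in>J. x j z) \<le> K * (\<Sum>j\<in>J. x j z)"
proof -
  obtain \<eta> where \<eta>: "\<eta> > 0" "\<And>z i j. i \<in> J \<Longrightarrow> j \<in> J \<Longrightarrow> i \<noteq> j \<Longrightarrow> chordal_sq (a i) z \<ge> \<eta> \<or> chordal_sq (a j) z \<ge> \<eta>"
    using chordal_sq_separated[OF J(1,3)] by blast
  show ?thesis
  proof (intro exI[of _ "(1 / \<eta>) ^ (card J - 1)"] conjI allI impI)
    show "(1 / \<eta>) ^ (card J - 1) > 0" using \<eta> by simp
    fix z assume good: "\<forall>j\<in>J. form (a j) z \<noteq> 0"
    have s: "chordal_sq (a j) z > 0" "ln (chordal_sq (a j) z) \<le> 0" if "j \<in> J" for j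
      using chordal_sq_pos[of "a j" z] chordal_sq_le_1[of "a j" z] good that by (auto simp: ln_le_zero_iff)
    have xpos: "x j z > 0" if "j \<in> J" for j
      unfolding x_def using s[OF that] by (intro divide_pos_pos mult_pos_pos zero_less_power) linarith+
    \<comment> \<open>At most one target is close to the image point; every other factor is bounded.\<close>
    obtain j where j: "j \<in> J" "\<And>i. i \<in> J \<Longrightarrow> i \<noteq> j \<Longrightarrow> chordal_sq (a i) z \<ge> \<eta>"
    proof (cases "\<exists>j\<in>J. chordal_sq (a j) z < \<eta>")
      case True
      then obtain j where "j \<in> J" "chordal_sq (a j) z < \<eta>" by blast
      thus thesis using that[of j] \<eta>(2)[of _ j z] by force
    next
      case False
      thus thesis using that J(2) by (meson ex_in_conv not_less)
    qed
    have "(\<Prod>i\<in>J - {j}. x i z) \<le> (\<Prod>i\<in>J - {j}. 1 / \<eta>)"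
    proof (rule prod_mono, intro conjI)
      fix i assume i: "i \<in> J - {j}"
      show "0 \<le> x i z" using xpos[of i] i by simp
      have e: "chordal_sq (a i) z \<ge> \<eta>" using j(2) i by auto
      have "1\<^sup>2 \<le> (3 - ln (chordal_sq (a i) z))\<^sup>2"
        using s(2)[of i] i by (intro power_mono) auto
      hence "\<eta> * 1 \<le> chordal_sq (a i) z * (3 - ln (chordal_sq (a i) z))\<^sup>2"
        using e \<eta>(1) by (intro mult_mono) auto
      thus "x i z \<le> 1 / \<eta>" unfolding x_def using \<eta>(1) by (intro divide_left_mono) auto
    qed
    also have "\<dots> = (1 / \<eta>) ^ (card J - 1)" using J j by simp
    finally have "x j z * (\<Prod>i\<in>J - {j}. x i z) \<le> x j z * (1 / \<eta>) ^ (card J - 1)"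
      using xpos[OF j(1)] by (intro mult_left_mono) auto
    also have "\<dots> \<le> (\<Sum>j\<in>J. x j z) * (1 / \<eta>) ^ (card J - 1)"
      using member_le_sum[OF j(1), of "\<lambda>j. x j z"] xpos J(1) \<eta>(1) less_imp_le
      by (intro mult_right_mono) (auto simp: less_imp_le)
    finally show "(\<Prod>j\<in>J. x j z) \<le> (1 / \<eta>) ^ (card J - 1) * (\<Sum>j\<in>J. x j z)"
      using prod.remove[OF J(1) j(1), of "\<lambda>j. x j z"] by (simp add: mult.commute)
  qed
qed

lemma sphere_map_eq_iff:
  assumes "\<And>z. f z = F1 z / F0 z" "\<And>z. is_pole f z \<longleftrightarrow> F0 z = 0"
  shows "sphere_map f z = b \<longleftrightarrow> form b z = 0"
  using no_common_zero[of z]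
  by (cases b) (auto simp: sphere_map_def assms form_def target_form_def field_simps)

text \<open>
  Let X be the mean of ln (fs_density / product of the squared chordal distances).  Expanding the logarithm
  expresses X by (q - 2) T and the means of the forms and of the Wronskian, and the latter are
  bounded by the counting functions.  In the other direction X exceeds the mean of
  ln (fs_density * product of 1 / (s \<psi>^2)) only by means of 2 ln \<psi>.  By concavity both can be estimated by
  logarithms of means: for the first term by the growth estimate, and for \<psi> = 3 - ln s by
  Jensen's inequality, which gives a multiple of 1 + T.
\<close>

lemma second_main_theorem:
  fixes q :: nat and a :: "nat \<Rightarrow> complex option"
  assumes f: "\<And>z. f z = F1 z / F0 z" and pole: "\<And>z. is_pole f z \<longleftrightarrow> F0 z = 0"
    and q: "q \<ge> 1" and inj: "inj_on a {1..q}"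
  shows "\<exists>C::real. \<forall>\<delta>>0. \<exists>E. E \<in> lmeasurable \<and> {0<..1} \<subseteq> E \<and>
           (\<forall>r\<in>{0<..} - E.
              (real q - 2) * nevanlinna_T f r
                \<le> (\<Sum>j=1..q. nevanlinna_Nbar f r (a j))
                   + C * (1 + max (ln (nevanlinna_T f r)) 0 + max (\<delta> * ln r) 0))"
proof -
  define J where "J = {1..q}"
  have J: "finite J" "J \<noteq> {}" "inj_on a J" "card J = q" using q inj by (auto simp: J_def)
  define m where "m = circle_mean (\<lambda>z. 1/2 * ln (sqnorm z))"
  define M where "M = (\<lambda>g. circle_mean (\<lambda>z. ln (cmod (g z))))"
  define T where "T = nevanlinna_T f"
  define det where "det = (\<lambda>j. cmod (form_det (a j)))"
  have det: "det j \<ge> 1" for j using cmod_form_det_ge_1 by (simp add: det_def)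
  have F0: "\<exists>z. F0 z \<noteq> 0" using form_not_constantly_0[of None] by (simp add: form_def target_form_def)
  have T_eq: "m r = T r + m 1" if "r \<ge> 1" for r
    unfolding m_def T_def sqnorm_def
    using nevanlinna_T_eq_circle_mean[OF hol0 hol1 no_common_zero F0 f pole that] by simp
  have T0: "T r \<ge> 0" for r unfolding T_def by (rule nevanlinna_T_nonneg)
  \<comment> \<open>On a circle whose radius is not in B all logarithms are continuous; B is countable and goes into the exceptional set.\<close>
  define B where "B = cmod ` ({z. wronskian z = 0} \<union> (\<Union>j\<in>J. {z. form (a j) z = 0}))"
  have "\<exists>z. wronskian z \<noteq> 0" using nondegenerate by (simp add: wronskian_def)
  hence B: "countable B"
    unfolding B_def using J(1) entire_zeros(1)[OF hol_wronskian] entire_zeros(1)[OF hol_form form_not_constantly_0]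
    by (intro countable_image countable_Un countable_UN) (auto intro: countable_finite)
  have goodB: "wronskian z \<noteq> 0 \<and> (j \<in> J \<longrightarrow> form (a j) z \<noteq> 0)" if "cmod z \<notin> B" for z j
    using that by (auto simp: B_def)
  \<comment> \<open>The zeros may lie on the unit circle, so the comparison starts at a radius s0 of the interval [1, 2] outside B.\<close>
  have "uncountable {1..2::real}" using uncountable_closed_interval[of 1 "2::real"] by simp
  hence "\<not> {1..2} \<subseteq> B" using B countable_subset by blast
  then obtain s0 where s0: "s0 \<in> {1..2}" "s0 \<notin> B" by blast
  have s01: "s0 \<ge> 1" using s0 by simp
  have good0: "form (a j) z \<noteq> 0" if "cmod z = s0" "j \<in> J" for z j using goodB s0 that by blast
  obtain C0 where C0: "\<And>d. 0 < d \<Longrightarrow> d \<le> 1 \<Longrightarrow> \<exists>E\<in>sets borel. emeasure lborel E \<le> ennreal (2 / d) \<and>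
     (\<forall>r. r \<ge> s0 \<longrightarrow> r \<notin> E \<longrightarrow> (\<forall>z j. cmod z = r \<longrightarrow> j \<in> J \<longrightarrow> form (a j) z \<noteq> 0) \<longrightarrow>
        circle_mean (\<lambda>z. fs_density z * (\<Sum>j\<in>J. 1 / (chordal_sq (a j) z * (3 - ln (chordal_sq (a j) z))\<^sup>2))) r
          \<le> 4 * r powr d * (C0 + 2 * real (card J) * (m r - m s0)) ^ 4)"
    using chordal_average_bound[where a=a, OF J(1) s01 good0] unfolding m_def by blast
  define s where "s = (\<lambda>j. chordal_sq (a j))"
  define \<psi> where "\<psi> = (\<lambda>j z. 3 - ln (s j z))"
  define x where "x = (\<lambda>j z. 1 / (s j z * (\<psi> j z)\<^sup>2))"
  obtain K where K: "K > 0" "\<And>z. (\<And>j. j \<in> J \<Longrightarrow> form (a j) z \<noteq> 0) \<Longrightarrow> (\<Prod>j\<in>J. x j z) \<le> K * (\<Sum>j\<in>J. x j z)"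
    using prod_chordal_le_sum[OF J(1-3)] unfolding x_def \<psi>_def s_def by blast
  define A where "A = 1 + \<bar>C0\<bar> + 2 * real q * (1 + \<bar>m 1\<bar> + \<bar>m s0\<bar>) + 2 + 2 * \<bar>m 1\<bar> + (\<Sum>j\<in>J. \<bar>3 - 2 * M (form (a j)) s0 + ln (det j)\<bar>)"
  have A: "A \<ge> 1" by (simp add: A_def sum_nonneg add_nonneg_nonneg)
  define C1 where "C1 = (\<Sum>j\<in>J. M (form (a j)) s0) - M wronskian s0 - 1/2 * (\<Sum>j\<in>J. ln (det j)) - (real q - 2) * m 1 + 1/2 * ln (4 * K) + (2 + real q) * (ln A + ln 2)"
  define C where "C = \<bar>C1\<bar> + (2 + real q)"
  have main: "(real q - 2) * T r \<le> (\<Sum>j=1..q. nevanlinna_Nbar f r (a j)) + C * (1 + max (ln (T r)) 0 + max (\<delta> * ln r) 0)"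
    if d: "0 < d" "d \<le> \<delta>" and r: "r \<ge> s0" "r \<notin> B" and bound: "circle_mean (\<lambda>z. fs_density z * (\<Sum>j\<in>J. x j z)) r
          \<le> 4 * r powr d * (C0 + 2 * real (card J) * (m r - m s0)) ^ 4" for r d \<delta>
  proof -
    have r1: "r \<ge> 1" using r s01 by simp
    hence r0: "r \<ge> 0" by simp
    have W0: "wronskian z \<noteq> 0" and g0: "\<And>j. j \<in> J \<Longrightarrow> form (a j) z \<noteq> 0" if "cmod z = r" for z
      using goodB[of z] that r by auto
    have sp: "0 < s j z" "s j z \<le> 1" if "cmod z = r" "j \<in> J" for j z
      unfolding s_def using chordal_sq_pos[OF g0[OF that]] chordal_sq_le_1 by auto
    have fp: "fs_density z > 0" if "cmod z = r" for z
      unfolding fs_density_def using W0[OF that] sqnorm_pos[of z] by simp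
    have \<psi>3: "\<psi> j z \<ge> 3" if "cmod z = r" "j \<in> J" for j z
      unfolding \<psi>_def using sp[OF that] by (simp add: ln_le_zero_iff)
    have xp: "x j z > 0" if "cmod z = r" "j \<in> J" for j z
      unfolding x_def using sp[OF that] \<psi>3[OF that] by (intro divide_pos_pos mult_pos_pos zero_less_power) linarith+
    let ?S = "sphere (0::complex) r"
    have nzs: "s j z \<noteq> 0" "\<psi> j z \<noteq> 0" if "z \<in> ?S" "j \<in> J" for j z
      using sp[of z j] \<psi>3[of z j] that by auto
    have c_s: "continuous_on ?S (s j)" for j unfolding s_def by (rule continuous_chordal_sq)
    have c_lns: "continuous_on ?S (\<lambda>z. ln (s j z))" if "j \<in> J" for j
      using nzs that by (intro continuous_on_ln c_s) auto
    have c_\<psi>: "continuous_on ?S (\<psi> j)" if "j \<in> J" for j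
      unfolding \<psi>_def by (intro continuous_intros c_lns that)
    have c_ln\<psi>: "continuous_on ?S (\<lambda>z. ln (\<psi> j z))" if "j \<in> J" for j
      using nzs that by (intro continuous_on_ln c_\<psi>) auto
    have c_x: "continuous_on ?S (x j)" if "j \<in> J" for j
      unfolding x_def using nzs that by (intro continuous_intros c_s c_\<psi>) auto
    have c_g: "continuous_on ?S (\<lambda>z. fs_density z * (\<Sum>j\<in>J. x j z))"
      by (intro continuous_intros continuous_fs_density c_x)
    have gp: "fs_density z * (\<Sum>j\<in>J. x j z) > 0" if "cmod z = r" for z
      using fp[OF that] xp[OF that] J by (intro mult_pos_pos sum_pos) auto
    have Kgp: "K * (fs_density z * (\<Sum>j\<in>J. x j z)) > 0" if "cmod z = r" for z
      by (rule mult_pos_pos[OF K(1) gp[OF that]])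
    have c_lnKg: "continuous_on ?S (\<lambda>z. ln (K * (fs_density z * (\<Sum>j\<in>J. x j z))))"
    proof (intro continuous_on_ln continuous_on_mult_left c_g ballI)
      fix z assume "z \<in> ?S"
      thus "K * (fs_density z * (\<Sum>j\<in>J. x j z)) \<noteq> 0" using Kgp[of z] by (metis less_irrefl mem_sphere_0)
    qed
    have c_fs: "continuous_on ?S (\<lambda>z. ln (fs_density z))"
      using fp by (intro continuous_on_ln continuous_fs_density) (auto simp: less_imp_neq[symmetric])
    have c_hol: "continuous_on ?S (\<lambda>z. ln (cmod (g z)))" if "g holomorphic_on UNIV" "\<And>z. cmod z = r \<Longrightarrow> g z \<noteq> 0" for g
      using that by (intro continuous_intros holomorphic_on_imp_continuous_on holomorphic_on_subset[OF that(1)]) auto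
    have c_W: "continuous_on ?S (\<lambda>z. ln (cmod (wronskian z)))" by (intro c_hol hol_wronskian W0)
    have c_f: "continuous_on ?S (\<lambda>z. ln (cmod (form (a j) z)))" if "j \<in> J" for j
      using g0 that by (intro c_hol hol_form) auto
    have c_q: "continuous_on ?S (\<lambda>z. 1/2 * ln (sqnorm z))"
      using sqnorm_pos by (intro continuous_on_mult_left continuous_on_ln continuous_sqnorm) (auto simp: less_imp_neq[symmetric])
    have ln_s: "ln (s j z) = 2 * ln (cmod (form (a j) z)) - (ln (det j) + 2 * (1/2 * ln (sqnorm z)))" if "cmod z = r" "j \<in> J" for j z
      unfolding s_def chordal_sq_def using g0[OF that] sqnorm_pos[of z] det[of j]
      by (simp add: ln_div ln_mult ln_realpow det_def)
    have ln_fs: "ln (fs_density z) = 2 * ln (cmod (wronskian z)) - 4 * (1/2 * ln (sqnorm z))" if "cmod z = r" for z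
      unfolding fs_density_def using W0[OF that] sqnorm_pos[of z]
      by (simp add: ln_div ln_realpow)
    have mean_ln_s: "circle_mean (\<lambda>z. ln (s j z)) r = 2 * M (form (a j)) r - (ln (det j) + 2 * m r)" if j: "j \<in> J" for j
    proof -
      have "circle_mean (\<lambda>z. ln (s j z)) r = circle_mean (\<lambda>z. 2 * ln (cmod (form (a j) z)) - (ln (det j) + 2 * (1/2 * ln (sqnorm z)))) r"
        by (rule circle_mean_cong[OF ln_s[OF _ j] r0])
      also have "\<dots> = 2 * M (form (a j)) r - (ln (det j) + 2 * m r)"
        unfolding circle_mean_diff[OF continuous_on_mult_left[OF c_f[OF j]] continuous_on_add[OF continuous_on_const continuous_on_mult_left[OF c_q]] r0]
          circle_mean_add[OF continuous_on_const continuous_on_mult_left[OF c_q] r0] circle_mean_cmult[of 2] circle_mean_const M_def m_def ..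
      finally show ?thesis .
    qed
    have mean_ln_fs: "circle_mean (\<lambda>z. ln (fs_density z)) r = 2 * M wronskian r - 4 * m r"
    proof -
      have "circle_mean (\<lambda>z. ln (fs_density z)) r = circle_mean (\<lambda>z. 2 * ln (cmod (wronskian z)) - 4 * (1/2 * ln (sqnorm z))) r"
        by (rule circle_mean_cong[OF ln_fs r0])
      also have "\<dots> = 2 * M wronskian r - 4 * m r"
        unfolding circle_mean_diff[OF continuous_on_mult_left[OF c_W] continuous_on_mult_left[OF c_q] r0]
          circle_mean_cmult[of 2] circle_mean_cmult[of 4] M_def m_def ..
      finally show ?thesis .
    qed
    define X where "X = circle_mean (\<lambda>z. ln (fs_density z) - (\<Sum>j\<in>J. ln (s j z))) r"
    have X_eq: "X = 2 * M wronskian r - 2 * (\<Sum>j\<in>J. M (form (a j)) r) + 2 * (real q - 2) * m r + (\<Sum>j\<in>J. ln (det j))"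
    proof -
      have c: "continuous_on ?S (\<lambda>z. \<Sum>j\<in>J. ln (s j z))" by (intro continuous_on_sum c_lns)
      have sum: "circle_mean (\<lambda>z. \<Sum>j\<in>J. ln (s j z)) r = (\<Sum>j\<in>J. circle_mean (\<lambda>z. ln (s j z)) r)"
        by (rule circle_mean_sum[OF c_lns r0])
      have "X = circle_mean (\<lambda>z. ln (fs_density z)) r - (\<Sum>j\<in>J. circle_mean (\<lambda>z. ln (s j z)) r)"
        unfolding X_def circle_mean_diff[OF c_fs c r0] sum ..
      also have "\<dots> = 2 * M wronskian r - 4 * m r - (\<Sum>j\<in>J. 2 * M (form (a j)) r - (ln (det j) + 2 * m r))"
        unfolding mean_ln_fs by (simp add: mean_ln_s)
      finally show ?thesis
        by (simp add: sum_subtractf sum.distrib sum_distrib_left J(4) algebra_simps)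
    qed
    have count: "(\<Sum>j\<in>J. M (form (a j)) r) - M wronskian r \<le> (\<Sum>j\<in>J. M (form (a j)) s0) - M wronskian s0 + (\<Sum>j\<in>J. nevanlinna_Nbar f r (a j))"
    proof -
      have "(\<Sum>j\<in>J. M (form (a j)) r) - M wronskian r \<le> (\<Sum>j\<in>J. M (form (a j)) s0) - M wronskian s0
          + (\<Sum>j\<in>J. \<Sum>z\<in>{z\<in>ball 0 r. form (a j) z = 0}. ln r - ln (max s0 (cmod z)))"
        unfolding M_def by (rule circle_mean_ln_forms_le[OF J(1,3)]) (use s0 r goodB in auto)
      also have "(\<Sum>j\<in>J. \<Sum>z\<in>{z\<in>ball 0 r. form (a j) z = 0}. ln r - ln (max s0 (cmod z))) \<le> (\<Sum>j\<in>J. nevanlinna_Nbar f r (a j))"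
      proof (rule sum_mono)
        fix j
        show "(\<Sum>z\<in>{z\<in>ball 0 r. form (a j) z = 0}. ln r - ln (max s0 (cmod z))) \<le> nevanlinna_Nbar f r (a j)"
          by (rule nevanlinna_Nbar_ge[OF entire_zeros(2)[OF hol_form form_not_constantly_0] _ s01 r(1)])
             (simp add: sphere_map_eq_iff[OF f pole])
      qed
      finally show ?thesis by simp
    qed
    define y where "y = A * (1 + T r)"
    have y1: "y \<ge> 1" using A T0[of r] mult_mono[of 1 A 1 "1 + T r"] by (simp add: y_def)
    have mean_\<psi>: "circle_mean (\<psi> j) r \<le> y" if j: "j \<in> J" for j
    proof -
      have "circle_mean (\<psi> j) r = 3 - circle_mean (\<lambda>z. ln (s j z)) r"
        unfolding \<psi>_def circle_mean_diff[OF continuous_on_const c_lns[OF j] r0] circle_mean_const ..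
      also have "\<dots> = 3 - 2 * M (form (a j)) r + ln (det j) + 2 * m r"
        unfolding mean_ln_s[OF j] by simp
      also have "M (form (a j)) s0 \<le> M (form (a j)) r"
        unfolding M_def
        by (rule circle_mean_ln_holomorphic_mono[of _ "r + 1", OF holomorphic_on_subset[OF hol_form]])
           (use s01 r good0 g0 j in auto)
      hence "3 - 2 * M (form (a j)) r + ln (det j) + 2 * m r \<le> (3 - 2 * M (form (a j)) s0 + ln (det j)) + 2 * T r + 2 * m 1"
        using T_eq[OF r1] by simp
      also have "\<dots> \<le> \<bar>3 - 2 * M (form (a j)) s0 + ln (det j)\<bar> + 2 * T r + 2 * \<bar>m 1\<bar>" by linarith
      also have "\<bar>3 - 2 * M (form (a j)) s0 + ln (det j)\<bar> \<le> (\<Sum>j\<in>J. \<bar>3 - 2 * M (form (a j)) s0 + ln (det j)\<bar>)"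
        using j J(1) by (intro member_le_sum) auto
      finally have "circle_mean (\<psi> j) r \<le> (\<Sum>j\<in>J. \<bar>3 - 2 * M (form (a j)) s0 + ln (det j)\<bar>) + 2 * T r + 2 * \<bar>m 1\<bar>"
        by simp
      also have "\<dots> \<le> A + A * T r"
      proof -
        have "2 \<le> A" by (simp add: A_def sum_nonneg add_nonneg_nonneg)
        hence "2 * T r \<le> A * T r" using T0 by (intro mult_right_mono)
        moreover have "(\<Sum>j\<in>J. \<bar>3 - 2 * M (form (a j)) s0 + ln (det j)\<bar>) + 2 * \<bar>m 1\<bar> \<le> A"
          by (simp add: A_def add_nonneg_nonneg)
        ultimately show ?thesis by linarith
      qed
      finally show ?thesis by (simp add: y_def algebra_simps)
    qed
    have V: "\<bar>C0 + 2 * real (card J) * (m r - m s0)\<bar> \<le> y"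
    proof -
      have "2 * real q * (m r - m s0) = 2 * real q * T r + 2 * real q * (m 1 - m s0)"
        unfolding T_eq[OF r1] by (simp add: algebra_simps)
      moreover have "2 * real q * \<bar>m 1 - m s0\<bar> \<le> 2 * real q * (\<bar>m 1\<bar> + \<bar>m s0\<bar>)"
        by (intro mult_left_mono) auto
      moreover have "\<bar>2 * real q * (m 1 - m s0)\<bar> = 2 * real q * \<bar>m 1 - m s0\<bar>" by (simp add: abs_mult)
      moreover have "0 \<le> 2 * real q * T r" using T0 by simp
      ultimately have "\<bar>C0 + 2 * real q * (m r - m s0)\<bar> \<le> \<bar>C0\<bar> + 2 * real q * T r + 2 * real q * (\<bar>m 1\<bar> + \<bar>m s0\<bar>)"
        by linarith
      also have "\<dots> \<le> A * T r + A"
      proof -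
        have "2 * real q \<le> A" by (simp add: A_def sum_nonneg add_nonneg_nonneg algebra_simps)
        hence "2 * real q * T r \<le> A * T r" using T0 by (intro mult_right_mono)
        moreover have "\<bar>C0\<bar> + 2 * real q * (\<bar>m 1\<bar> + \<bar>m s0\<bar>) \<le> A"
          by (simp add: A_def sum_nonneg add_nonneg_nonneg algebra_simps)
        ultimately show ?thesis by linarith
      qed
      finally show ?thesis by (simp add: y_def J(4) algebra_simps)
    qed
    have "X \<le> circle_mean (\<lambda>z. ln (K * (fs_density z * (\<Sum>j\<in>J. x j z))) + (\<Sum>j\<in>J. 2 * ln (\<psi> j z))) r"
      unfolding X_def
    proof (rule circle_mean_mono[OF continuous_on_diff[OF c_fs continuous_on_sum[OF c_lns]] _ r0])
      show "continuous_on ?S (\<lambda>z. ln (K * (fs_density z * (\<Sum>j\<in>J. x j z))) + (\<Sum>j\<in>J. 2 * ln (\<psi> j z)))"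
        by (intro continuous_on_add continuous_on_sum continuous_on_mult_left c_ln\<psi> c_lnKg)
      fix z assume z: "cmod z = r"
      have "(\<Sum>j\<in>J. ln (x j z)) = (\<Sum>j\<in>J. - ln (s j z) - 2 * ln (\<psi> j z))"
      proof (rule sum.cong[OF refl])
        fix j assume j: "j \<in> J"
        show "ln (x j z) = - ln (s j z) - 2 * ln (\<psi> j z)"
          unfolding x_def using sp[OF z j] \<psi>3[OF z j] by (simp add: ln_div ln_mult ln_realpow)
      qed
      hence "ln (fs_density z) - (\<Sum>j\<in>J. ln (s j z)) = ln (fs_density z) + (\<Sum>j\<in>J. ln (x j z)) + (\<Sum>j\<in>J. 2 * ln (\<psi> j z))"
        by (simp add: sum_subtractf sum_negf)
      also have "(\<Sum>j\<in>J. ln (x j z)) = ln (\<Prod>j\<in>J. x j z)"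
        using xp[OF z] J(1) by (intro ln_prod[symmetric]) fastforce+
      also have "ln (fs_density z) + ln (\<Prod>j\<in>J. x j z) = ln (fs_density z * (\<Prod>j\<in>J. x j z))"
        using fp[OF z] prod_pos[of J "\<lambda>j. x j z"] xp[OF z] by (simp add: ln_mult)
      also have "\<dots> \<le> ln (K * (fs_density z * (\<Sum>j\<in>J. x j z)))"
      proof (rule ln_mono)
        show "0 < fs_density z * (\<Prod>j\<in>J. x j z)" using fp[OF z] xp[OF z] by (intro mult_pos_pos prod_pos) auto
        have "fs_density z * (\<Prod>j\<in>J. x j z) \<le> fs_density z * (K * (\<Sum>j\<in>J. x j z))"
          using fp[OF z] K(2)[OF g0[OF z]] by (intro mult_left_mono) auto
        thus "fs_density z * (\<Prod>j\<in>J. x j z) \<le> K * (fs_density z * (\<Sum>j\<in>J. x j z))" by (simp add: algebra_simps)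
      qed
      finally show "ln (fs_density z) - (\<Sum>j\<in>J. ln (s j z)) \<le> ln (K * (fs_density z * (\<Sum>j\<in>J. x j z))) + (\<Sum>j\<in>J. 2 * ln (\<psi> j z))"
        by simp
    qed
    also have "\<dots> = circle_mean (\<lambda>z. ln (K * (fs_density z * (\<Sum>j\<in>J. x j z)))) r + (\<Sum>j\<in>J. 2 * circle_mean (\<lambda>z. ln (\<psi> j z)) r)"
    proof -
      have c2: "continuous_on ?S (\<lambda>z. \<Sum>j\<in>J. 2 * ln (\<psi> j z))"
        by (intro continuous_on_sum continuous_on_mult_left c_ln\<psi>)
      have sum: "circle_mean (\<lambda>z. \<Sum>j\<in>J. 2 * ln (\<psi> j z)) r = (\<Sum>j\<in>J. circle_mean (\<lambda>z. 2 * ln (\<psi> j z)) r)"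
        by (rule circle_mean_sum[OF continuous_on_mult_left[OF c_ln\<psi>] r0])
      show ?thesis
        unfolding circle_mean_add[OF c_lnKg c2 r0] sum circle_mean_cmult ..
    qed
    also have "circle_mean (\<lambda>z. ln (K * (fs_density z * (\<Sum>j\<in>J. x j z)))) r \<le> ln (4 * K) + d * ln r + 4 * ln y"
    proof -
      have p: "0 < circle_mean (\<lambda>z. K * (fs_density z * (\<Sum>j\<in>J. x j z))) r"
        "circle_mean (\<lambda>z. ln (K * (fs_density z * (\<Sum>j\<in>J. x j z)))) r \<le> ln (circle_mean (\<lambda>z. K * (fs_density z * (\<Sum>j\<in>J. x j z))) r)"
        by (rule circle_mean_ln_le[OF continuous_on_mult_left[OF c_g] r0 Kgp], assumption)+
      have "circle_mean (\<lambda>z. K * (fs_density z * (\<Sum>j\<in>J. x j z))) r \<le> K * (4 * r powr d * (C0 + 2 * real (card J) * (m r - m s0)) ^ 4)"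
        unfolding circle_mean_cmult using bound K(1) by (intro mult_left_mono) auto
      also have "(C0 + 2 * real (card J) * (m r - m s0)) ^ 4 = \<bar>C0 + 2 * real (card J) * (m r - m s0)\<bar> ^ 4"
        by simp
      also have "K * (4 * r powr d * \<bar>C0 + 2 * real (card J) * (m r - m s0)\<bar> ^ 4) \<le> K * (4 * r powr d * y ^ 4)"
        using V K(1) by (intro mult_left_mono power_mono) auto
      finally have "ln (circle_mean (\<lambda>z. K * (fs_density z * (\<Sum>j\<in>J. x j z))) r) \<le> ln (K * (4 * r powr d * y ^ 4))"
        using p(1) by (intro ln_mono)
      also have "\<dots> = ln (4 * K) + d * ln r + 4 * ln y"
        using K(1) r1 y1 by (simp add: ln_mult ln_powr ln_realpow)
      finally show ?thesis using p(2) by linarith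
    qed
    also have "(\<Sum>j\<in>J. 2 * circle_mean (\<lambda>z. ln (\<psi> j z)) r) \<le> (\<Sum>j\<in>J. 2 * ln y)"
    proof (rule sum_mono)
      fix j assume j: "j \<in> J"
      have pos: "\<psi> j z > 0" if "cmod z = r" for z using \<psi>3[OF that j] by simp
      have "circle_mean (\<lambda>z. ln (\<psi> j z)) r \<le> ln (circle_mean (\<psi> j) r)"
        by (rule circle_mean_ln_le(2)[OF c_\<psi>[OF j] r0 pos])
      also have "\<dots> \<le> ln y"
        using mean_\<psi>[OF j] circle_mean_ln_le(1)[OF c_\<psi>[OF j] r0 pos] by (intro ln_mono)
      finally show "2 * circle_mean (\<lambda>z. ln (\<psi> j z)) r \<le> 2 * ln y" by simp
    qed
    finally have X_le: "X \<le> ln (4 * K) + d * ln r + (4 + 2 * real q) * ln y"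
      by (simp add: J(4) algebra_simps)
    have lny: "ln y \<le> ln A + ln 2 + max (ln (T r)) 0"
      unfolding y_def using T0 A by (intro ln_one_plus_le) auto
    have dr: "d * ln r \<le> max (\<delta> * ln r) 0"
      using d r1 by (intro max.coboundedI1 mult_right_mono) auto
    have "(2 + real q) * ln y \<le> (2 + real q) * (ln A + ln 2) + (2 + real q) * max (ln (T r)) 0"
      using lny mult_left_mono[of "ln y" "ln A + ln 2 + max (ln (T r)) 0" "2 + real q"] by (simp add: algebra_simps)
    moreover have "(real q - 2) * T r = 1/2 * X + ((\<Sum>j\<in>J. M (form (a j)) r) - M wronskian r) - 1/2 * (\<Sum>j\<in>J. ln (det j)) - (real q - 2) * m 1"
      unfolding X_eq T_eq[OF r1] by (simp add: algebra_simps)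
    moreover have "1/2 * X \<le> 1/2 * ln (4 * K) + 1/2 * (d * ln r) + (2 + real q) * ln y"
      using X_le by (simp add: algebra_simps)
    ultimately have "(real q - 2) * T r \<le> (\<Sum>j\<in>J. nevanlinna_Nbar f r (a j)) + (C1 + (2 + real q) * max (ln (T r)) 0 + 1/2 * (d * ln r))"
      using count unfolding C1_def by linarith
    also have "C1 + (2 + real q) * max (ln (T r)) 0 + 1/2 * (d * ln r) \<le> C * (1 + max (ln (T r)) 0 + max (\<delta> * ln r) 0)"
    proof -
      have "C1 \<le> C" by (simp add: C_def)
      moreover have "(2 + real q) * max (ln (T r)) 0 \<le> C * max (ln (T r)) 0" by (intro mult_right_mono) (auto simp: C_def)
      moreover have "1/2 * (d * ln r) \<le> C * max (\<delta> * ln r) 0"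
      proof -
        have "1/2 * (d * ln r) \<le> 1 * max (\<delta> * ln r) 0" using dr by simp
        also have "\<dots> \<le> C * max (\<delta> * ln r) 0" by (intro mult_right_mono) (auto simp: C_def)
        finally show ?thesis .
      qed
      ultimately show ?thesis by (simp add: algebra_simps)
    qed
    finally show ?thesis by (simp add: J_def)
  qed
  show ?thesis
  proof (intro exI[of _ C] allI impI)
    fix \<delta> :: real assume \<delta>: "\<delta> > 0"
    define d where "d = min \<delta> 1"
    have d: "0 < d" "d \<le> 1" "d \<le> \<delta>" using \<delta> by (auto simp: d_def)
    obtain E where E: "E \<in> sets borel" "emeasure lborel E \<le> ennreal (2 / d)"
      "\<And>r. r \<ge> s0 \<Longrightarrow> r \<notin> E \<Longrightarrow> (\<forall>z j. cmod z = r \<longrightarrow> j \<in> J \<longrightarrow> form (a j) z \<noteq> 0) \<Longrightarrow>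
        circle_mean (\<lambda>z. fs_density z * (\<Sum>j\<in>J. x j z)) r \<le> 4 * r powr d * (C0 + 2 * real (card J) * (m r - m s0)) ^ 4"
      using C0[OF d(1,2)] unfolding x_def \<psi>_def s_def by blast
    have "E \<in> lmeasurable"
    proof (rule fmeasurableI)
      show "E \<in> sets lebesgue" using E(1) by simp
      have "emeasure lebesgue E = emeasure lborel E" using E(1) by simp
      also have "\<dots> < \<infinity>" using E(2) by (simp add: order.strict_trans1)
      finally show "emeasure lebesgue E < \<infinity>" .
    qed
    moreover have "B \<in> lmeasurable"
      by (intro fmeasurableI_null_sets null_sets_completionI countable_imp_null_set_lborel B)
    ultimately have "{0..s0} \<union> (E \<union> B) \<in> lmeasurable"
      by (intro fmeasurable.Un) auto
    moreover have "{0<..1} \<subseteq> {0..s0} \<union> (E \<union> B)" using s01 by auto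
    moreover have "(real q - 2) * nevanlinna_T f r \<le> (\<Sum>j=1..q. nevanlinna_Nbar f r (a j))
                   + C * (1 + max (ln (nevanlinna_T f r)) 0 + max (\<delta> * ln r) 0)"
      if r: "r \<in> {0<..} - ({0..s0} \<union> (E \<union> B))" for r
    proof -
      have r': "r \<ge> s0" "r \<notin> E" "r \<notin> B" using r by auto
      show ?thesis
        using main[OF d(1) d(3) r'(1,3) E(3)[OF r'(1,2)]] goodB r' unfolding T_def by blast
    qed
    ultimately show "\<exists>E. E \<in> lmeasurable \<and> {0<..1} \<subseteq> E \<and>
           (\<forall>r\<in>{0<..} - E. (real q - 2) * nevanlinna_T f r \<le> (\<Sum>j=1..q. nevanlinna_Nbar f r (a j))
                   + C * (1 + max (ln (nevanlinna_T f r)) 0 + max (\<delta> * ln r) 0))"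
      by blast
  qed
qed

end

text \<open>
  If the Wronskian vanished identically, F1 would be a constant multiple of F0, near a point where
  F0 is nonzero and hence everywhere.
\<close>

lemma reduced_liftI:
  assumes f: "\<not> f constant_on UNIV" and hol: "F0 holomorphic_on UNIV" "F1 holomorphic_on UNIV"
    and nz: "\<And>z. F0 z \<noteq> 0 \<or> F1 z \<noteq> 0" and quot: "\<And>z. f z = F1 z / F0 z"
  shows "reduced_lift F0 F1"
proof
  show "\<exists>z. F0 z * deriv F1 z - deriv F0 z * F1 z \<noteq> 0"
  proof (rule ccontr)
    assume "\<not> ?thesis"
    hence W: "F0 z * deriv F1 z - deriv F0 z * F1 z = 0" for z by simp
    have "\<exists>z0. F0 z0 \<noteq> 0"
    proof (rule ccontr)
      assume "\<not> ?thesis"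
      hence "f z = 0" for z using quot[of z] by simp
      thus False using f by (auto simp: constant_on_def)
    qed
    then obtain z0 where z0: "F0 z0 \<noteq> 0" by blast
    have "isCont F0 z0"
      using hol(1) by (meson UNIV_I continuous_on_eq_continuous_at holomorphic_on_imp_continuous_on open_UNIV)
    then obtain e where e: "e > 0" "\<And>z. dist z0 z < e \<Longrightarrow> F0 z \<noteq> 0"
      using continuous_at_avoid[of z0 F0 0] z0 by blast
    have d: "((\<lambda>z. F1 z / F0 z) has_field_derivative 0) (at z)" if "z \<in> ball z0 e" for z
    proof -
      have "((\<lambda>z. F1 z / F0 z) has_field_derivative (deriv F1 z * F0 z - F1 z * deriv F0 z) / (F0 z * F0 z)) (at z)"
        using hol e(2)[of z] that by (intro DERIV_divide holomorphic_derivI[of _ UNIV]) auto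
      also have "deriv F1 z * F0 z - F1 z * deriv F0 z = 0" using W[of z] by (simp add: mult.commute)
      finally show ?thesis by simp
    qed
    obtain c where c: "\<And>z. z \<in> ball z0 e \<Longrightarrow> F1 z / F0 z = c"
      using has_field_derivative_zero_constant[of "ball z0 e" "\<lambda>z. F1 z / F0 z"] d
      by (meson convex_ball has_field_derivative_at_within)
    have "F1 z = c * F0 z" for z
    proof (rule analytic_continuation_open[of "ball z0 e" UNIV F1 "\<lambda>z. c * F0 z"])
      show "F1 w = c * F0 w" if "w \<in> ball z0 e" for w
        using c[OF that] e(2)[of w] that by auto
    qed (use e hol in \<open>auto intro!: holomorphic_intros Convex.connected_UNIV\<close>)
    hence "f z = c" for z using nz[of z] quot[of z] by auto
    thus False using f by (auto simp: constant_on_def)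
  qed
qed (use hol nz in auto)

theorem corollaryI:
  fixes f :: "complex \<Rightarrow> complex" and q :: nat and a :: "nat \<Rightarrow> complex option"
  assumes "f nicely_meromorphic_on UNIV"
    and "\<not> f constant_on UNIV"
    and "inj_on a {1..q}"
  shows "\<exists>C::real. \<forall>\<delta>>0. \<exists>E. E \<in> lmeasurable \<and> {0<..1} \<subseteq> E \<and>
           (\<forall>r\<in>{0<..} - E.
              (real q - 2) * nevanlinna_T f r
                \<le> (\<Sum>j=1..q. nevanlinna_Nbar f r (a j))
                   + C * (1 + max (ln (nevanlinna_T f r)) 0 + max (\<delta> * ln r) 0))"
proof (cases "q \<ge> 1")
  case True
  obtain h f1 f2 where fact: "h holomorphic_on UNIV" "f1 holomorphic_on UNIV" "f2 holomorphic_on UNIV"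
    "\<forall>z. f1 z = 0 \<longleftrightarrow> \<not> is_pole f z \<and> f z = 0" "\<forall>z. f2 z = 0 \<longleftrightarrow> is_pole f z"
    "\<forall>z. h z \<noteq> 0" "\<forall>z. f z = h z * f1 z / f2 z"
    using weierstrass_factorization_meromorphic_UNIV[OF assms(1)] by metis
  interpret reduced_lift f2 "\<lambda>z. h z * f1 z"
    by (rule reduced_liftI[OF assms(2)]) (use fact in \<open>auto intro!: holomorphic_intros\<close>)
  show ?thesis
    by (rule second_main_theorem[OF _ _ True assms(3)]) (use fact in auto)
next
  case False
  hence "q = 0" by simp
  hence "(real q - 2) * nevanlinna_T f r \<le> (\<Sum>j=1..q. nevanlinna_Nbar f r (a j)) + 0 * x" for r x
    using nevanlinna_T_nonneg[of f r] by simp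
  moreover have "{0..1::real} \<in> lmeasurable" "{0<..1::real} \<subseteq> {0..1}" by auto
  ultimately show ?thesis by blast
qed

end
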